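(* The Riemann surface $\Omega_{\mathbb{Z}}$ is uniformized (onto the unit disk $\mathbb{D}$) by $\psi=\phi^{-1}$, where $$\phi=\frac{1}{2\pi i}\ln(1-q^{-1}),$$ with $q^{-1}$ the inverse function of the elliptic nome function $q(\omega)=e^{-\pi\,\mathbb{K}(1-\omega)/\mathbb{K}(\omega)}$.
   Context: $\Omega_{\mathbb{Z}}$ is the set of equivalence classes of curves starting at $0$, modulo homotopies in $\mathbb{C}\setminus\mathbb{Z}$ (the curves start at $0$ and otherwise avoid $\mathbb{Z}$), together with the origin itself on the first sheet; so $0$ is a regular point on the first sheet and a puncture on the other sheets. $\mathbb{K}(m)=\frac{\pi}{2}\,{}_2F_1(\tfrac12,\tfrac12;1;m)$ is the complete elliptic integral of the first kind as a function of $m=k^2$. The function $q^{-1}$ is the compositional inverse of $q$ (not $1/q$); it is analytic in $\mathbb{D}$ with $q^{-1}(z)=16z-128z^2+704z^3+\cdots$ near $0$. The logarithm is the branch with $\ln 1=0$ at $z=0$, continued analytically. *)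

theory Defs
  imports "HOL-Analysis.Analysis"
begin

section \<open>Riemann surfaces\<close>

text \<open>An atlas is a set of pairs (domain, chart map) on an abstract topological space; only the
  values of a chart map on its domain matter.\<close>

definition complex_atlas :: "'a topology \<Rightarrow> ('a set \<times> ('a \<Rightarrow> complex)) set \<Rightarrow> bool" where
  "complex_atlas X A \<longleftrightarrow>
     (\<forall>(U, f) \<in> A. openin X U \<and> open (f ` U) \<and>
        homeomorphic_map (subtopology X U) (top_of_set (f ` U)) f) \<and>
     (\<Union>(U, f) \<in> A. U) = topspace X \<and>
     (\<forall>(U, f) \<in> A. \<forall>(V, g) \<in> A. (g \<circ> inv_into U f) holomorphic_on f ` (U \<inter> V))"

definition riemann_surface :: "'a topology \<Rightarrow> ('a set \<times> ('a \<Rightarrow> complex)) set \<Rightarrow> bool" where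
  "riemann_surface X A \<longleftrightarrow>
     topspace X \<noteq> {} \<and> connected_space X \<and> Hausdorff_space X \<and> complex_atlas X A"

definition holomorphic_between ::
  "'a topology \<Rightarrow> ('a set \<times> ('a \<Rightarrow> complex)) set \<Rightarrow>
   'b topology \<Rightarrow> ('b set \<times> ('b \<Rightarrow> complex)) set \<Rightarrow> ('a \<Rightarrow> 'b) \<Rightarrow> bool" where
  "holomorphic_between X A Y B h \<longleftrightarrow>
     continuous_map X Y h \<and>
     (\<forall>(U, f) \<in> A. \<forall>(V, g) \<in> B. (g \<circ> h \<circ> inv_into U f) holomorphic_on f ` (U \<inter> h -` V))"

definition biholomorphic_between ::
  "'a topology \<Rightarrow> ('a set \<times> ('a \<Rightarrow> complex)) set \<Rightarrow>
   'b topology \<Rightarrow> ('b set \<times> ('b \<Rightarrow> complex)) set \<Rightarrow> ('a \<Rightarrow> 'b) \<Rightarrow> bool" where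
  "biholomorphic_between X A Y B h \<longleftrightarrow>
     bij_betw h (topspace X) (topspace Y) \<and>
     holomorphic_between X A Y B h \<and>
     holomorphic_between Y B X A (inv_into (topspace X) h)"

definition disc_topology :: "complex topology" where
  "disc_topology = top_of_set (ball 0 1)"

definition disc_atlas :: "(complex set \<times> (complex \<Rightarrow> complex)) set" where
  "disc_atlas = {(ball 0 1, \<lambda>z. z)}"


section \<open>The surface \<open>\<Omega>\<^sub>\<int>\<close>\<close>

text \<open>The constant curve, which represents the origin on the first sheet, is the only curve
  that meets an integer after its starting point.\<close>

definition Omega_curves :: "(real \<Rightarrow> complex) set" where
  "Omega_curves = {\<gamma>. path \<gamma> \<and> pathstart \<gamma> = 0 \<and>
     ((\<forall>t\<in>{0<..1}. \<gamma> t \<notin> \<int>) \<or> (\<forall>t\<in>{0..1}. \<gamma> t = 0))}"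

text \<open>Homotopies fix both endpoints and run through admissible curves. As the starting point
  is \<open>0\<close> itself, the number of turns a curve makes around \<open>0\<close> immediately after its start is not a
  homotopy invariant, so \<open>0\<close> is not a branch point on the first sheet.\<close>

definition Omega_homotopic :: "((real \<Rightarrow> complex) \<times> (real \<Rightarrow> complex)) set" where
  "Omega_homotopic = {(\<gamma>, \<delta>). \<gamma> \<in> Omega_curves \<and> \<delta> \<in> Omega_curves \<and>
     homotopic_with_canon (\<lambda>r. r \<in> Omega_curves \<and> pathfinish r = pathfinish \<gamma>)
       {0..1} UNIV \<gamma> \<delta>}"

definition Omega :: "(real \<Rightarrow> complex) set set" where
  "Omega = Omega_curves // Omega_homotopic"

definition Omega_origin :: "(real \<Rightarrow> complex) set" where
  "Omega_origin = Omega_homotopic `` {\<lambda>_. 0}"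

text \<open>The common endpoint of the curves of a class, i.e. the projection of the surface to
  the complex plane.\<close>

definition Omega_proj :: "(real \<Rightarrow> complex) set \<Rightarrow> complex" where
  "Omega_proj P = the_elem (pathfinish ` P)"

text \<open>The points reached by continuing curves of the class \<open>P\<close> inside the ball of radius \<open>r\<close>
  around the endpoint. Splitting a longer curve, instead of joining two curves, also covers the
  origin, where the curve that is continued is constant (\<open>s = 0\<close>).\<close>

definition Omega_nbhd :: "(real \<Rightarrow> complex) set \<Rightarrow> real \<Rightarrow> (real \<Rightarrow> complex) set set" where
  "Omega_nbhd P r = {Q \<in> Omega. \<exists>\<delta>\<in>Q. \<exists>s\<in>{0..1}.
     subpath 0 s \<delta> \<in> P \<and> path_image (subpath s 1 \<delta>) \<subseteq> ball (Omega_proj P) r}"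

definition Omega_topology :: "(real \<Rightarrow> complex) set topology" where
  "Omega_topology = topology (\<lambda>U. U \<subseteq> Omega \<and> (\<forall>P\<in>U. \<exists>r>0. Omega_nbhd P r \<subseteq> U))"

lemma openin_Omega_topology:
  "openin Omega_topology U \<longleftrightarrow> U \<subseteq> Omega \<and> (\<forall>P\<in>U. \<exists>r>0. Omega_nbhd P r \<subseteq> U)"
proof -
  have mono: "Omega_nbhd P r \<subseteq> Omega_nbhd P r'" if "r \<le> r'" for P r r'
    using subset_ball[OF that, of "Omega_proj P"] unfolding Omega_nbhd_def by blast
  have "istopology (\<lambda>U. U \<subseteq> Omega \<and> (\<forall>P\<in>U. \<exists>r>0. Omega_nbhd P r \<subseteq> U))"
    unfolding istopology_def
  proof (intro conjI allI impI ballI)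
    fix S T P
    assume S: "S \<subseteq> Omega \<and> (\<forall>P\<in>S. \<exists>r>0. Omega_nbhd P r \<subseteq> S)"
      and T: "T \<subseteq> Omega \<and> (\<forall>P\<in>T. \<exists>r>0. Omega_nbhd P r \<subseteq> T)"
    then show "S \<inter> T \<subseteq> Omega" by blast
    assume "P \<in> S \<inter> T"
    with S T obtain r r' where "r > 0" "Omega_nbhd P r \<subseteq> S" "r' > 0" "Omega_nbhd P r' \<subseteq> T"
      by blast
    then have "min r r' > 0 \<and> Omega_nbhd P (min r r') \<subseteq> S \<inter> T"
      using mono[of "min r r'" r P] mono[of "min r r'" r' P] by auto
    then show "\<exists>r>0. Omega_nbhd P r \<subseteq> S \<inter> T" by blast
  next
    fix K P
    assume K: "\<forall>U\<in>K. U \<subseteq> Omega \<and> (\<forall>P\<in>U. \<exists>r>0. Omega_nbhd P r \<subseteq> U)"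
    then show "\<Union>K \<subseteq> Omega" by blast
    assume "P \<in> \<Union>K"
    then obtain U where "U \<in> K" "P \<in> U" by blast
    with K obtain r where "r > 0" "Omega_nbhd P r \<subseteq> U" by blast
    with \<open>U \<in> K\<close> show "\<exists>r>0. Omega_nbhd P r \<subseteq> \<Union>K" by blast
  qed
  then show ?thesis unfolding Omega_topology_def by simp
qed

text \<open>The complex structure for which the projection is locally biholomorphic.\<close>

definition Omega_atlas ::
  "((real \<Rightarrow> complex) set set \<times> ((real \<Rightarrow> complex) set \<Rightarrow> complex)) set" where
  "Omega_atlas = {(U, Omega_proj) | U. openin Omega_topology U \<and> open (Omega_proj ` U) \<and>
     homeomorphic_map (subtopology Omega_topology U) (top_of_set (Omega_proj ` U)) Omega_proj}"


section \<open>The elliptic nome and its inverse\<close>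

text \<open>The hypergeometric series converges for \<open>norm m < 1\<close>, so that \<open>nome\<close> is given by its
  defining formula on the lens \<open>ball 0 1 \<inter> ball 1 1\<close>, which contains the real interval from
  0 to 1. Values outside the lens are not used.\<close>

definition ellK :: "complex \<Rightarrow> complex" where
  "ellK m = of_real pi / 2 * eval_fps (fps_hypergeo [1/2, 1/2] [1] 1) m"

definition nome :: "complex \<Rightarrow> complex" where
  "nome \<omega> = exp (- of_real pi * ellK (1 - \<omega>) / ellK \<omega>)"

definition is_nome_inverse :: "(complex \<Rightarrow> complex) \<Rightarrow> bool" where
  "is_nome_inverse f \<longleftrightarrow> f holomorphic_on ball 0 1 \<and>
     (\<forall>\<omega> \<in> ball 0 1 \<inter> ball 1 1. nome \<omega> \<in> ball 0 1 \<and> f (nome \<omega>) = \<omega>)"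

text \<open>By the identity theorem the choice is unique on the unit disc.\<close>

definition nome_inv :: "complex \<Rightarrow> complex" where
  "nome_inv = (SOME f. is_nome_inverse f)"

text \<open>The analytic continuation to the disc of the principal branch of
  \<open>ln (1 - nome_inv z)\<close> at \<open>z = 0\<close>.\<close>

definition is_log_continuation :: "(complex \<Rightarrow> complex) \<Rightarrow> bool" where
  "is_log_continuation L \<longleftrightarrow> L holomorphic_on ball 0 1 \<and> L 0 = 0 \<and>
     (\<forall>\<^sub>F z in nhds 0. L z = Ln (1 - nome_inv z))"

definition log_one_minus_nome_inv :: "complex \<Rightarrow> complex" where
  "log_one_minus_nome_inv = (SOME L. is_log_continuation L)"

definition phi :: "complex \<Rightarrow> complex" where
  "phi z = 1 / (2 * of_real pi * \<i>) * log_one_minus_nome_inv z"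

text \<open>As a map onto \<open>\<Omega>\<^sub>\<int>\<close>, \<open>phi\<close> sends \<open>z\<close> to the class of the image of the segment from \<open>0\<close>
  to \<open>z\<close>; as a plane-valued map it is not injective, and \<open>\<psi>\<close> is the inverse of the former.\<close>

definition phi_lift :: "complex \<Rightarrow> (real \<Rightarrow> complex) set" where
  "phi_lift z = Omega_homotopic `` {phi \<circ> linepath 0 z}"

definition psi :: "(real \<Rightarrow> complex) set \<Rightarrow> complex" where
  "psi = inv_into (ball 0 1) phi_lift"

end

theory Submission
  imports Defs "HOL-Complex_Analysis.Complex_Analysis" "HOL-Real_Asymp.Real_Asymp"
begin

text \<open>The inverse of the nome is the modular lambda function \<open>\<theta>\<^sub>2\<^sup>4 / \<theta>\<^sub>3\<^sup>4\<close>, and everything rests on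
  Landen's transformation. For theta series it is a splitting of a sum over a square lattice, and
  it shows that lambda omits \<open>1\<close> on the disc and \<open>0\<close> off the origin. For the elliptic integral it
  is Parseval's identity for \<open>(1 - z) powr (-1/2)\<close>. Hence the logarithm of the nome of
  \<open>lambda r\<close> doubles when \<open>r\<close> is squared, just like \<open>ln r\<close>, and the logarithmic singularity of the
  elliptic integral forces the two to agree.

  Lambda has the path lifting property of a covering of the plane without \<open>0\<close> and \<open>1\<close>: iterating
  Landen's transformation on a disc in that plane yields functions omitting \<open>0\<close> and \<open>1\<close> that tend
  to \<open>0\<close> by the theorems of Schottky, Montel and Hurwitz, and near \<open>0\<close> lambda is invertible.
  As \<open>exp (2 \<pi> \<i> phi) = 1 - lambda\<close>, \<open>phi\<close> restricts to a covering of \<open>\<complex> - \<int>\<close> by the punctured disc, and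
  it is injective near \<open>0\<close>. So curves and homotopies starting at \<open>0\<close> lift uniquely, whereas two
  curves in the disc with the same end are homotopic; this makes the classes of curves correspond
  to the points of the disc, and the sections of \<open>phi\<close> are the charts.\<close>

section \<open>Theta series and the lambda function\<close>

text \<open>The nome is given only on a lens, but its inverse and the covering are needed on the
  whole disc; so a global function is built first and compared with the nome on a real interval. The
  variable is \<open>q\<close> itself: \<open>theta2r\<close> omits the fractional power, and
  \<open>modk q\<close>, the modulus at \<open>q\<^sup>2\<close>, is single valued in
  \<open>q\<close>. The relations \<open>(modk q)\<^sup>2 = lam (q\<^sup>2)\<close> and
  \<open>lam q = 4 * modk q / (1 + modk q)\<^sup>2\<close> then carry the proof. Squaring
  \<open>q\<close> drives every question towards 0, where it is settled by continuity or by a local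
  inverse, and the only choice on the way is the sign of a square root of \<open>1 - lam\<close>.
  They determine the logarithm of the nome only up to a factor invariant under
  \<open>r \<mapsto> r\<^sup>2\<close>; the behaviour at 0 removes that freedom. The topological
  half is shaped by the start of the curves: 0 is a puncture of the base, yet \<open>phi\<close> is
  regular over it on the first sheet. Lifts therefore begin with a local section of
  \<open>phi\<close> at 0, and the covering takes over at a positive time.\<close>

lemma theta_abs_summable:
  fixes e :: "int \<Rightarrow> nat" and q :: complex
  assumes e: "\<And>n. nat \<bar>n\<bar> \<le> e n + 1" and q: "norm q < 1"
  shows "(\<lambda>n. norm (q ^ e n)) summable_on UNIV"
proof -
  \<comment> \<open>The bound 1/2 keeps \<open>r\<close> positive, so that the spare 1 in the
    exponent bound can be absorbed by a division by \<open>r\<close>.\<close>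
  define r where "r = max (norm q) (1/2)"
  have r: "0 < r" "r < 1" "norm q \<le> r" using q by (auto simp: r_def)
  have s: "(\<lambda>n::nat. r ^ n) summable_on UNIV"
    using r by (intro norm_summable_imp_summable_on) (simp add: summable_geometric)
  have half: "(\<lambda>n::int. r ^ nat \<bar>n\<bar>) summable_on range h" if "inj h" "\<And>k. nat \<bar>h k\<bar> = k"
    for h :: "nat \<Rightarrow> int"
    unfolding summable_on_reindex[OF that(1)] o_def that(2) by (rule s)
  have "(\<lambda>n::int. r ^ nat \<bar>n\<bar>) summable_on (range int \<union> range (\<lambda>k. - int k))"
    by (intro summable_on_union half) (auto simp: inj_def)
  moreover have "range int \<union> range (\<lambda>k. - int k) = UNIV"
    by (auto simp: image_iff) (metis int_cases2)
  ultimately have "(\<lambda>n::int. r ^ nat \<bar>n\<bar>) summable_on UNIV" by simp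
  then have "(\<lambda>n::int. r ^ nat \<bar>n\<bar> / r) summable_on UNIV"
    unfolding divide_inverse by (rule summable_on_cmult_left)
  then show ?thesis
  proof (rule Infinite_Sum.abs_summable_on_comparison_test')
    fix n :: int
    have "norm (q ^ e n) \<le> r ^ e n" using r by (auto simp: norm_power intro: power_mono)
    also have "\<dots> = r ^ (e n + 1) / r" using r by simp
    also have "\<dots> \<le> r ^ nat \<bar>n\<bar> / r"
      using r e[of n] by (intro divide_right_mono power_decreasing) auto
    finally show "norm (q ^ e n) \<le> r ^ nat \<bar>n\<bar> / r" .
  qed
qed

lemma theta_holomorphic:
  fixes e :: "int \<Rightarrow> nat"
  assumes e: "\<And>n. nat \<bar>n\<bar> \<le> e n + 1"
  shows "(\<lambda>q::complex. \<Sum>\<^sub>\<infinity>n. q ^ e n) holomorphic_on ball 0 1"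
proof -
  have hol: "(\<lambda>q::complex. \<Sum>\<^sub>\<infinity>n. q ^ e n) holomorphic_on ball 0 r" if r: "0 < r" "r < 1" for r
  proof -
    have "uniform_limit (cball (0::complex) r) (\<lambda>X q. \<Sum>n\<in>X. q ^ e n)
        (\<lambda>q. \<Sum>\<^sub>\<infinity>n. q ^ e n) (finite_subsets_at_top UNIV)"
    proof (rule Weierstrass_m_test_general)
      show "norm (q ^ e n) \<le> norm (complex_of_real r ^ e n)" if "q \<in> cball 0 r" for q :: complex and n
        using that r by (auto simp: norm_power intro: power_mono)
      show "(\<lambda>n. norm (complex_of_real r ^ e n)) summable_on UNIV"
        using theta_abs_summable[OF e, of "of_real r"] r by simp
    qed
    then show ?thesis
      by (rule holomorphic_uniform_limit[rotated])
         (auto intro!: always_eventually continuous_intros holomorphic_intros)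
  qed
  have "(\<lambda>q::complex. \<Sum>\<^sub>\<infinity>n. q ^ e n) holomorphic_on (\<Union>r\<in>{0<..<1}. ball 0 r)"
    using hol by (intro holomorphic_on_UN_open) auto
  moreover have "(\<Union>r\<in>{0<..<1}. ball (0::complex) r) = ball 0 1"
  proof (intro equalityI subsetI)
    fix z :: complex assume "z \<in> ball 0 1"
    then have "z \<in> ball 0 ((norm z + 1) / 2)" "(norm z + 1) / 2 \<in> {0<..<1}"
      by (auto intro: add_nonneg_pos)
    then show "z \<in> (\<Union>r\<in>{0<..<1}. ball (0::complex) r)" by blast
  qed auto
  ultimately show ?thesis by simp
qed

section \<open>Quadratic identities of the theta constants\<close>

lemma infsum_int_prod:
  fixes f g :: "int \<Rightarrow> complex"
  assumes f: "(\<lambda>m. norm (f m)) summable_on UNIV" and g: "(\<lambda>n. norm (g n)) summable_on UNIV"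
  shows "(\<lambda>(m, n). f m * g n) summable_on UNIV"
    and "(\<Sum>\<^sub>\<infinity>(m, n). f m * g n) = (\<Sum>\<^sub>\<infinity>m. f m) * (\<Sum>\<^sub>\<infinity>n. g n)"
proof -
  have "(\<lambda>x. norm (case x of (m, n) \<Rightarrow> f m * g n)) summable_on (UNIV \<times> UNIV)"
    unfolding Infinite_Sum.abs_summable_on_Sigma_iff using f g
    by (auto simp: norm_mult infsum_cmult_right' abs_mult intro!: summable_on_cmult_right summable_on_cmult_left)
  then show s: "(\<lambda>(m, n). f m * g n) summable_on UNIV"
    using abs_summable_summable by auto
  then show "(\<Sum>\<^sub>\<infinity>(m, n). f m * g n) = (\<Sum>\<^sub>\<infinity>m. f m) * (\<Sum>\<^sub>\<infinity>n. g n)"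
    using infsum_Sigma'_banach[of "\<lambda>m n. f m * g n" UNIV "\<lambda>_. UNIV"]
    by (simp add: infsum_cmult_right' infsum_cmult_left')
qed

text \<open>The sublattice with \<open>m + n\<close> even and its coset are parametrised by
  \<open>(a + b, a - b)\<close> and \<open>(a + b + 1, a - b)\<close>. This similarity of the
  lattice doubles sums of squares, which is what turns \<open>q\<close> into
  \<open>q\<^sup>2\<close> below.\<close>

lemma infsum_int_parity:
  fixes f :: "int \<times> int \<Rightarrow> complex"
  assumes f: "f summable_on UNIV"
  shows "(\<Sum>\<^sub>\<infinity>x. f x) = (\<Sum>\<^sub>\<infinity>(a, b). f (a + b, a - b)) + (\<Sum>\<^sub>\<infinity>(a, b). f (a + b + 1, a - b))"
proof -
  define E where "E = {(m, n :: int). even (m + n)}"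
  have "(\<Sum>\<^sub>\<infinity>x. f x) = (\<Sum>\<^sub>\<infinity>x\<in>E. f x) + (\<Sum>\<^sub>\<infinity>x\<in>-E. f x)"
    using infsum_Un_disjoint[of f E "-E"] summable_on_subset_banach[OF f] by auto
  also have "(\<Sum>\<^sub>\<infinity>x\<in>E. f x) = (\<Sum>\<^sub>\<infinity>(a, b). f (a + b, a - b))"
  proof (rule infsum_reindex_bij_witness[of _ "\<lambda>(a, b). (a + b, a - b)"
          "\<lambda>(m, n). ((m + n) div 2, (m - n) div 2)"])
    show "(case case x of (m, n) \<Rightarrow> ((m + n) div 2, (m - n) div 2) of (a, b) \<Rightarrow> (a + b, a - b)) = x"
      if "x \<in> E" for x
      using that by (auto simp: E_def; presburger)
    then show "(case case x of (m, n) \<Rightarrow> ((m + n) div 2, (m - n) div 2) of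
            (a, b) \<Rightarrow> f (a + b, a - b)) = f x" if "x \<in> E" for x
      using that by (metis (mono_tags, lifting) case_prod_conv split_beta)
  qed (auto simp: E_def; presburger)+
  also have "(\<Sum>\<^sub>\<infinity>x\<in>-E. f x) = (\<Sum>\<^sub>\<infinity>(a, b). f (a + b + 1, a - b))"
  proof (rule infsum_reindex_bij_witness[of _ "\<lambda>(a, b). (a + b + 1, a - b)"
          "\<lambda>(m, n). ((m + n) div 2, (m - n) div 2)"])
    show "(case case x of (m, n) \<Rightarrow> ((m + n) div 2, (m - n) div 2) of (a, b) \<Rightarrow> (a + b + 1, a - b)) = x"
      if "x \<in> - E" for x
      using that by (auto simp: E_def; presburger)
    then show "(case case x of (m, n) \<Rightarrow> ((m + n) div 2, (m - n) div 2) of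
            (a, b) \<Rightarrow> f (a + b + 1, a - b)) = f x" if "x \<in> - E" for x
      using that by (metis (mono_tags, lifting) case_prod_conv split_beta)
  qed (auto simp: E_def; presburger)+
  finally show ?thesis .
qed

definition theta3 :: "complex \<Rightarrow> complex" where
  "theta3 q = (\<Sum>\<^sub>\<infinity>n::int. q ^ nat (n\<^sup>2))"

text \<open>The classical theta constant is \<open>q powr (1/4) * theta2r q\<close>.\<close>

definition theta2r :: "complex \<Rightarrow> complex" where
  "theta2r q = (\<Sum>\<^sub>\<infinity>n::int. q ^ nat (n * (n + 1)))"

lemma int_mult_Suc_nonneg: "0 \<le> n * (n + 1)" for n :: int
  by (cases "n \<ge> 0") (auto simp: zero_le_mult_iff)

lemma theta3_exponent: "nat \<bar>n\<bar> \<le> nat (n\<^sup>2) + 1"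
proof -
  have "\<bar>n\<bar> * 1 \<le> \<bar>n\<bar> * \<bar>n\<bar>" by (cases "n = 0") (auto intro!: mult_left_mono simp del: abs_mult_self_eq)
  then show ?thesis by (simp add: power2_eq_square nat_le_iff)
qed

lemma theta2r_exponent: "nat \<bar>n\<bar> \<le> nat (n * (n + 1)) + 1"
proof -
  have "\<bar>n\<bar> \<le> n * (n + 1) + 1"
  proof (cases "n \<ge> 0")
    case False
    have "0 \<le> (n + 1) * (n + 1)" by simp
    then show ?thesis using False by (simp add: algebra_simps)
  qed (auto simp: algebra_simps)
  then show ?thesis using int_mult_Suc_nonneg[of n] by linarith
qed

lemmas theta3_summable = theta_abs_summable[OF theta3_exponent]
lemmas theta2r_summable = theta_abs_summable[OF theta2r_exponent]

lemma theta3_holomorphic: "theta3 holomorphic_on ball 0 1"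
  unfolding theta3_def by (rule theta_holomorphic[OF theta3_exponent])

lemma theta2r_holomorphic: "theta2r holomorphic_on ball 0 1"
  unfolding theta2r_def by (rule theta_holomorphic[OF theta2r_exponent])

lemma norm_square_less_1: "norm (q\<^sup>2) < 1" if "norm q < 1" for q :: complex
  using that by (simp add: norm_power power_less_one_iff)

lemma power_nat_add_mult:
  fixes q :: complex
  assumes "0 \<le> x" "0 \<le> y" "z = 2 * x + 2 * y"
  shows "q ^ nat z = (q\<^sup>2) ^ nat x * (q\<^sup>2) ^ nat y"
proof -
  have "nat z = 2 * nat x + 2 * nat y" using assms by simp
  then show ?thesis by (simp add: power_add power_mult)
qed

text \<open>Classically theta3(q)^2 = theta3(q^2)^2 + theta2(q^2)^2. In the even class the exponents
  add up to \<open>2 * a\<^sup>2 + 2 * b\<^sup>2\<close>, in the odd class to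
  \<open>1 + 2 * (a * (a + 1)) + 2 * (b * (b + 1))\<close>.\<close>

lemma theta3_square:
  assumes q: "norm q < 1"
  shows "(theta3 q)\<^sup>2 = (theta3 (q\<^sup>2))\<^sup>2 + q * (theta2r (q\<^sup>2))\<^sup>2"
proof -
  note q2 = norm_square_less_1[OF q]
  let ?f = "\<lambda>(m::int, n::int). q ^ nat (m\<^sup>2) * q ^ nat (n\<^sup>2)"
  note p = infsum_int_prod[OF theta3_summable[OF q] theta3_summable[OF q]]
  note p3 = infsum_int_prod[OF theta3_summable[OF q2] theta3_summable[OF q2]]
  note p2 = infsum_int_prod[OF theta2r_summable[OF q2] theta2r_summable[OF q2]]
  have "(theta3 q)\<^sup>2 = (\<Sum>\<^sub>\<infinity>x. ?f x)"
    using p(2) by (simp add: theta3_def power2_eq_square)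
  also have "\<dots> = (\<Sum>\<^sub>\<infinity>(a, b). ?f (a + b, a - b)) + (\<Sum>\<^sub>\<infinity>(a, b). ?f (a + b + 1, a - b))"
    by (rule infsum_int_parity[OF p(1)])
  also have "(\<Sum>\<^sub>\<infinity>(a, b). ?f (a + b, a - b)) = (\<Sum>\<^sub>\<infinity>(a, b). (q\<^sup>2) ^ nat (a\<^sup>2) * (q\<^sup>2) ^ nat (b\<^sup>2))"
  proof (intro infsum_cong, clarsimp)
    fix a b :: int
    have "q ^ nat ((a + b)\<^sup>2) * q ^ nat ((a - b)\<^sup>2) = q ^ nat ((a + b)\<^sup>2 + (a - b)\<^sup>2)"
      by (simp add: nat_add_distrib power_add)
    also have "\<dots> = (q\<^sup>2) ^ nat (a\<^sup>2) * (q\<^sup>2) ^ nat (b\<^sup>2)"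
      by (rule power_nat_add_mult) (auto simp: power2_eq_square algebra_simps)
    finally show "q ^ nat ((a + b)\<^sup>2) * q ^ nat ((a - b)\<^sup>2) = (q\<^sup>2) ^ nat (a\<^sup>2) * (q\<^sup>2) ^ nat (b\<^sup>2)" .
  qed
  also have "\<dots> = (theta3 (q\<^sup>2))\<^sup>2"
    using p3(2) by (simp add: theta3_def power2_eq_square)
  also have "(\<Sum>\<^sub>\<infinity>(a, b). ?f (a + b + 1, a - b)) =
      (\<Sum>\<^sub>\<infinity>x. q * (case x of (a, b) \<Rightarrow> (q\<^sup>2) ^ nat (a * (a + 1)) * (q\<^sup>2) ^ nat (b * (b + 1))))"
  proof (intro infsum_cong, clarsimp)
    fix a b :: int
    have "(a + b + 1)\<^sup>2 + (a - b)\<^sup>2 = 1 + (2 * (a * (a + 1)) + 2 * (b * (b + 1)))"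
      by (simp add: power2_eq_square algebra_simps)
    then have "nat ((a + b + 1)\<^sup>2) + nat ((a - b)\<^sup>2) = 1 + nat (2 * (a * (a + 1)) + 2 * (b * (b + 1)))"
      using int_mult_Suc_nonneg[of a] int_mult_Suc_nonneg[of b]
      by (metis (no_types, lifting) add_nonneg_nonneg mult_2 nat_add_distrib nat_one_as_int nat_1 zero_le_one zero_le_power2 One_nat_def)
    then have "q ^ nat ((a + b + 1)\<^sup>2) * q ^ nat ((a - b)\<^sup>2) =
        q * q ^ nat (2 * (a * (a + 1)) + 2 * (b * (b + 1)))"
      by (metis power_add power_one_right)
    also have "\<dots> = q * ((q\<^sup>2) ^ nat (a * (a + 1)) * (q\<^sup>2) ^ nat (b * (b + 1)))"
      by (subst power_nat_add_mult[OF int_mult_Suc_nonneg int_mult_Suc_nonneg refl]) simp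
    finally show "q ^ nat ((a + b + 1)\<^sup>2) * q ^ nat ((a - b)\<^sup>2) =
        q * ((q\<^sup>2) ^ nat (a * (a + 1)) * (q\<^sup>2) ^ nat (b * (b + 1)))" .
  qed
  also have "\<dots> = q * (theta2r (q\<^sup>2))\<^sup>2"
    using p2(2) by (simp add: theta2r_def power2_eq_square infsum_cmult_right')
  finally show ?thesis .
qed

text \<open>Both parity classes contribute the same product, whence the factor 2: the exponents add
  up to \<open>2 * (a * (a + 1)) + 2 * b\<^sup>2\<close> and to
  \<open>2 * (b * (b + 1)) + 2 * (a + 1)\<^sup>2\<close>.\<close>

lemma theta2r_square:
  assumes q: "norm q < 1"
  shows "(theta2r q)\<^sup>2 = 2 * theta2r (q\<^sup>2) * theta3 (q\<^sup>2)"
proof -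
  note q2 = norm_square_less_1[OF q]
  let ?f = "\<lambda>(m::int, n::int). q ^ nat (m * (m + 1)) * q ^ nat (n * (n + 1))"
  let ?g = "\<lambda>(a::int, b::int). (q\<^sup>2) ^ nat (a * (a + 1)) * (q\<^sup>2) ^ nat (b\<^sup>2)"
  note p = infsum_int_prod[OF theta2r_summable[OF q] theta2r_summable[OF q]]
  note p2 = infsum_int_prod[OF theta2r_summable[OF q2] theta3_summable[OF q2]]
  have "(theta2r q)\<^sup>2 = (\<Sum>\<^sub>\<infinity>x. ?f x)"
    using p(2) by (simp add: theta2r_def power2_eq_square)
  also have "\<dots> = (\<Sum>\<^sub>\<infinity>(a, b). ?f (a + b, a - b)) + (\<Sum>\<^sub>\<infinity>(a, b). ?f (a + b + 1, a - b))"
    by (rule infsum_int_parity[OF p(1)])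
  also have "(\<Sum>\<^sub>\<infinity>(a, b). ?f (a + b, a - b)) = (\<Sum>\<^sub>\<infinity>x. ?g x)"
  proof (intro infsum_cong, clarsimp)
    fix a b :: int
    have "q ^ nat ((a + b) * (a + b + 1)) * q ^ nat ((a - b) * (a - b + 1)) =
        q ^ nat ((a + b) * (a + b + 1) + (a - b) * (a - b + 1))"
      by (subst nat_add_distrib) (auto simp: power_add int_mult_Suc_nonneg)
    also have "\<dots> = (q\<^sup>2) ^ nat (a * (a + 1)) * (q\<^sup>2) ^ nat (b\<^sup>2)"
      by (rule power_nat_add_mult[OF int_mult_Suc_nonneg]) (auto simp: power2_eq_square algebra_simps)
    finally show "q ^ nat ((a + b) * (a + b + 1)) * q ^ nat ((a - b) * (a - b + 1)) =
        (q\<^sup>2) ^ nat (a * (a + 1)) * (q\<^sup>2) ^ nat (b\<^sup>2)" .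
  qed
  also have "(\<Sum>\<^sub>\<infinity>(a, b). ?f (a + b + 1, a - b)) = (\<Sum>\<^sub>\<infinity>x. ?g x)"
  proof (rule infsum_reindex_bij_witness[of _ "\<lambda>(x, y). (y - 1, x)" "\<lambda>(a, b). (b, a + 1)"]; clarsimp?)
    fix a b :: int
    have "q ^ nat ((a + b + 1) * (a + b + 1 + 1)) * q ^ nat ((a - b) * (a - b + 1)) =
        q ^ nat ((a + b + 1) * (a + b + 1 + 1) + (a - b) * (a - b + 1))"
      by (subst nat_add_distrib[OF int_mult_Suc_nonneg int_mult_Suc_nonneg]) (simp add: power_add)
    also have "\<dots> = (q\<^sup>2) ^ nat (b * (b + 1)) * (q\<^sup>2) ^ nat ((a + 1)\<^sup>2)"
      by (rule power_nat_add_mult[OF int_mult_Suc_nonneg zero_le_power2]) (simp add: power2_eq_square algebra_simps)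
    finally show "(q\<^sup>2) ^ nat (b * (b + 1)) * (q\<^sup>2) ^ nat ((a + 1)\<^sup>2) =
        q ^ nat ((a + b + 1) * (2 + (a + b))) * q ^ nat ((a - b) * (a - b + 1))"
      by (simp add: algebra_simps)
  qed
  also have "(\<Sum>\<^sub>\<infinity>x. ?g x) = theta2r (q\<^sup>2) * theta3 (q\<^sup>2)"
    using p2(2) by (simp add: theta2r_def theta3_def)
  finally show ?thesis by simp
qed

text \<open>Classically theta3(q) theta4(q) = theta4(q^2)^2, where theta4 is \<open>theta3\<close>
  at \<open>- q\<close>. The odd class cancels: the reflection \<open>a \<mapsto> - 1 - a\<close>
  fixes \<open>a * (a + 1)\<close> but changes the parity of \<open>a - b\<close>, hence the
  sign.\<close>

lemma theta3_mult_minus: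
  assumes q: "norm q < 1"
  shows "theta3 q * theta3 (- q) = (theta3 (- (q\<^sup>2)))\<^sup>2"
proof -
  note q2 = norm_square_less_1[OF q]
  have nq: "norm (- q) < 1" and nq2: "norm (- (q\<^sup>2)) < 1" using q q2 by simp_all
  let ?f = "\<lambda>(m::int, n::int). q ^ nat (m\<^sup>2) * (- q) ^ nat (n\<^sup>2)"
  let ?h = "\<lambda>(a::int, b::int). q * ((-1) ^ nat \<bar>a - b\<bar> * ((q\<^sup>2) ^ nat (a * (a + 1)) * (q\<^sup>2) ^ nat (b * (b + 1))))"
  note p = infsum_int_prod[OF theta3_summable[OF q] theta3_summable[OF nq]]
  note p3 = infsum_int_prod[OF theta3_summable[OF nq2] theta3_summable[OF nq2]]
  have sgn: "(- q) ^ nat (n\<^sup>2) = (-1) ^ nat \<bar>n\<bar> * q ^ nat (n\<^sup>2)" for n :: int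
    by (subst power_minus) (simp add: minus_one_power_iff even_nat_iff)
  have sgn2: "(- (q\<^sup>2)) ^ nat (n\<^sup>2) = (-1) ^ nat \<bar>n\<bar> * (q\<^sup>2) ^ nat (n\<^sup>2)" for n :: int
    by (subst power_minus) (simp add: minus_one_power_iff even_nat_iff)
  have "theta3 q * theta3 (- q) = (\<Sum>\<^sub>\<infinity>x. ?f x)"
    using p(2) by (simp add: theta3_def)
  also have "\<dots> = (\<Sum>\<^sub>\<infinity>(a, b). ?f (a + b, a - b)) + (\<Sum>\<^sub>\<infinity>(a, b). ?f (a + b + 1, a - b))"
    by (rule infsum_int_parity[OF p(1)])
  also have "(\<Sum>\<^sub>\<infinity>(a, b). ?f (a + b, a - b)) = (\<Sum>\<^sub>\<infinity>(a, b). (- (q\<^sup>2)) ^ nat (a\<^sup>2) * (- (q\<^sup>2)) ^ nat (b\<^sup>2))"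
  proof (intro infsum_cong, clarsimp)
    fix a b :: int
    have "q ^ nat ((a + b)\<^sup>2) * q ^ nat ((a - b)\<^sup>2) = q ^ nat ((a + b)\<^sup>2 + (a - b)\<^sup>2)"
      by (simp add: nat_add_distrib power_add)
    also have "\<dots> = (q\<^sup>2) ^ nat (a\<^sup>2) * (q\<^sup>2) ^ nat (b\<^sup>2)"
      by (rule power_nat_add_mult) (auto simp: power2_eq_square algebra_simps)
    finally have "q ^ nat ((a + b)\<^sup>2) * q ^ nat ((a - b)\<^sup>2) = (q\<^sup>2) ^ nat (a\<^sup>2) * (q\<^sup>2) ^ nat (b\<^sup>2)" .
    then show "q ^ nat ((a + b)\<^sup>2) * (- q) ^ nat ((a - b)\<^sup>2) = (- (q\<^sup>2)) ^ nat (a\<^sup>2) * (- (q\<^sup>2)) ^ nat (b\<^sup>2)"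
      unfolding sgn sgn2 by (auto simp: minus_one_power_iff even_nat_iff)
  qed
  also have "\<dots> = (theta3 (- (q\<^sup>2)))\<^sup>2"
    using p3(2) by (simp add: theta3_def power2_eq_square)
  also have "(\<Sum>\<^sub>\<infinity>(a, b). ?f (a + b + 1, a - b)) = (\<Sum>\<^sub>\<infinity>x. ?h x)"
  proof (intro infsum_cong, clarsimp)
    fix a b :: int
    have "(a + b + 1)\<^sup>2 + (a - b)\<^sup>2 = 1 + (2 * (a * (a + 1)) + 2 * (b * (b + 1)))"
      by (simp add: power2_eq_square algebra_simps)
    then have "nat ((a + b + 1)\<^sup>2) + nat ((a - b)\<^sup>2) = 1 + nat (2 * (a * (a + 1)) + 2 * (b * (b + 1)))"
      using int_mult_Suc_nonneg[of a] int_mult_Suc_nonneg[of b]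
      by (metis (no_types, lifting) add_nonneg_nonneg mult_2 nat_add_distrib nat_one_as_int nat_1 zero_le_one zero_le_power2 One_nat_def)
    then have "q ^ nat ((a + b + 1)\<^sup>2) * q ^ nat ((a - b)\<^sup>2) =
        q * q ^ nat (2 * (a * (a + 1)) + 2 * (b * (b + 1)))"
      by (metis power_add power_one_right)
    also have "\<dots> = q * ((q\<^sup>2) ^ nat (a * (a + 1)) * (q\<^sup>2) ^ nat (b * (b + 1)))"
      by (subst power_nat_add_mult[OF int_mult_Suc_nonneg int_mult_Suc_nonneg refl]) simp
    finally show "q ^ nat ((a + b + 1)\<^sup>2) * (- q) ^ nat ((a - b)\<^sup>2) =
        q * ((-1) ^ nat \<bar>a - b\<bar> * ((q\<^sup>2) ^ nat (a * (a + 1)) * (q\<^sup>2) ^ nat (b * (b + 1))))"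
      unfolding sgn by (simp add: mult_ac)
  qed
  also have "(\<Sum>\<^sub>\<infinity>x. ?h x) = 0"
  proof -
    have "(\<Sum>\<^sub>\<infinity>x. ?h x) = (\<Sum>\<^sub>\<infinity>x. - ?h x)"
      by (rule infsum_reindex_bij_witness[of _ "\<lambda>(a, b). (- 1 - a, b)" "\<lambda>(a, b). (- 1 - a, b)"])
         (auto simp: minus_one_power_iff even_nat_iff algebra_simps)
    also have "\<dots> = - (\<Sum>\<^sub>\<infinity>x. ?h x)" by (rule infsum_uminus)
    finally show ?thesis by simp
  qed
  finally show ?thesis by simp
qed

lemma theta3_0 [simp]: "theta3 0 = 1"
proof -
  have "theta3 0 = (\<Sum>\<^sub>\<infinity>n\<in>{0::int}. 0 ^ nat (n\<^sup>2))"
    unfolding theta3_def by (rule infsum_cong_neutral) (auto simp: power_0_left)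
  then show ?thesis by simp
qed

lemma theta2r_0 [simp]: "theta2r 0 = 2"
proof -
  have "n * (n + 1) \<le> 0 \<longleftrightarrow> n \<in> {-1, 0}" for n :: int
  proof -
    have "n * (n + 1) \<le> 0 \<longleftrightarrow> n * (n + 1) = 0" using int_mult_Suc_nonneg[of n] by linarith
    then show ?thesis by auto
  qed
  then have "theta2r 0 = (\<Sum>\<^sub>\<infinity>n\<in>{-1, 0::int}. 0 ^ nat (n * (n + 1)))"
    unfolding theta2r_def by (intro infsum_cong_neutral) (auto simp: power_0_left)
  then show ?thesis by simp
qed

lemma power_power2_tendsto_0: "(\<lambda>n. q ^ 2 ^ n) \<longlonglongrightarrow> 0" if "norm q < 1" for q :: complex
proof -
  have "filterlim (\<lambda>n::nat. (2::nat) ^ n) at_top sequentially"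
    by (rule filterlim_subseq) (simp add: strict_mono_def)
  with LIMSEQ_power_zero[OF that] show ?thesis by (rule filterlim_compose)
qed

text \<open>The zeros of a function on the disc that is continuous at \<open>0\<close> are pushed into \<open>0\<close> by
  iterating a map under which \<open>norm q\<close> is squared.\<close>

lemma nonzero_by_squaring:
  fixes F :: "complex \<Rightarrow> complex"
  assumes cont: "continuous (at 0) F" and F0: "F 0 \<noteq> 0"
    and step: "\<And>q. norm q < 1 \<Longrightarrow> F q = 0 \<Longrightarrow> \<exists>q'. norm q' = (norm q)\<^sup>2 \<and> F q' = 0"
    and q: "norm q < 1"
  shows "F q \<noteq> 0"
proof
  assume Fq: "F q = 0"
  have "\<exists>q'. norm q' = norm q ^ 2 ^ n \<and> F q' = 0" for n
  proof (induction n)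
    case (Suc n)
    then obtain q' where q': "norm q' = norm q ^ 2 ^ n" "F q' = 0" by blast
    then have "norm q' < 1" using q by (simp add: power_less_one_iff)
    from step[OF this q'(2)] q'(1) show ?case by (simp add: power_mult[symmetric] mult.commute)
  qed (use Fq in auto)
  then obtain u where u: "\<And>n. norm (u n) = norm q ^ 2 ^ n" "\<And>n. F (u n) = 0" by metis
  have "(\<lambda>n. norm (u n)) \<longlonglongrightarrow> 0"
    using tendsto_norm[OF power_power2_tendsto_0[OF q]] by (simp add: u norm_power)
  then have "u \<longlonglongrightarrow> 0" by (rule tendsto_norm_zero_cancel)
  then have "(\<lambda>n. F (u n)) \<longlonglongrightarrow> F 0"
    by (rule continuous_within_tendsto_compose'[OF cont, rotated]) auto
  with u(2) have "F 0 = 0" using LIMSEQ_unique[of "\<lambda>_. 0"] by auto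
  with F0 show False by simp
qed

text \<open>By \<open>theta3_mult_minus\<close> a zero at \<open>q\<close> entails one at
  \<open>- (q\<^sup>2)\<close>, while \<open>theta3 0 = 1\<close>.\<close>

lemma theta3_nonzero:
  assumes "norm q < 1"
  shows "theta3 q \<noteq> 0"
proof (rule nonzero_by_squaring[OF _ _ _ assms])
  show "continuous (at 0) theta3"
    using theta3_holomorphic holomorphic_on_imp_continuous_on continuous_on_interior by fastforce
  show "\<exists>q'. norm q' = (norm q)\<^sup>2 \<and> theta3 q' = 0" if "norm q < 1" "theta3 q = 0" for q
    using theta3_mult_minus[OF that(1)] that(2)
    by (intro exI[of _ "- (q\<^sup>2)"]) (auto simp: norm_power)
qed auto

lemma theta2r_nonzero:
  assumes "norm q < 1"
  shows "theta2r q \<noteq> 0"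
proof (rule nonzero_by_squaring[OF _ _ _ assms])
  show "continuous (at 0) theta2r"
    using theta2r_holomorphic holomorphic_on_imp_continuous_on continuous_on_interior by fastforce
  show "\<exists>q'. norm q' = (norm q)\<^sup>2 \<and> theta2r q' = 0" if "norm q < 1" "theta2r q = 0" for q
    using theta2r_square[OF that(1)] that(2) theta3_nonzero[OF norm_square_less_1[OF that(1)]]
    by (intro exI[of _ "q\<^sup>2"]) (auto simp: norm_power)
qed auto

text \<open>The modular lambda function \<open>k\<^sup>2 = \<theta>\<^sub>2\<^sup>4 / \<theta>\<^sub>3\<^sup>4\<close> as a function of the nome.\<close>

definition lam :: "complex \<Rightarrow> complex" where
  "lam q = q * (theta2r q / theta3 q) ^ 4"

text \<open>The modulus \<open>k\<close> at \<open>q\<^sup>2\<close>.\<close>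

definition modk :: "complex \<Rightarrow> complex" where
  "modk q = q * (theta2r (q\<^sup>2) / theta3 (q\<^sup>2))\<^sup>2"

lemma lam_holomorphic: "lam holomorphic_on ball 0 1"
  unfolding lam_def
  by (intro holomorphic_intros theta2r_holomorphic theta3_holomorphic) (auto simp: theta3_nonzero)

lemma lam_0 [simp]: "lam 0 = 0"
  by (simp add: lam_def)

lemma lam_eq_0_iff: "norm q < 1 \<Longrightarrow> lam q = 0 \<longleftrightarrow> q = 0"
  by (auto simp: lam_def theta3_nonzero theta2r_nonzero)

lemma modk_square: "(modk q)\<^sup>2 = lam (q\<^sup>2)"
  by (simp add: lam_def modk_def power_mult_distrib flip: power_mult)

lemma modk_holomorphic: "modk holomorphic_on ball 0 1"
proof -
  have "(\<lambda>q. theta2r (q\<^sup>2)) holomorphic_on ball 0 1" "(\<lambda>q. theta3 (q\<^sup>2)) holomorphic_on ball 0 1"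
    by (rule holomorphic_on_compose_gen[OF _ theta2r_holomorphic, unfolded o_def]
             holomorphic_on_compose_gen[OF _ theta3_holomorphic, unfolded o_def];
        auto intro!: holomorphic_intros norm_square_less_1 simp: norm_square_less_1)+
  then show ?thesis
    unfolding modk_def by (intro holomorphic_intros) (auto simp: theta3_nonzero norm_square_less_1)
qed

text \<open>\<open>theta3_square\<close> in terms of the modulus. Since \<open>theta3\<close> has no
  zeros, it also excludes the value -1 of \<open>modk\<close>, so that the denominator in Landen's
  formula never vanishes.\<close>

lemma one_plus_modk:
  assumes "norm q < 1"
  shows "(theta3 (q\<^sup>2))\<^sup>2 * (1 + modk q) = (theta3 q)\<^sup>2"
  using theta3_square[OF assms] theta3_nonzero[OF norm_square_less_1[OF assms]]
  by (simp add: modk_def field_simps)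

lemma modk_neq_minus_1: "norm q < 1 \<Longrightarrow> 1 + modk q \<noteq> 0"
  using one_plus_modk[of q] theta3_nonzero[of q] by auto

text \<open>The quotient of the squares of \<open>theta2r_square\<close> and
  \<open>theta3_square\<close>: Landen's step from the modulus at \<open>q\<^sup>2\<close> to the
  one at \<open>q\<close>.\<close>

lemma lam_landen:
  assumes q: "norm q < 1"
  shows "lam q = 4 * modk q / (1 + modk q)\<^sup>2"
proof -
  note q2 = norm_square_less_1[OF q]
  have "(theta2r q) ^ 4 = ((theta2r q)\<^sup>2)\<^sup>2" "(theta3 q) ^ 4 = ((theta3 q)\<^sup>2)\<^sup>2" by simp_all
  then have "lam q = q * (2 * theta2r (q\<^sup>2) * theta3 (q\<^sup>2))\<^sup>2 / ((theta3 (q\<^sup>2))\<^sup>2 * (1 + modk q))\<^sup>2"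
    by (simp only: lam_def power_divide theta2r_square[OF q] one_plus_modk[OF q] times_divide_eq_right)
  also have "\<dots> = 4 * modk q / (1 + modk q)\<^sup>2"
    using theta3_nonzero[OF q2] modk_neq_minus_1[OF q]
    by (simp add: modk_def power_mult_distrib divide_simps)
  finally show ?thesis .
qed

lemma one_minus_lam: "norm q < 1 \<Longrightarrow> 1 - lam q = ((1 - modk q) / (1 + modk q))\<^sup>2"
  using lam_landen[of q] modk_neq_minus_1[of q]
  by (simp add: power_divide divide_simps) (simp add: power2_eq_square algebra_simps)

text \<open>The value 1 at \<open>q\<close> forces \<open>modk q = 1\<close>, hence the value 1 at
  \<open>q\<^sup>2\<close>; iteration contradicts \<open>lam 0 = 0\<close>.\<close>

lemma lam_neq_1:
  assumes "norm q < 1"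
  shows "lam q \<noteq> 1"
proof -
  have "1 - lam q \<noteq> 0"
  proof (rule nonzero_by_squaring[OF _ _ _ assms])
    have "isCont lam 0"
      using lam_holomorphic holomorphic_on_imp_continuous_on continuous_on_interior by fastforce
    then show "isCont (\<lambda>q. 1 - lam q) 0" by (intro continuous_intros)
    show "\<exists>q'. norm q' = (norm q)\<^sup>2 \<and> 1 - lam q' = 0" if "norm q < 1" "1 - lam q = 0" for q
      using one_minus_lam[OF that(1)] that(2) modk_neq_minus_1[OF that(1)]
      by (intro exI[of _ "q\<^sup>2"]) (auto simp: norm_power simp flip: modk_square)
  qed auto
  then show ?thesis by auto
qed

lemma modk_neq_1: "norm q < 1 \<Longrightarrow> 1 - modk q \<noteq> 0"
  using one_minus_lam[of q] lam_neq_1[of q] by auto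

text \<open>\<open>lam q\<close> is \<open>q\<close> times a function with value
  \<open>(2 / 1) ^ 4\<close> at 0.\<close>

lemma deriv_lam_0: "deriv lam 0 = 16"
proof -
  define g where "g q = (theta2r q / theta3 q) ^ 4" for q
  have "g holomorphic_on ball 0 1"
    unfolding g_def
    by (intro holomorphic_intros theta2r_holomorphic theta3_holomorphic) (auto simp: theta3_nonzero)
  then have "(g has_field_derivative deriv g 0) (at 0)"
    by (intro holomorphic_derivI[of g "ball 0 1"]) auto
  then have "((\<lambda>q. q * g q) has_field_derivative 0 * deriv g 0 + 1 * g 0) (at 0)"
    by (rule DERIV_mult'[OF DERIV_ident])
  moreover have "lam = (\<lambda>q. q * g q)" by (auto simp: lam_def g_def)
  ultimately show ?thesis by (auto simp: g_def dest: DERIV_imp_deriv)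
qed

lemma theta3_real: "0 \<le> r \<Longrightarrow> r < 1 \<Longrightarrow> \<exists>t>0. theta3 (of_real r) = of_real t"
  and theta2r_real: "0 \<le> r \<Longrightarrow> r < 1 \<Longrightarrow> \<exists>t>0. theta2r (of_real r) = of_real t"
proof -
  have gen: "\<exists>t>0. (\<Sum>\<^sub>\<infinity>n. complex_of_real r ^ e n) = of_real t"
    if r: "0 \<le> r" "r < 1" and e: "\<And>n. nat \<bar>n\<bar> \<le> e n + 1" and e0: "e 0 = 0" for e :: "int \<Rightarrow> nat"
  proof -
    have "(\<lambda>n. norm (of_real r ^ e n :: complex)) summable_on UNIV"
      using r by (intro theta_abs_summable[OF e]) simp
    then have s: "(\<lambda>n. r ^ e n) summable_on UNIV" using r by (simp add: norm_power)
    have "(\<Sum>\<^sub>\<infinity>n\<in>{0::int}. r ^ e n) \<le> (\<Sum>\<^sub>\<infinity>n. r ^ e n)"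
      using s r by (intro infsum_mono2) auto
    then have "0 < (\<Sum>\<^sub>\<infinity>n. r ^ e n)" using e0 by simp
    moreover have "(\<Sum>\<^sub>\<infinity>n. complex_of_real r ^ e n) = of_real (\<Sum>\<^sub>\<infinity>n. r ^ e n)"
      using infsumI[OF has_sum_of_real[OF has_sum_infsum[OF s]]] by simp
    ultimately show ?thesis by blast
  qed
  show "0 \<le> r \<Longrightarrow> r < 1 \<Longrightarrow> \<exists>t>0. theta3 (of_real r) = of_real t"
    unfolding theta3_def by (rule gen) (use theta3_exponent in auto)
  show "0 \<le> r \<Longrightarrow> r < 1 \<Longrightarrow> \<exists>t>0. theta2r (of_real r) = of_real t"
    unfolding theta2r_def by (rule gen) (use theta2r_exponent in auto)
qed

text \<open>Positivity is that of the theta series. For the upper bound, \<open>modk\<close> is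
  continuous on the segment from 0 to \<open>r\<close>, vanishes at 0 and omits 1.\<close>

lemma modk_real:
  assumes "0 < r" "r < 1"
  shows "\<exists>x. 0 < x \<and> x < 1 \<and> modk (of_real r) = of_real x"
proof -
  have k: "\<exists>x. 0 < x \<and> modk (of_real s) = of_real x" if "0 < s" "s < 1" for s
  proof -
    have "0 \<le> s\<^sup>2" "s\<^sup>2 < 1" using that by (auto simp: power_less_one_iff)
    then obtain t u where "t > 0" "theta3 (of_real (s\<^sup>2)) = of_real t"
       "u > 0" "theta2r (of_real (s\<^sup>2)) = of_real u"
      using theta3_real theta2r_real by blast
    then have "modk (of_real s) = of_real (s * (u / t)\<^sup>2)" "0 < s * (u / t)\<^sup>2"
      using that by (auto simp: modk_def)
    then show ?thesis by blast
  qed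
  have re: "\<exists>x. 0 \<le> x \<and> modk (of_real s) = of_real x" if "0 \<le> s" "s < 1" for s
    using k[of s] that by (cases "s = 0") (auto simp: modk_def intro: less_imp_le)
  have "Re (modk (of_real r)) < 1"
  proof (rule ccontr)
    assume "\<not> Re (modk (of_real r)) < 1"
    moreover have "continuous_on {0..r} (\<lambda>s. Re (modk (of_real s)))"
      using assms
      by (intro continuous_intros continuous_on_compose2[OF holomorphic_on_imp_continuous_on[OF modk_holomorphic]]) auto
    ultimately obtain s where s: "0 \<le> s" "s \<le> r" "Re (modk (of_real s)) = 1"
      using IVT'[of "\<lambda>s. Re (modk (of_real s))" 0 1 r] assms by (auto simp: modk_def)
    with re[of s] assms have "modk (of_real s) = 1" by auto
    with modk_neq_1[of "of_real s"] s assms show False by auto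
  qed
  with k[OF assms] show ?thesis by auto
qed

section \<open>The elliptic integral and the nome\<close>

lemma has_integral_series:
  fixes f :: "nat \<Rightarrow> real \<Rightarrow> complex"
  assumes c: "\<And>n. continuous_on {a..b} (f n)"
    and M: "\<And>n t. t \<in> {a..b} \<Longrightarrow> norm (f n t) \<le> M n" "summable M"
    and I: "\<And>n. (f n has_integral I n) {a..b}"
  shows "((\<lambda>t. \<Sum>n. f n t) has_integral (\<Sum>n. I n)) {a..b}" "summable I"
proof -
  have u: "uniform_limit {a..b} (\<lambda>n t. \<Sum>i<n. f i t) (\<lambda>t. \<Sum>n. f n t) sequentially"
    using M by (rule Weierstrass_m_test)
  obtain S J where S: "\<And>n. ((\<lambda>t. \<Sum>i<n. f i t) has_integral S n) {a..b}"
    and J: "((\<lambda>t. \<Sum>n. f n t) has_integral J) {a..b}" "S \<longlonglongrightarrow> J"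
    by (rule uniform_limit_integral[OF u]) (auto intro!: continuous_intros c)
  have "((\<lambda>t. \<Sum>i<n. f i t) has_integral (\<Sum>i<n. I i)) {a..b}" for n
    by (intro has_integral_sum I) auto
  then have "S = (\<lambda>n. \<Sum>i<n. I i)" by (intro ext has_integral_unique[OF S])
  with J(2) have "I sums J" by (simp add: sums_def)
  with J(1) show "((\<lambda>t. \<Sum>n. f n t) has_integral (\<Sum>n. I n)) {a..b}" "summable I"
    by (auto simp: sums_iff)
qed

text \<open>\<open>wallis_coeff n\<close> is the central binomial coefficient divided by \<open>4 ^ n\<close>.\<close>

definition wallis_coeff :: "nat \<Rightarrow> real" where
  "wallis_coeff n = pochhammer (1/2) n / fact n"

lemma wallis_coeff_0 [simp]: "wallis_coeff 0 = 1"
  by (simp add: wallis_coeff_def)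

lemma wallis_coeff_Suc: "2 * real (Suc n) * wallis_coeff (Suc n) = (2 * real n + 1) * wallis_coeff n"
  by (simp add: wallis_coeff_def pochhammer_Suc field_simps del: of_nat_Suc)

lemma wallis_coeff_pos: "0 < wallis_coeff n"
  by (auto simp: wallis_coeff_def intro!: divide_pos_pos pochhammer_pos)

lemma wallis_coeff_le_1: "wallis_coeff n \<le> 1"
proof (induction n)
  case (Suc n)
  have "2 * real (Suc n) * wallis_coeff (Suc n) \<le> 2 * real (Suc n) * 1"
    unfolding wallis_coeff_Suc using Suc.IH wallis_coeff_pos[of n]
    by (intro mult_mono) auto
  then show ?case by (simp add: mult_le_cancel_left_pos del: of_nat_Suc)
qed auto

lemma wallis_coeff_bounds: "\<bar>wallis_coeff n\<bar> \<le> 1" "(wallis_coeff n)\<^sup>2 \<le> 1"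
  using wallis_coeff_pos[of n] wallis_coeff_le_1[of n] by (auto simp: power_le_one_iff abs_if)

text \<open>The function \<open>cos t ^ (2 * n + 1) * sin t\<close> vanishes at both ends;
  integrating its derivative gives the Wallis recursion.\<close>

lemma has_integral_cos_power:
  "((\<lambda>t. cos t ^ (2 * n)) has_integral pi * wallis_coeff n) {0..pi}"
proof (induction n)
  case 0
  show ?case using has_integral_const_real[of "1::real" 0 pi] by simp
next
  case (Suc n)
  have "((\<lambda>t. (2 * n + 2) * cos t ^ (2 * n + 2) - (2 * n + 1) * cos t ^ (2 * n)) has_integral
      (cos pi ^ (2 * n + 1) * sin pi - cos 0 ^ (2 * n + 1) * sin 0)) {0..pi}"
  proof (rule fundamental_theorem_of_calculus)
    fix t :: real
    have s: "(sin t)\<^sup>2 = 1 - (cos t)\<^sup>2" by (simp add: sin_squared_eq)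
    have "((\<lambda>t. cos t ^ (2 * n + 1) * sin t) has_real_derivative
        cos t ^ (2 * n + 1) * cos t - (2 * n + 1) * cos t ^ (2 * n) * (sin t)\<^sup>2) (at t)"
      by (rule DERIV_cong[OF DERIV_mult'[OF DERIV_power[OF DERIV_cos] DERIV_sin]])
         (simp add: power2_eq_square)
    also have "cos t ^ (2 * n + 1) * cos t - (2 * n + 1) * cos t ^ (2 * n) * (sin t)\<^sup>2 =
        (2 * n + 2) * cos t ^ (2 * n + 2) - (2 * n + 1) * cos t ^ (2 * n)"
      unfolding s by (simp add: power2_eq_square algebra_simps)
    finally have "((\<lambda>t. cos t ^ (2 * n + 1) * sin t) has_vector_derivative
        (2 * n + 2) * cos t ^ (2 * n + 2) - (2 * n + 1) * cos t ^ (2 * n)) (at t)"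
      by (simp only: has_real_derivative_iff_has_vector_derivative)
    then show "((\<lambda>t. cos t ^ (2 * n + 1) * sin t) has_vector_derivative
        (2 * n + 2) * cos t ^ (2 * n + 2) - (2 * n + 1) * cos t ^ (2 * n)) (at t within {0..pi})"
      by (rule has_vector_derivative_at_within)
  qed auto
  from has_integral_add[OF this has_integral_mult_right[OF Suc.IH, of "2 * n + 1"]]
  have "((\<lambda>t. (2 * n + 2) * cos t ^ (2 * n + 2)) has_integral (2 * n + 1) * (pi * wallis_coeff n)) {0..pi}"
    by simp
  from has_integral_mult_left[OF this, of "inverse (2 * n + 2)"]
  have "((\<lambda>t. cos t ^ (2 * n + 2)) has_integral (2 * n + 1) * (pi * wallis_coeff n) * inverse (2 * n + 2)) {0..pi}"
    by (rule has_integral_eq[rotated]) simp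
  also have "(2 * n + 1) * (pi * wallis_coeff n) * inverse (2 * n + 2) = pi * wallis_coeff (Suc n)"
    using wallis_coeff_Suc[of n] by (simp add: field_simps)
  finally show ?case by simp
qed

lemma wallis_binomial_sums:
  fixes z :: complex
  assumes "norm z < 1"
  shows "(\<lambda>n. of_real (wallis_coeff n) * z ^ n) sums ((1 - z) powr (-1/2))"
proof -
  have "(\<lambda>n. ((-1/2) gchoose n) * (- z) ^ n) sums (1 + - z) powr (-1/2)"
    by (rule gen_binomial_complex) (use assms in simp)
  moreover have "((-1/2) gchoose n) * (- z) ^ n = of_real (wallis_coeff n) * z ^ n" for n
  proof -
    have w: "complex_of_real (wallis_coeff n) = pochhammer (1/2) n / fact n"
      using pochhammer_of_real[of "1/2" n, where 'a = complex] by (simp add: wallis_coeff_def)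
    have z: "z ^ n = (- 1) ^ n * (- z) ^ n" by (simp flip: power_mult_distrib)
    have g: "((-1/2) gchoose n) = (- 1) ^ n * pochhammer (1/2 :: complex) n / fact n"
      by (simp add: gbinomial_pochhammer)
    show ?thesis by (subst z, subst g, subst w) (simp only: times_divide_eq_left times_divide_eq_right mult_ac)
  qed
  ultimately show ?thesis by simp
qed

lemma norm_wallis_power_le:
  "norm (of_real (wallis_coeff n) * z ^ n) \<le> norm z ^ n" for z :: complex
  using wallis_coeff_bounds(1)[of n] by (auto simp: norm_mult norm_power intro: mult_left_le_one_le)

lemma norm_wallis_square_power_le:
  "norm (of_real ((wallis_coeff n)\<^sup>2) * z ^ n) \<le> norm z ^ n" for z :: complex
  using wallis_coeff_bounds(2)[of n]
  by (simp add: norm_mult norm_power mult_left_le_one_le)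

text \<open>\<open>2 / \<pi>\<close> times the complete elliptic integral.\<close>

definition hyperK :: "complex \<Rightarrow> complex" where
  "hyperK m = (\<Sum>n. of_real ((wallis_coeff n)\<^sup>2) * m ^ n)"

lemma hyperK_summable: "summable (\<lambda>n. of_real ((wallis_coeff n)\<^sup>2) * m ^ n)" if "norm m < 1" for m :: complex
proof (rule summable_comparison_test'[where N = 0])
  show "summable (\<lambda>n. norm m ^ n)" using that by (simp add: summable_geometric)
qed (rule norm_wallis_square_power_le)

lemma hypergeo_nth: "fps_nth (fps_hypergeo [1/2, 1/2] [1] 1) n = complex_of_real ((wallis_coeff n)\<^sup>2)"
proof -
  have "complex_of_real (pochhammer (1/2) n) = pochhammer (1/2) n"
    using pochhammer_of_real[of "1/2" n, where 'a = complex] by simp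
  then show ?thesis
    by (simp add: wallis_coeff_def power2_eq_square pochhammer_fact[symmetric])
qed

lemma ellK_eq: "ellK m = of_real pi / 2 * hyperK m"
  by (simp add: ellK_def hyperK_def eval_fps_def hypergeo_nth del: fps_hypergeo_nth)

lemma hyperK_holomorphic: "hyperK holomorphic_on ball 0 1"
proof -
  have "fps_conv_radius (fps_hypergeo [1/2, 1/2] [1] (1::complex)) \<ge> 1"
    unfolding fps_conv_radius_def hypergeo_nth
  proof (rule conv_radius_geI_ex)
    fix r :: real assume r: "0 < r" "ereal r < 1"
    then show "\<exists>z. norm z = r \<and> summable (\<lambda>n. complex_of_real ((wallis_coeff n)\<^sup>2) * z ^ n)"
      by (intro exI[of _ "of_real r"] conjI hyperK_summable) auto
  qed
  then have "ball 0 1 \<subseteq> eball 0 (fps_conv_radius (fps_hypergeo [1/2, 1/2] [1] (1::complex)))"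
    by (intro ball_eball_mono) (simp add: one_ereal_def)
  moreover have "hyperK = eval_fps (fps_hypergeo [1/2, 1/2] [1] 1)"
    by (auto simp: hyperK_def eval_fps_def hypergeo_nth fun_eq_iff simp del: fps_hypergeo_nth)
  ultimately show ?thesis
    using holomorphic_on_eval_fps by metis
qed

text \<open>The binomial series at \<open>m * of_real ((cos t)\<^sup>2)\<close> is integrated term
  by term; the Wallis integrals supply the second factor of the squared coefficients.\<close>

lemma hyperK_has_integral:
  assumes m: "norm m < 1"
  shows "((\<lambda>t. (1 - m * of_real ((cos t)\<^sup>2)) powr (-1/2)) has_integral of_real pi * hyperK m) {0..pi}"
proof -
  let ?f = "\<lambda>n t. of_real (wallis_coeff n) * (m * of_real ((cos t)\<^sup>2)) ^ n"
  have nm: "norm (m * of_real ((cos t)\<^sup>2)) \<le> norm m" for t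
    by (auto simp: norm_mult norm_power abs_square_le_1 intro!: mult_left_le)
  have "((\<lambda>t. \<Sum>n. ?f n t) has_integral (\<Sum>n. of_real pi * (of_real ((wallis_coeff n)\<^sup>2) * m ^ n))) {0..pi}"
  proof (rule has_integral_series)
    show "continuous_on {0..pi} (?f n)" for n by (intro continuous_intros)
    show "norm (?f n t) \<le> norm m ^ n" for n t
      using norm_wallis_power_le[of n "m * of_real ((cos t)\<^sup>2)"] power_mono[OF nm[of t], of n] by simp
    show "summable (\<lambda>n. norm m ^ n)" using m by (simp add: summable_geometric)
    show "(?f n has_integral of_real pi * (of_real ((wallis_coeff n)\<^sup>2) * m ^ n)) {0..pi}" for n
    proof -
      have "((\<lambda>t. complex_of_real (cos t ^ (2 * n))) has_integral of_real (pi * wallis_coeff n)) {0..pi}"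
        by (rule has_integral_of_real[OF has_integral_cos_power])
      from has_integral_mult_right[OF this, of "of_real (wallis_coeff n) * m ^ n"]
      show ?thesis by (simp add: power_mult_distrib power2_eq_square mult_ac power_mult)
    qed
  qed
  moreover have "(\<Sum>n. ?f n t) = (1 - m * of_real ((cos t)\<^sup>2)) powr (-1/2)" for t
    using wallis_binomial_sums[of "m * of_real ((cos t)\<^sup>2)"] nm[of t] m by (simp add: sums_iff)
  ultimately show ?thesis
    by (simp only: hyperK_def suminf_mult[OF hyperK_summable[OF m]])
qed

section \<open>The nome maps the lens into the disc\<close>

lemma powr_minus_half_cone:
  assumes "0 < Re v"
  shows "\<bar>Im (v powr (-1/2))\<bar> < Re (v powr (-1/2))"
proof -
  have v: "v \<noteq> 0" using assms by auto
  \<comment> \<open>The argument of \<open>v powr (-1/2)\<close>, below \<open>pi / 4\<close> in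
    absolute value; \<open>cos (2 * y) > 0\<close> then says that the sine is dominated by the
    cosine.\<close>
  define y where "y = - Im (Ln v) / 2"
  have "\<bar>Im (Ln v)\<bar> < pi / 2" using Re_Ln_pos_lt[OF v] assms by auto
  then have y: "\<bar>y\<bar> < pi / 4" by (auto simp: y_def)
  have "cos (2 * y) > 0" using y by (intro cos_gt_zero_pi) auto
  moreover have c: "cos y > 0" using y by (intro cos_gt_zero_pi) auto
  ultimately have "\<bar>sin y\<bar> < cos y"
    by (intro power2_less_imp_less[of "\<bar>sin y\<bar>"]) (auto simp: cos_double)
  then have "exp (Re (- Ln v / 2)) * \<bar>sin y\<bar> < exp (Re (- Ln v / 2)) * cos y" by simp
  moreover have "v powr (-1/2) = exp (- Ln v / 2)" using v by (simp add: powr_def)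
  ultimately show ?thesis by (simp add: Re_exp Im_exp y_def abs_mult)
qed

text \<open>The integrand lies in the sector of half-angle \<open>pi / 4\<close>, a convex cone, so
  the integral does too; compactness of the interval keeps the inequality strict. A mere positive
  real part would not do, because the nome involves a quotient of two values of
  \<open>hyperK\<close>.\<close>

lemma hyperK_cone:
  assumes m: "norm m < 1"
  shows "\<bar>Im (hyperK m)\<bar> < Re (hyperK m)"
proof -
  define u where "u t = (1 - m * of_real ((cos t)\<^sup>2)) powr (-1/2)" for t
  have nm: "norm (m * of_real ((cos t)\<^sup>2)) < 1" for t
    using m by (intro le_less_trans[OF _ m]) (auto simp: norm_mult norm_power abs_square_le_1 intro!: mult_left_le)
  have re: "0 < Re (1 - m * of_real ((cos t)\<^sup>2))" for t
    using nm[of t] complex_Re_le_cmod[of "m * of_real ((cos t)\<^sup>2)"] by simp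
  have "u t = exp (-1/2 * Ln (1 - m * of_real ((cos t)\<^sup>2)))" for t
  proof -
    have "1 - m * of_real ((cos t)\<^sup>2) \<noteq> 0" using re[of t] by (metis less_irrefl zero_complex.sel(1))
    then show ?thesis by (simp add: u_def powr_def)
  qed
  moreover have "continuous_on {0..pi} (\<lambda>t. exp (-1/2 * Ln (1 - m * of_real ((cos t)\<^sup>2))))"
    using re by (intro continuous_intros) (auto simp: complex_nonpos_Reals_iff not_le simp del: of_real_power)
  ultimately have cu: "continuous_on {0..pi} u" by (simp add: u_def)
  define g where "g t = Re (u t) - \<bar>Im (u t)\<bar>" for t
  have "continuous_on {0..pi} g" unfolding g_def by (intro continuous_intros cu)
  then obtain t0 where t0: "t0 \<in> {0..pi}" "\<And>t. t \<in> {0..pi} \<Longrightarrow> g t0 \<le> g t"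
    using continuous_attains_inf[of "{0..pi}" g] by auto
  have g0: "0 < g t0" using powr_minus_half_cone[OF re[of t0]] by (simp add: g_def u_def)
  have int: "(u has_integral of_real pi * hyperK m) {0..pi}"
    unfolding u_def by (rule hyperK_has_integral[OF m])
  note R = has_integral_Re[OF int] and I = has_integral_Im[OF int]
  have c: "((\<lambda>_. g t0) has_integral pi * g t0) {0..pi}"
    using has_integral_const_real[of "g t0" 0 pi] by simp
  have "pi * g t0 \<le> pi * (Re (hyperK m) - Im (hyperK m))"
    using has_integral_le[OF c has_integral_diff[OF R I]] t0(2) by (force simp: g_def right_diff_distrib)
  moreover have "pi * g t0 \<le> pi * (Re (hyperK m) + Im (hyperK m))"
    using has_integral_le[OF c has_integral_add[OF R I]] t0(2) by (force simp: g_def distrib_left)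
  ultimately show ?thesis using g0 by auto
qed

text \<open>Two arguments below \<open>pi / 4\<close> in absolute value differ by less than
  \<open>pi / 2\<close>.\<close>

lemma Re_divide_cone:
  assumes "\<bar>Im a\<bar> < Re a" "\<bar>Im b\<bar> < Re b"
  shows "0 < Re (a / b)"
proof -
  have "- (Im a * Im b) \<le> \<bar>Im a\<bar> * \<bar>Im b\<bar>" by (metis abs_ge_minus_self abs_mult)
  also have "\<dots> < Re a * Re b" using assms by (intro mult_strict_mono') auto
  finally have "0 < Re a * Re b + Im a * Im b" by simp
  moreover have "b \<noteq> 0" using assms by auto
  ultimately show ?thesis
    by (auto simp: Re_divide complex_eq_iff intro!: divide_pos_pos simp: sum_power2_gt_zero_iff)
qed

lemma nome_in_disc:
  assumes "\<omega> \<in> ball 0 1 \<inter> ball 1 1"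
  shows "nome \<omega> \<in> ball 0 1"
proof -
  have n: "norm \<omega> < 1" "norm (1 - \<omega>) < 1" using assms by (auto simp: dist_norm)
  define Q where "Q = hyperK (1 - \<omega>) / hyperK \<omega>"
  have "0 < Re Q" unfolding Q_def using n by (intro Re_divide_cone hyperK_cone)
  moreover have "nome \<omega> = exp (- (of_real pi * Q))" by (simp add: nome_def ellK_eq Q_def)
  ultimately show ?thesis by simp
qed

lemma nome_holomorphic: "nome holomorphic_on ball 0 1 \<inter> ball 1 1"
proof -
  have nz: "hyperK \<omega> \<noteq> 0" if "norm \<omega> < 1" for \<omega> using hyperK_cone[OF that] by auto
  have "(\<lambda>\<omega>. hyperK (1 - \<omega>)) holomorphic_on ball 1 1"
    by (rule holomorphic_on_compose_gen[OF _ hyperK_holomorphic, unfolded o_def])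
       (auto intro!: holomorphic_intros simp: dist_norm norm_minus_commute)
  then have "(\<lambda>\<omega>. exp (- of_real pi * hyperK (1 - \<omega>) / hyperK \<omega>)) holomorphic_on ball 0 1 \<inter> ball 1 1"
    using hyperK_holomorphic
    by (intro holomorphic_intros) (auto intro: holomorphic_on_subset simp: nz)
  moreover have "nome = (\<lambda>\<omega>. exp (- of_real pi * hyperK (1 - \<omega>) / hyperK \<omega>))"
    by (auto simp: nome_def ellK_eq fun_eq_iff)
  ultimately show ?thesis by simp
qed

section \<open>Landen's transformation of the elliptic integral\<close>

lemma has_integral_cis:
  fixes k :: int
  shows "((\<lambda>t. cis (2 * of_int k * t)) has_integral (if k = 0 then of_real pi else 0)) {0..pi}"
proof (cases "k = 0")
  case True
  then show ?thesis using has_integral_const_real[of "1::complex" 0 pi] by (simp add: scaleR_conv_of_real)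
next
  case False
  have "((\<lambda>t. cis (2 * of_int k * t)) has_integral
      (cis (2 * of_int k * pi) / (2 * \<i> * of_int k) - cis (2 * of_int k * 0) / (2 * \<i> * of_int k))) {0..pi}"
  proof (rule fundamental_theorem_of_calculus)
    fix t :: real
    have "((\<lambda>z. exp (\<i> * (2 * of_int k * z)) / (2 * \<i> * of_int k)) has_field_derivative
        exp (\<i> * (2 * of_int k * of_real t))) (at (of_real t))"
      using False by (auto intro!: derivative_eq_intros)
    from has_vector_derivative_real_field[OF this]
    have "((\<lambda>t. exp (\<i> * of_real (2 * of_int k * t)) / (2 * \<i> * of_int k)) has_vector_derivative
        exp (\<i> * of_real (2 * of_int k * t))) (at t within {0..pi})" by simp
    then show "((\<lambda>t. cis (2 * of_int k * t) / (2 * \<i> * of_int k)) has_vector_derivative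
        cis (2 * of_int k * t)) (at t within {0..pi})"
      by (simp add: cis_conv_exp)
  qed auto
  moreover have "cis (2 * of_int k * pi) = 1"
    using cis_multiple_2pi[of "of_int k"] by (simp add: mult_ac)
  ultimately show ?thesis using False by simp
qed

text \<open>Parseval's identity for \<open>(1 - z) powr (-1/2)\<close> on the circle of radius \<open>x\<close>.\<close>

lemma has_integral_wallis_circle:
  fixes x :: real
  assumes x: "0 < x" "x < 1"
  shows "((\<lambda>t. 1 / complex_of_real (norm (1 - of_real x * cis (2 * t)))) has_integral
    of_real pi * hyperK (of_real (x\<^sup>2))) {0..pi}"
proof -
  define F where "F z = (1 - z) powr (-1/2)" for z :: complex
  have Fs: "(\<lambda>n. of_real (wallis_coeff n) * z ^ n) sums F z" if "norm z < 1" for z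
    unfolding F_def by (rule wallis_binomial_sums[OF that])
  define z where "z t = of_real x * cis (2 * t)" for t
  have nz: "norm (z t) = x" "norm (cnj (z t)) = x" for t using x by (auto simp: z_def norm_mult)
  have sg: "summable (\<lambda>n. x ^ n)" using x by (simp add: summable_geometric)
  have cz: "continuous_on {0..pi} z" "continuous_on {0..pi} (\<lambda>t. cnj (z t))"
    unfolding z_def by (intro continuous_intros)+
  have zz: "z t ^ n * cnj (z t) ^ m = of_real (x ^ (n + m)) * cis (2 * of_int (int n - int m) * t)" for t n m
  proof -
    have c: "cnj (z t) = of_real x * cis (- (2 * t))" by (simp add: z_def complex_eq_iff)
    have "z t ^ n = of_real x ^ n * cis (real n * (2 * t))"
      using Complex.DeMoivre[of "2 * t" n] by (simp add: z_def power_mult_distrib)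
    moreover have "cnj (z t) ^ m = of_real x ^ m * cis (real m * (- (2 * t)))"
      using Complex.DeMoivre[of "- (2 * t)" m] by (simp add: c power_mult_distrib)
    ultimately have "z t ^ n * cnj (z t) ^ m = of_real (x ^ (n + m)) * (cis (real n * (2 * t)) * cis (real m * (- (2 * t))))"
      by (simp add: power_add)
    also have "cis (real n * (2 * t)) * cis (real m * (- (2 * t))) = cis (2 * of_int (int n - int m) * t)"
      unfolding cis_mult by (simp add: algebra_simps)
    finally show ?thesis .
  qed
  \<comment> \<open>For fixed \<open>n\<close>, orthogonality of the \<open>cis\<close> functions
    leaves only the term \<open>m = n\<close>. The sum over \<open>n\<close> is integrated
    afterwards, with the second factor already in closed form.\<close>
  have inner: "((\<lambda>t. of_real (wallis_coeff n) * z t ^ n * F (cnj (z t))) has_integral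
      of_real pi * (of_real ((wallis_coeff n)\<^sup>2) * of_real (x\<^sup>2) ^ n)) {0..pi}" for n
  proof -
    let ?f = "\<lambda>m t. of_real (wallis_coeff n) * z t ^ n * (of_real (wallis_coeff m) * cnj (z t) ^ m)"
    let ?I = "\<lambda>m. complex_of_real (wallis_coeff n * wallis_coeff m * x ^ (n + m)) * (if int n - int m = 0 then of_real pi else 0)"
    have "((\<lambda>t. \<Sum>m. ?f m t) has_integral (\<Sum>m. ?I m)) {0..pi}"
    proof (rule has_integral_series)
      show "continuous_on {0..pi} (?f m)" for m by (intro continuous_intros cz)
      show "norm (?f m t) \<le> x ^ m" for m t
      proof -
        have "norm (?f m t) \<le> norm (z t) ^ n * norm (cnj (z t)) ^ m"
          using mult_mono[OF norm_wallis_power_le[of n "z t"] norm_wallis_power_le[of m "cnj (z t)"]]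
          by (simp add: norm_mult)
        also have "\<dots> \<le> 1 * x ^ m" unfolding nz using x by (intro mult_right_mono power_le_one) auto
        finally show ?thesis by simp
      qed
      show "(?f m has_integral ?I m) {0..pi}" for m
      proof -
        have "?f m = (\<lambda>t. of_real (wallis_coeff n * wallis_coeff m * x ^ (n + m)) * cis (2 * of_int (int n - int m) * t))"
          using zz[of _ n m] by (simp add: fun_eq_iff mult_ac)
        then show ?thesis by (simp only: has_integral_mult_right[OF has_integral_cis])
      qed
    qed (rule sg)
    moreover have "(\<Sum>m. ?f m t) = of_real (wallis_coeff n) * z t ^ n * F (cnj (z t))" for t
      using sums_mult[OF Fs[of "cnj (z t)"], of "of_real (wallis_coeff n) * z t ^ n"] nz x by (simp add: sums_iff)
    moreover have "(\<Sum>m. ?I m) = ?I n" by (subst suminf_finite[of "{n}"]) auto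
    moreover have "?I n = of_real pi * (of_real ((wallis_coeff n)\<^sup>2) * of_real (x\<^sup>2) ^ n)"
      by (simp add: power2_eq_square power_add power_mult_distrib)
    ultimately show ?thesis by (simp only:)
  qed
  have re: "0 < Re (1 - cnj (z t))" for t
    using complex_Re_le_cmod[of "z t"] nz[of t] x by simp
  have "F (cnj (z t)) = exp (-1/2 * Ln (1 - cnj (z t)))" for t
    using re[of t] by (auto simp: F_def powr_def)
  moreover have "continuous_on {0..pi} (\<lambda>t. exp (-1/2 * Ln (1 - cnj (z t))))"
    using re by (intro continuous_intros cz) (auto simp: complex_nonpos_Reals_iff not_le)
  ultimately have cF: "continuous_on {0..pi} (\<lambda>t. F (cnj (z t)))" by simp
  have "bounded ((\<lambda>t. F (cnj (z t))) ` {0..pi})"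
    by (intro compact_imp_bounded compact_continuous_image cF) auto
  then obtain C where "\<forall>w\<in>(\<lambda>t. F (cnj (z t))) ` {0..pi}. norm w \<le> C"
    unfolding bounded_iff by blast
  then have C: "norm (F (cnj (z t))) \<le> C" if "t \<in> {0..pi}" for t using that by blast
  have "((\<lambda>t. \<Sum>n. of_real (wallis_coeff n) * z t ^ n * F (cnj (z t))) has_integral
      (\<Sum>n. of_real pi * (of_real ((wallis_coeff n)\<^sup>2) * of_real (x\<^sup>2) ^ n))) {0..pi}"
  proof (rule has_integral_series)
    show "continuous_on {0..pi} (\<lambda>t. of_real (wallis_coeff n) * z t ^ n * F (cnj (z t)))" for n
      by (intro continuous_intros cz cF)
    show "norm (of_real (wallis_coeff n) * z t ^ n * F (cnj (z t))) \<le> x ^ n * C" if "t \<in> {0..pi}" for n t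
      using mult_mono[OF norm_wallis_power_le[of n "z t"] C[OF that]] x by (simp add: norm_mult nz)
    show "summable (\<lambda>n. x ^ n * C)" by (rule summable_mult2[OF sg])
  qed (rule inner)
  moreover have "(\<Sum>n. of_real (wallis_coeff n) * z t ^ n * F (cnj (z t))) = F (z t) * F (cnj (z t))" for t
    using sums_mult2[OF Fs[of "z t"], of "F (cnj (z t))"] nz x by (simp add: sums_iff)
  \<comment> \<open>The exponents combine to a real logarithm: \<open>Ln v + cnj (Ln v)\<close> is
    twice \<open>ln (norm v)\<close>.\<close>
  moreover have "F (z t) * F (cnj (z t)) = 1 / of_real (norm (1 - of_real x * cis (2 * t)))" for t
  proof -
    define v where "v = 1 - z t"
    have re: "0 < Re v" using complex_Re_le_cmod[of "z t"] nz[of t] x by (simp add: v_def)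
    then have v: "v \<noteq> 0" "cnj v \<noteq> 0" by auto
    have "F (z t) * F (cnj (z t)) = exp (-1/2 * Ln v) * exp (-1/2 * Ln (cnj v))"
      using v by (simp add: F_def powr_def v_def)
    also have "\<dots> = exp (- ((Ln v + cnj (Ln v)) / 2))"
      using re by (subst cnj_Ln[symmetric]) (auto simp: complex_nonpos_Reals_iff not_le exp_add[symmetric] add_divide_distrib)
    also have "(Ln v + cnj (Ln v)) / 2 = of_real (ln (norm v))"
      using v by (simp add: complex_add_cnj)
    also have "exp (- complex_of_real (ln (norm v))) = 1 / of_real (norm v)"
      using v by (simp add: exp_minus exp_of_real inverse_eq_divide)
    finally show ?thesis by (simp add: v_def z_def)
  qed
  moreover have "norm (complex_of_real (x\<^sup>2)) < 1" using x by (simp add: norm_power power_less_one_iff)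
  ultimately show ?thesis
    by (simp only: hyperK_def suminf_mult[OF hyperK_summable])
qed

text \<open>The squared distance from 1 to \<open>x * cis (2 * t)\<close> is
  \<open>(1 + x)\<^sup>2 - 4 * x * (cos t)\<^sup>2\<close>, so up to the factor \<open>1 + x\<close>
  the integrands of \<open>hyperK_has_integral\<close> and \<open>has_integral_wallis_circle\<close>
  coincide.\<close>

lemma hyperK_landen:
  fixes x :: real
  assumes x: "0 < x" "x < 1"
  shows "hyperK (of_real (4 * x / (1 + x)\<^sup>2)) = of_real (1 + x) * hyperK (of_real (x\<^sup>2))"
proof -
  define T where "T = 4 * x / (1 + x)\<^sup>2"
  have "4 * x < (1 + x)\<^sup>2" using x zero_less_power2[of "1 - x"] by (simp add: power2_eq_square algebra_simps)
  then have T: "0 < T" "T < 1" using x by (auto simp: T_def)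
  have eq: "(1 - of_real T * of_real ((cos t)\<^sup>2)) powr (-1/2) =
      of_real (1 + x) * (1 / complex_of_real (norm (1 - of_real x * cis (2 * t))))" for t
  proof -
    define w where "w = 1 - T * (cos t)\<^sup>2"
    have "T * (cos t)\<^sup>2 \<le> T * 1" using T by (intro mult_left_mono) (auto simp: abs_square_le_1)
    with T(2) have w: "0 < w" unfolding w_def by linarith
    have expand: "(1 - x * c)\<^sup>2 + (x * s)\<^sup>2 = 1 - 2 * x * c + x\<^sup>2 * (s\<^sup>2 + c\<^sup>2)" for c s
      by (simp add: power2_eq_square algebra_simps)
    have "(norm (1 - of_real x * cis (2 * t)))\<^sup>2 = (1 - x * cos (2 * t))\<^sup>2 + (x * sin (2 * t))\<^sup>2"
      by (simp add: cmod_power2)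
    also have "\<dots> = 1 - 2 * x * cos (2 * t) + x\<^sup>2 * ((sin (2 * t))\<^sup>2 + (cos (2 * t))\<^sup>2)"
      by (rule expand)
    also have "\<dots> = (1 + x)\<^sup>2 - 4 * x * (cos t)\<^sup>2"
      unfolding sin_cos_squared_add unfolding cos_double_cos by (simp add: power2_eq_square algebra_simps)
    also have "\<dots> = (1 + x)\<^sup>2 * w"
      using x by (simp add: w_def T_def right_diff_distrib)
    finally have "norm (1 - of_real x * cis (2 * t)) = (1 + x) * sqrt w"
      using x w by (metis add_nonneg_nonneg less_imp_le norm_ge_zero real_sqrt_abs2 real_sqrt_mult real_sqrt_unique zero_le_one real_sqrt_power power2_eq_square abs_of_nonneg)
    moreover have "(1 - of_real T * of_real ((cos t)\<^sup>2)) powr (-1/2) = complex_of_real (1 / sqrt w)"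
    proof -
      have "1 - of_real T * of_real ((cos t)\<^sup>2) = complex_of_real w" by (simp add: w_def)
      moreover have "complex_of_real w powr (-1/2) = of_real (w powr (-1/2))"
        using w powr_of_real[of w "-1/2"] by simp
      ultimately show ?thesis using w by (simp add: powr_minus powr_half_sqrt inverse_eq_divide)
    qed
    moreover have "1 / sqrt w = (1 + x) * (1 / ((1 + x) * sqrt w))" using x by simp
    ultimately show ?thesis by (metis of_real_mult of_real_divide of_real_1)
  qed
  have "((\<lambda>t. (1 - of_real T * of_real ((cos t)\<^sup>2)) powr (-1/2)) has_integral of_real pi * hyperK (of_real T)) {0..pi}"
    by (rule hyperK_has_integral) (use T in auto)
  moreover have "((\<lambda>t. (1 - of_real T * of_real ((cos t)\<^sup>2)) powr (-1/2)) has_integral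
      of_real (1 + x) * (of_real pi * hyperK (of_real (x\<^sup>2)))) {0..pi}"
    unfolding eq by (rule has_integral_mult_right[OF has_integral_wallis_circle[OF x]])
  ultimately have "of_real pi * hyperK (of_real T) = of_real (1 + x) * (of_real pi * hyperK (of_real (x\<^sup>2)))"
    by (rule has_integral_unique)
  then show ?thesis by (simp add: T_def)
qed

section \<open>The logarithmic singularity of the elliptic integral\<close>

lemma wallis_coeff_asymptotic: "(\<lambda>n. real n * (wallis_coeff n)\<^sup>2) \<longlonglongrightarrow> 1 / pi"
proof -
  have "(\<lambda>n. inverse ((Gamma_series (1/2 :: real) n)\<^sup>2)) \<longlonglongrightarrow> inverse ((Gamma (1/2))\<^sup>2)"
    by (intro tendsto_intros) (simp add: Gamma_one_half_real)
  then have 1: "(\<lambda>n. inverse ((Gamma_series (1/2 :: real) n)\<^sup>2)) \<longlonglongrightarrow> 1 / pi"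
    by (simp add: Gamma_one_half_real inverse_eq_divide)
  have 2: "(\<lambda>n. (real n / (real n + 1/2))\<^sup>2) \<longlonglongrightarrow> 1"
    by real_asymp
  \<comment> \<open>\<open>Gamma_series\<close> has \<open>pochhammer (1/2) (n + 1)\<close> in its
    denominator; the quotient \<open>n / (n + 1/2)\<close> compensates for the surplus
    factor.\<close>
  have eq: "real n * (wallis_coeff n)\<^sup>2 = inverse ((Gamma_series (1/2 :: real) n)\<^sup>2) * (real n / (real n + 1/2))\<^sup>2"
    if "n > 0" for n
  proof -
    have "exp (1/2 * ln (real n)) ^ 2 = real n"
      using that by (simp add: exp_of_nat_mult[symmetric] flip: exp_double)
    then have "(Gamma_series (1/2 :: real) n)\<^sup>2 = (fact n)\<^sup>2 * real n / (pochhammer (1/2) n * (real n + 1/2))\<^sup>2"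
      by (simp add: Gamma_series_def power_divide power_mult_distrib pochhammer_Suc add.commute)
    then show ?thesis
      using that pochhammer_pos[of "1/2::real" n]
      by (simp add: wallis_coeff_def power_divide power_mult_distrib power2_eq_square[of "real n"])
  qed
  have "\<forall>\<^sub>F n in sequentially. inverse ((Gamma_series (1/2 :: real) n)\<^sup>2) * (real n / (real n + 1/2))\<^sup>2 =
      real n * (wallis_coeff n)\<^sup>2"
    using eventually_gt_at_top[of 0] by eventually_elim (simp only: eq)
  from Lim_transform_eventually[OF tendsto_mult[OF 1 2] this] show ?thesis by simp
qed

text \<open>Where \<open>c n\<close> is close to \<open>L / n\<close>, the series is close to
  \<open>L\<close> times the logarithm series, whose sum at \<open>1 - x\<close> is
  \<open>- ln x\<close>; the finitely many exceptional terms stay bounded while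
  \<open>- ln x\<close> tends to infinity.\<close>

lemma abelian_log:
  fixes c :: "nat \<Rightarrow> real"
  assumes c: "(\<lambda>n. real n * c n) \<longlonglongrightarrow> L" and s: "\<And>m. 0 < m \<Longrightarrow> m < 1 \<Longrightarrow> summable (\<lambda>n. c n * m ^ n)"
  shows "((\<lambda>x. (\<Sum>n. c n * (1 - x) ^ n) / (- ln x)) \<longlongrightarrow> L) (at_right 0)"
proof (rule tendstoI)
  fix e :: real assume e: "e > 0"
  obtain N where N: "\<And>n. n \<ge> N \<Longrightarrow> \<bar>real n * c n - L\<bar> < e / 2"
    using LIMSEQ_D[OF c, of "e/2"] e by (auto simp: real_norm_def)
  \<comment> \<open>Bounds the exceptional terms. The index 0 is counted separately, since it is
    exceptional even if \<open>N = 0\<close>: the logarithm series has no such term,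
    \<open>m ^ 0 / 0\<close> being 0.\<close>
  define C where "C = (\<Sum>n<N. \<bar>c n\<bar> + \<bar>L\<bar>) + \<bar>c 0\<bar>"
  have bound: "\<bar>(\<Sum>n. c n * (1 - x) ^ n) - L * (- ln x)\<bar> \<le> C + e / 2 * (- ln x)" if x: "0 < x" "x < 1" for x
  proof -
    define m where "m = 1 - x"
    have m: "0 < m" "m < 1" using x by (auto simp: m_def)
    have h: "(\<lambda>n. m ^ n / real n) sums (- ln x)"
      using sums_minus[OF ln_series'[of "- m"]] m by (simp add: m_def)
    have S: "(\<lambda>n. c n * m ^ n) sums (\<Sum>n. c n * m ^ n)" using s[OF m] by (rule summable_sums)
    have f: "(\<lambda>n. if n < N then (\<bar>c n\<bar> + \<bar>L\<bar>) else 0) sums (\<Sum>n<N. \<bar>c n\<bar> + \<bar>L\<bar>)"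
      using sums_If_finite_set[of "{..<N}" "\<lambda>n. \<bar>c n\<bar> + \<bar>L\<bar>"] by simp
    have f0: "(\<lambda>n. if n = 0 then \<bar>c n\<bar> else 0) sums \<bar>c 0\<bar>"
      using sums_If_finite_set[of "{0}" "\<lambda>n. \<bar>c n\<bar>"] by simp
    have d: "(\<lambda>n. c n * m ^ n - L * (m ^ n / real n)) sums ((\<Sum>n. c n * m ^ n) - L * (- ln x))"
      by (rule sums_diff[OF S sums_mult[OF h]])
    have D: "(\<lambda>n. (if n < N then (\<bar>c n\<bar> + \<bar>L\<bar>) else 0) + (if n = 0 then \<bar>c n\<bar> else 0) + e / 2 * (m ^ n / real n))
        sums (C + e / 2 * (- ln x))"
      unfolding C_def by (intro sums_add f f0 sums_mult h)
    have le: "\<bar>c n * m ^ n - L * (m ^ n / real n)\<bar> \<le>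
        (if n < N then (\<bar>c n\<bar> + \<bar>L\<bar>) else 0) + (if n = 0 then \<bar>c n\<bar> else 0) + e / 2 * (m ^ n / real n)" for n
    proof (cases "n = 0 \<or> n < N")
      case True
      have "\<bar>c n * m ^ n\<bar> \<le> \<bar>c n\<bar>"
        using m by (auto simp: abs_mult intro!: mult_left_le power_le_one)
      moreover have "\<bar>L * (m ^ n / real n)\<bar> \<le> \<bar>L\<bar>" if "n > 0"
      proof -
        have "m ^ n \<le> 1" using m by (intro power_le_one) auto
        then have "m ^ n / real n \<le> 1" using that m by (simp add: divide_simps)
        then show ?thesis using mult_left_le[of "m ^ n / real n" "\<bar>L\<bar>"] m by (simp add: abs_mult)
      qed
      moreover have "0 \<le> e / 2 * (m ^ n / real n)" using e m by simp
      ultimately show ?thesis using True by (cases "n = 0") (auto simp: abs_if split: if_splits)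
    next
      case False
      then have "c n * m ^ n - L * (m ^ n / real n) = (real n * c n - L) * (m ^ n / real n)"
        by (simp add: field_simps)
      also have "\<bar>\<dots>\<bar> \<le> e / 2 * (m ^ n / real n)"
        unfolding abs_mult using N[of n] False m e by (intro mult_mono) auto
      finally show ?thesis using False by simp
    qed
    have "(\<Sum>n. c n * m ^ n) - L * (- ln x) \<le> C + e / 2 * (- ln x)"
      by (rule sums_le[OF _ d D]) (use le in \<open>auto simp: abs_le_iff\<close>)
    moreover have "- ((\<Sum>n. c n * m ^ n) - L * (- ln x)) \<le> C + e / 2 * (- ln x)"
      by (rule sums_le[OF _ sums_minus[OF d] D]) (use le in \<open>auto simp: abs_le_iff\<close>)
    ultimately show ?thesis unfolding m_def by (simp add: abs_le_iff)
  qed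
  have "filterlim (\<lambda>x::real. - ln x) at_top (at_right 0)" by real_asymp
  then have "\<forall>\<^sub>F x in at_right 0. - ln x > 2 * C / e + 1" by (simp add: filterlim_at_top_dense)
  moreover have "\<forall>\<^sub>F x::real in at_right 0. x \<in> {0<..<1}" by (rule eventually_at_right_real) simp
  ultimately show "\<forall>\<^sub>F x in at_right 0. dist ((\<Sum>n. c n * (1 - x) ^ n) / (- ln x)) L < e"
  proof eventually_elim
    case (elim x)
    define H where "H = - ln x"
    have C0: "0 \<le> C" by (auto simp: C_def intro!: add_nonneg_nonneg sum_nonneg)
    have H: "H > 0" "2 * C / e < H" using elim C0 e by (auto simp: H_def)
    then have "C < e / 2 * H" using e by (simp add: field_simps)
    with bound[of x] elim have "\<bar>(\<Sum>n. c n * (1 - x) ^ n) - L * H\<bar> < e * H" unfolding H_def by auto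
    then have "\<bar>((\<Sum>n. c n * (1 - x) ^ n) - L * H) / H\<bar> < e"
      using H by (simp add: abs_divide divide_simps)
    moreover have "((\<Sum>n. c n * (1 - x) ^ n) - L * H) / H = (\<Sum>n. c n * (1 - x) ^ n) / H - L"
      using H by (simp add: diff_divide_distrib)
    ultimately show ?case by (simp only: dist_real_def H_def)
  qed
qed

definition hyperK_re :: "real \<Rightarrow> real" where
  "hyperK_re x = (\<Sum>n. (wallis_coeff n)\<^sup>2 * x ^ n)"

lemma hyperK_re_summable: "summable (\<lambda>n. (wallis_coeff n)\<^sup>2 * x ^ n)" if "0 \<le> x" "x < 1"
proof (rule summable_comparison_test'[where N = 0])
  show "summable (\<lambda>n. x ^ n)" using that by (simp add: summable_geometric)
  show "norm ((wallis_coeff n)\<^sup>2 * x ^ n) \<le> x ^ n" for n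
    using norm_wallis_square_power_le[of n "of_real x"] that by (simp add: norm_mult norm_power)
qed

lemma hyperK_of_real: "hyperK (of_real x) = of_real (hyperK_re x)" if "0 \<le> x" "x < 1"
  using suminf_of_real[OF hyperK_re_summable[OF that], where 'a = complex] by (simp add: hyperK_def hyperK_re_def)

lemma hyperK_re_pos: "0 < hyperK_re x" if "0 \<le> x" "x < 1"
  using hyperK_cone[of "of_real x"] that by (simp add: hyperK_of_real)

lemma hyperK_re_landen:
  assumes "0 < x" "x < 1"
  shows "hyperK_re (4 * x / (1 + x)\<^sup>2) = (1 + x) * hyperK_re (x\<^sup>2)"
proof -
  have "4 * x < (1 + x)\<^sup>2" using assms zero_less_power2[of "1 - x"] by (simp add: power2_eq_square algebra_simps)
  then have "0 \<le> 4 * x / (1 + x)\<^sup>2" "4 * x / (1 + x)\<^sup>2 < 1" "0 \<le> x\<^sup>2" "x\<^sup>2 < 1"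
    using assms by (auto simp: power_less_one_iff)
  then have "complex_of_real (hyperK_re (4 * x / (1 + x)\<^sup>2)) = of_real ((1 + x) * hyperK_re (x\<^sup>2))"
    using hyperK_landen[OF assms] by (simp only: hyperK_of_real of_real_mult)
  then show ?thesis by (simp only: of_real_eq_iff)
qed

definition lnome :: "real \<Rightarrow> real" where
  "lnome x = - pi * hyperK_re (1 - x) / hyperK_re x"

lemma nome_of_real: "nome (of_real x) = of_real (exp (lnome x))" if "0 < x" "x < 1"
proof -
  have "hyperK (1 - of_real x) = of_real (hyperK_re (1 - x))"
    using hyperK_of_real[of "1 - x"] that by simp
  then show ?thesis
    using that by (simp add: nome_def ellK_eq hyperK_of_real lnome_def flip: exp_of_real)
qed

text \<open>\<open>hyperK_re_landen\<close> is applied at \<open>x\<close> and at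
  \<open>y = (1 - x) / (1 + x)\<close>, which exchanges the complementary moduli:
  \<open>y\<^sup>2 = 1 - 4 * x / (1 + x)\<^sup>2\<close> and
  \<open>4 * y / (1 + y)\<^sup>2 = 1 - x\<^sup>2\<close>. The factors \<open>1 + x\<close> and
  \<open>1 + y\<close> have product 2.\<close>

lemma lnome_landen:
  assumes x: "0 < x" "x < 1"
  shows "lnome (x\<^sup>2) = 2 * lnome (4 * x / (1 + x)\<^sup>2)"
proof -
  define y where "y = (1 - x) / (1 + x)"
  have y: "0 < y" "y < 1" using x by (auto simp: y_def)
  have "1 + y = 2 / (1 + x)" using x by (simp add: y_def field_simps)
  moreover have "1 - 4 * x / (1 + x)\<^sup>2 = y\<^sup>2"
    using x by (simp add: y_def power_divide divide_simps) (simp add: power2_eq_square algebra_simps)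
  moreover have "4 * y / (1 + y)\<^sup>2 = 1 - x\<^sup>2"
    unfolding \<open>1 + y = _\<close> using x by (simp add: y_def power_divide divide_simps) (simp add: power2_eq_square algebra_simps)
  ultimately have "hyperK_re (1 - x\<^sup>2) = 2 / (1 + x) * hyperK_re (1 - 4 * x / (1 + x)\<^sup>2)"
    using hyperK_re_landen[OF y] by simp
  moreover have "hyperK_re (x\<^sup>2) > 0" using x by (intro hyperK_re_pos) (auto simp: power_less_one_iff)
  ultimately show ?thesis
    using x by (simp add: lnome_def hyperK_re_landen)
qed

text \<open>Near 0 the numerator is governed by the singularity of \<open>hyperK_re\<close> at 1,
  with constant \<open>1 / pi\<close>, and the denominator tends to 1.\<close>

lemma lnome_asymptotic: "((\<lambda>x. lnome x / ln x) \<longlongrightarrow> 1) (at_right 0)"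
proof -
  have 1: "((\<lambda>x. hyperK_re (1 - x) / (- ln x)) \<longlongrightarrow> 1 / pi) (at_right 0)"
    unfolding hyperK_re_def
    by (rule abelian_log[OF wallis_coeff_asymptotic]) (rule hyperK_re_summable, auto)
  have "isCont hyperK 0"
    using hyperK_holomorphic holomorphic_on_imp_continuous_on continuous_on_interior by fastforce
  moreover have "((\<lambda>x. complex_of_real x) \<longlongrightarrow> 0) (at_right 0)"
    using tendsto_of_real[OF tendsto_ident_at, of 0 "{0<..}"] by simp
  ultimately have "((\<lambda>x. hyperK (of_real x)) \<longlongrightarrow> hyperK 0) (at_right 0)"
    by (metis isCont_tendsto_compose)
  then have "((\<lambda>x. Re (hyperK (of_real x))) \<longlongrightarrow> Re (hyperK 0)) (at_right 0)" by (rule tendsto_Re)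
  moreover have ev: "\<forall>\<^sub>F x::real in at_right 0. x \<in> {0<..<1}" by (rule eventually_at_right_real) simp
  then have "\<forall>\<^sub>F x in at_right 0. Re (hyperK (of_real x)) = hyperK_re x"
    by eventually_elim (simp add: hyperK_of_real)
  ultimately have 2: "(hyperK_re \<longlongrightarrow> 1) (at_right 0)"
    using Lim_transform_eventually[of "\<lambda>x. Re (hyperK (of_real x))"] by (fastforce simp: hyperK_def)
  have "((\<lambda>x. pi * (hyperK_re (1 - x) / (- ln x)) / hyperK_re x) \<longlongrightarrow> pi * (1 / pi) / 1) (at_right 0)"
    by (intro tendsto_intros 1 2) auto
  moreover have "(\<lambda>x. pi * (hyperK_re (1 - x) / (- ln x)) / hyperK_re x) = (\<lambda>x. lnome x / ln x)"
    by (simp add: lnome_def fun_eq_iff)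
  ultimately show ?thesis by simp
qed

section \<open>The lambda function as inverse of the nome\<close>

lemma lam_real:
  assumes "0 < r" "r < 1"
  shows "\<exists>x. 0 < x \<and> x < 1 \<and> lam (of_real r) = of_real x"
proof -
  obtain k where k: "0 < k" "k < 1" "modk (of_real r) = of_real k" using modk_real[OF assms] by blast
  have "4 * k < (1 + k)\<^sup>2" using k zero_less_power2[of "1 - k"] by (simp add: power2_eq_square algebra_simps)
  moreover have "lam (of_real r) = of_real (4 * k / (1 + k)\<^sup>2)"
    using lam_landen[of "of_real r"] assms k by simp
  ultimately show ?thesis using k by (intro exI[of _ "4 * k / (1 + k)\<^sup>2"]) auto
qed

text \<open>Both \<open>lnome\<close> composed with \<open>lam\<close> and \<open>ln\<close> are doubled by \<open>r \<mapsto> r\<^sup>2\<close>, and their ratio tends to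
  \<open>1\<close> at \<open>0\<close>.\<close>

lemma nome_lam_of_real:
  assumes r: "0 < r" "r < 1"
  shows "nome (lam (of_real r)) = of_real r"
proof -
  define g where "g s = Re (lam (of_real s))" for s :: real
  have g: "lam (of_real s) = of_real (g s)" "0 < g s" "g s < 1" if "0 < s" "s < 1" for s
    using lam_real[OF that] by (auto simp: g_def)
  define h where "h s = lnome (g s) / ln s" for s
  have sq: "0 < s\<^sup>2 \<and> s\<^sup>2 < 1" if "0 < s" "s < 1" for s :: real
    using that by (auto simp: power_less_one_iff)
  have step: "h (s\<^sup>2) = h s" if s: "0 < s" "s < 1" for s
  proof -
    obtain k where k: "0 < k" "k < 1" "modk (of_real s) = of_real k" using modk_real[OF s] by blast
    have "complex_of_real (g (s\<^sup>2)) = of_real (k\<^sup>2)"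
      using modk_square[of "of_real s"] g(1)[of "s\<^sup>2"] sq[OF s] k by (simp add: g_def)
    then have "g (s\<^sup>2) = k\<^sup>2" by (simp only: of_real_eq_iff)
    moreover have "complex_of_real (g s) = of_real (4 * k / (1 + k)\<^sup>2)"
      using lam_landen[of "of_real s"] s k g(1)[OF s] by simp
    then have "g s = 4 * k / (1 + k)\<^sup>2" by (simp only: of_real_eq_iff)
    ultimately show ?thesis
      using lnome_landen[OF k(1,2)] s by (simp add: h_def ln_realpow)
  qed
  \<comment> \<open>Thus \<open>h\<close> is constant along the iterated squares of \<open>r\<close>
    and equals its limit at 0.\<close>
  have it: "h (r ^ 2 ^ n) = h r" for n
  proof (induction n)
    case (Suc n)
    have "h ((r ^ 2 ^ n)\<^sup>2) = h (r ^ 2 ^ n)"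
      using r by (intro step) (auto simp: power_less_one_iff)
    then show ?case using Suc.IH by (simp add: power_mult[symmetric] mult.commute)
  qed auto
  define G where "G q = (theta2r q / theta3 q) ^ 4" for q
  have Gc: "isCont G 0"
  proof -
    have "G holomorphic_on ball 0 1"
      unfolding G_def
      by (intro holomorphic_intros theta2r_holomorphic theta3_holomorphic) (auto simp: theta3_nonzero)
    then show ?thesis using holomorphic_on_imp_continuous_on continuous_on_interior by fastforce
  qed
  have lim0: "((\<lambda>s. complex_of_real s) \<longlongrightarrow> 0) (at_right 0)"
    using tendsto_of_real[OF tendsto_ident_at, of 0 "{0<..}"] by simp
  have ev: "\<forall>\<^sub>F s::real in at_right 0. s \<in> {0<..<1}" by (rule eventually_at_right_real) simp
  have lG: "((\<lambda>s. Re (G (of_real s))) \<longlongrightarrow> 16) (at_right 0)"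
    using tendsto_Re[OF isCont_tendsto_compose[OF Gc lim0]] by (simp add: G_def)
  \<comment> \<open>\<open>g s / s\<close> has the finite positive limit 16, whose logarithm is
    negligible against \<open>ln s\<close>; so \<open>ln (g s)\<close> and \<open>ln s\<close> are
    asymptotically equal.\<close>
  have gG: "g s = s * Re (G (of_real s))" for s by (simp add: g_def lam_def G_def)
  have 3: "(g \<longlongrightarrow> 0) (at_right 0)"
    using tendsto_mult[OF tendsto_ident_at lG] by (simp add: gG[abs_def])
  have g_right: "filterlim g (at_right 0) (at_right 0)"
    by (rule tendsto_imp_filterlim_at_right[OF 3]) (use ev in eventually_elim, auto intro: g)
  have "((\<lambda>s. ln (Re (G (of_real s)))) \<longlongrightarrow> ln 16) (at_right 0)"
    by (intro tendsto_intros lG) auto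
  moreover have "filterlim (\<lambda>s::real. ln s) at_bot (at_right 0)" by real_asymp
  ultimately have "((\<lambda>s. 1 + ln (Re (G (of_real s))) / ln s) \<longlongrightarrow> 1 + 0) (at_right 0)"
    by (intro tendsto_intros tendsto_divide_0) (auto intro: filterlim_at_bot_imp_at_infinity)
  moreover have "\<forall>\<^sub>F s in at_right 0. 1 + ln (Re (G (of_real s))) / ln s = ln (g s) / ln s"
    using ev
  proof eventually_elim
    case (elim s)
    then have "0 < Re (G (of_real s))" using g(2)[of s] gG[of s] by (auto simp: zero_less_mult_iff)
    then show ?case using elim by (simp add: gG ln_mult add_divide_distrib)
  qed
  ultimately have 4: "((\<lambda>s. ln (g s) / ln s) \<longlongrightarrow> 1) (at_right 0)"
    by (simp add: Lim_transform_eventually)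
  have "((\<lambda>s. lnome (g s) / ln (g s)) \<longlongrightarrow> 1) (at_right 0)"
    by (rule filterlim_compose[OF lnome_asymptotic g_right])
  from tendsto_mult[OF this 4]
  have "((\<lambda>s. lnome (g s) / ln (g s) * (ln (g s) / ln s)) \<longlongrightarrow> 1) (at_right 0)" by simp
  moreover have "\<forall>\<^sub>F s in at_right 0. lnome (g s) / ln (g s) * (ln (g s) / ln s) = h s"
    using ev
  proof eventually_elim
    case (elim s)
    then have "ln (g s) < 0" using g[of s] by simp
    then show ?case by (simp add: h_def)
  qed
  ultimately have hlim: "(h \<longlongrightarrow> 1) (at_right 0)" by (rule Lim_transform_eventually)
  have "(\<lambda>n. r ^ 2 ^ n) \<longlonglongrightarrow> 0"
    using tendsto_Re[OF power_power2_tendsto_0[of "of_real r"]] r by (simp flip: of_real_power)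
  then have "filterlim (\<lambda>n. r ^ 2 ^ n) (at_right 0) sequentially"
    by (rule tendsto_imp_filterlim_at_right) (use r in auto)
  then have "(\<lambda>n. h (r ^ 2 ^ n)) \<longlonglongrightarrow> 1" by (rule filterlim_compose[OF hlim])
  then have "h r = 1" unfolding it using LIMSEQ_unique[OF tendsto_const] by blast
  then have "lnome (g r) = ln r" using r by (simp add: h_def)
  then show ?thesis using g[OF r] nome_of_real[of "g r"] r by simp
qed

text \<open>At the points \<open>lam r\<close> with \<open>r\<close> real between 0 and 1 this is
  \<open>nome_lam_of_real\<close>. They form an infinite connected set, so they accumulate at one of
  themselves, and the identity theorem extends the equation to the lens.\<close>

lemma lam_nome:
  assumes "\<omega> \<in> ball 0 1 \<inter> ball 1 1"
  shows "lam (nome \<omega>) = \<omega>"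
proof -
  let ?S = "ball (0::complex) 1 \<inter> ball 1 1"
  have S: "open ?S" "connected ?S" by (auto intro: convex_connected convex_Int)
  have hol: "(\<lambda>\<omega>. lam (nome \<omega>) - \<omega>) holomorphic_on ?S"
    by (intro holomorphic_intros holomorphic_on_compose_gen[OF nome_holomorphic lam_holomorphic, unfolded o_def])
       (use nome_in_disc in auto)
  define U where "U = (\<lambda>r. lam (of_real r)) ` {0<..<1::real}"
  have US: "U \<subseteq> ?S"
  proof
    fix u assume "u \<in> U"
    then obtain x where "0 < x" "x < 1" "u = of_real x" unfolding U_def using lam_real by force
    then show "u \<in> ?S"
      using norm_of_real[of "1 - x", where 'a = complex] by (auto simp: dist_norm norm_minus_commute)
  qed
  have zero: "lam (nome u) - u = 0" if "u \<in> U" for u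
    using that nome_lam_of_real by (auto simp: U_def)
  define x0 where "x0 = lam (of_real (1/2))"
  have "inj_on (\<lambda>r. lam (of_real r)) {0<..<1::real}"
    by (rule inj_on_inverseI[where g = "\<lambda>w. Re (nome w)"]) (simp add: nome_lam_of_real)
  moreover have "connected U"
    unfolding U_def
    by (intro connected_continuous_image continuous_intros
          continuous_on_compose2[OF holomorphic_on_imp_continuous_on[OF lam_holomorphic]]) auto
  moreover have x0: "x0 \<in> U"
    unfolding x0_def U_def by (intro image_eqI[where x = "1/2"] refl) simp
  moreover have "infinite U"
    unfolding U_def finite_image_iff[OF calculation(1)] by (simp add: infinite_Ioo)
  ultimately have lim: "x0 islimpt U" using connected_imp_perfect[of U x0] by (metis finite.emptyI finite_insert)
  have "x0 \<in> ?S" using x0 US by blast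
  from analytic_continuation[OF hol S US this lim zero assms] show ?thesis by simp
qed

lemma is_nome_inverse_lam: "is_nome_inverse lam"
  unfolding is_nome_inverse_def using lam_holomorphic nome_in_disc lam_nome by blast

lemma nome_inv_works: "is_nome_inverse nome_inv"
  unfolding nome_inv_def by (rule someI[of is_nome_inverse, OF is_nome_inverse_lam])

text \<open>\<open>nome_inv\<close> is a choice, but it agrees with \<open>lam\<close> on the image
  of the lens. That image is open because \<open>nome\<close> is injective there with left inverse
  \<open>lam\<close>, so the identity theorem applies.\<close>

lemma nome_inv_eq_lam:
  assumes "z \<in> ball 0 1"
  shows "nome_inv z = lam z"
proof (rule analytic_continuation_open[of "nome ` (ball 0 1 \<inter> ball 1 1)" "ball 0 1" nome_inv lam])
  let ?S = "ball (0::complex) 1 \<inter> ball 1 1"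
  have ne: "of_real (1/2) \<in> ?S" by (auto simp: dist_norm)
  show "open (nome ` ?S)"
  proof (rule open_mapping_thm3[OF nome_holomorphic])
    show "inj_on nome ?S" by (rule inj_on_inverseI[of _ lam]) (rule lam_nome)
  qed auto
  show "nome ` ?S \<noteq> {}" using ne by blast
  show "nome ` ?S \<subseteq> ball 0 1" using nome_in_disc by blast
  show "nome_inv holomorphic_on ball 0 1" using nome_inv_works by (simp add: is_nome_inverse_def)
  show "nome_inv u = lam u" if "u \<in> nome ` ?S" for u
  proof -
    from that obtain w where w: "w \<in> ?S" "u = nome w" by blast
    then have "nome_inv u = w" using nome_inv_works by (simp add: is_nome_inverse_def)
    with w show ?thesis by (simp add: lam_nome)
  qed
qed (use assms lam_holomorphic in auto)

section \<open>Lifting through the lambda function\<close>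

text \<open>Landen's relation is solved for the modulus at the squared nome:
  \<open>\<kappa> = (1 - s) / (1 + s)\<close> with \<open>s\<close> a square root of
  \<open>1 - G\<close>, which exists because \<open>G\<close> omits 1. The square of
  \<open>\<kappa>\<close> again omits 0 and 1, so the step can be repeated.\<close>

lemma landen_step:
  assumes G: "G holomorphic_on ball a r" "\<And>w. w \<in> ball a r \<Longrightarrow> G w \<noteq> 0 \<and> G w \<noteq> 1" and r: "0 < r"
    and p: "norm p < 1" "lam p = G a"
  shows "\<exists>\<kappa>. \<kappa> holomorphic_on ball a r \<and> \<kappa> a = modk p \<and>
    (\<forall>w\<in>ball a r. G w = 4 * \<kappa> w / (1 + \<kappa> w)\<^sup>2 \<and> \<kappa> w \<noteq> 0 \<and> (\<kappa> w)\<^sup>2 \<noteq> 1)"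
proof -
  have "(\<lambda>w. 1 - G w) holomorphic_on ball a r" by (intro holomorphic_intros G)
  moreover have "contractible (ball a r)" by (simp add: convex_imp_contractible)
  ultimately obtain s0 where s0: "s0 holomorphic_on ball a r" "\<And>w. w \<in> ball a r \<Longrightarrow> 1 - G w = (s0 w)\<^sup>2"
    using contractible_imp_holomorphic_sqrt[of "\<lambda>w. 1 - G w" "ball a r"] G(2) by auto
  have a: "a \<in> ball a r" using r by simp
  define k where "k = modk p"
  have k: "1 + k \<noteq> 0" using modk_neq_minus_1[OF p(1)] by (simp add: k_def)
  \<comment> \<open>The complementary modulus at \<open>p\<close>. The root is chosen to take this
    value at \<open>a\<close>; as \<open>t \<mapsto> (1 - t) / (1 + t)\<close> is an involution,
    \<open>\<kappa>\<close> then has the value \<open>k\<close> there.\<close>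
  define t where "t = (1 - k) / (1 + k)"
  have "(s0 a)\<^sup>2 = t\<^sup>2" using s0(2)[OF a] one_minus_lam[OF p(1)] p(2) by (simp add: t_def k_def)
  then have "s0 a = t \<or> - s0 a = t" by (auto simp: power2_eq_iff)
  then have "\<exists>s. s holomorphic_on ball a r \<and> (\<forall>w\<in>ball a r. 1 - G w = (s w)\<^sup>2) \<and> s a = t"
  proof
    assume "s0 a = t"
    then show ?thesis using s0 by blast
  next
    assume "- s0 a = t"
    then show ?thesis using s0 by (intro exI[of _ "\<lambda>w. - s0 w"]) (auto intro: holomorphic_on_minus)
  qed
  then obtain s where s: "s holomorphic_on ball a r" "\<And>w. w \<in> ball a r \<Longrightarrow> 1 - G w = (s w)\<^sup>2" "s a = t"
    by blast
  have nz: "1 + s w \<noteq> 0" "1 - s w \<noteq> 0" "s w \<noteq> 0" if "w \<in> ball a r" for w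
  proof -
    have "(1 + s w) * (1 - s w) = G w" using s(2)[OF that] by (simp add: power2_eq_square algebra_simps)
    then show "1 + s w \<noteq> 0" "1 - s w \<noteq> 0" using G(2)[OF that] by auto
    show "s w \<noteq> 0" using s(2)[OF that] G(2)[OF that] by auto
  qed
  define \<kappa> where "\<kappa> w = (1 - s w) / (1 + s w)" for w
  show ?thesis
  proof (intro exI[of _ \<kappa>] conjI ballI)
    show "\<kappa> holomorphic_on ball a r" unfolding \<kappa>_def by (intro holomorphic_intros s) (use nz in auto)
    show "\<kappa> a = modk p"
      using k unfolding \<kappa>_def s(3) t_def k_def by (simp add: divide_simps)
    fix w assume w: "w \<in> ball a r"
    note nz = nz[OF w]
    have "1 + \<kappa> w = 2 / (1 + s w)" using nz by (simp add: \<kappa>_def divide_simps)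
    then have "4 * \<kappa> w / (1 + \<kappa> w)\<^sup>2 = (1 - s w) * (1 + s w)"
      using nz by (simp add: \<kappa>_def power_divide power2_eq_square)
    also have "\<dots> = G w" using s(2)[OF w] by (simp add: power2_eq_square algebra_simps)
    finally show "G w = 4 * \<kappa> w / (1 + \<kappa> w)\<^sup>2" ..
    show "\<kappa> w \<noteq> 0" using nz by (simp add: \<kappa>_def)
    \<comment> \<open>The value 1 would mean \<open>s w = 0\<close>, that is \<open>G w = 1\<close>;
      the value -1 is not attained by \<open>(1 - s) / (1 + s)\<close>.\<close>
    have "\<kappa> w \<noteq> 1" "\<kappa> w \<noteq> - 1" using nz by (auto simp: \<kappa>_def divide_simps)
    then show "(\<kappa> w)\<^sup>2 \<noteq> 1" by (simp add: power2_eq_1_iff)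
  qed
qed

lemma compact_subset_ball_imp_cball:
  fixes a :: "'a::metric_space"
  assumes "compact K" "K \<subseteq> ball a r" "0 < r"
  obtains t where "0 < t" "t < r" "K \<subseteq> cball a t"
proof (cases "K = {}")
  case True
  then show ?thesis using that[of "r/2"] assms by auto
next
  case False
  have "\<exists>x\<in>K. \<forall>y\<in>K. dist a y \<le> dist a x"
    by (rule continuous_attains_sup[OF assms(1) False]) (intro continuous_intros)
  then obtain x where x: "x \<in> K" "\<And>y. y \<in> K \<Longrightarrow> dist a y \<le> dist a x" by blast
  show ?thesis
    by (rule that[of "max (dist a x) (r/2)"]) (use x assms in \<open>force simp: less_max_iff_disj\<close>)+
qed

text \<open>Functions omitting \<open>0\<close> and \<open>1\<close> that are small at the centre are small: Schottky's theorem
  bounds them, and by Montel and Hurwitz a limit of them that vanishes at \<open>a\<close> vanishes identically.\<close>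

lemma omitting_small:
  fixes W :: "nat \<Rightarrow> complex \<Rightarrow> complex"
  assumes hol: "\<And>n. W n holomorphic_on ball a r" and om: "\<And>n w. w \<in> ball a r \<Longrightarrow> W n w \<noteq> 0 \<and> W n w \<noteq> 1"
    and lim: "(\<lambda>n. W n a) \<longlonglongrightarrow> 0" and r: "0 < r'" "r' < r" and e: "0 < e"
  shows "\<exists>n\<ge>N. \<forall>w\<in>ball a r'. norm (W n w) < e"
proof -
  obtain R where R: "\<And>n. norm (W n a) \<le> R"
    using convergent_imp_Bseq[OF convergentI[OF lim]] unfolding Bseq_def by blast
  have bounded: "\<exists>B. \<forall>h\<in>range W. \<forall>z\<in>K. norm (h z) \<le> B" if K: "compact K" "K \<subseteq> ball a r" for K
  proof -
    obtain t where t: "0 < t" "t < r" "K \<subseteq> cball a t"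
      using compact_subset_ball_imp_cball[OF K] r by auto
    \<comment> \<open>A radius between \<open>t\<close> and \<open>r\<close> makes room: after
      rescaling by \<open>\<rho>\<close>, Schottky's theorem applies on the closed unit disc and
      bounds the function up to radius \<open>t / \<rho>\<close>.\<close>
    define \<rho> where "\<rho> = (t + r) / 2"
    have \<rho>: "t < \<rho>" "\<rho> < r" "0 < \<rho>" using t by (auto simp: \<rho>_def)
    define B where "B = exp (pi * exp (pi * (2 + 2 * R + 12 * (t / \<rho>) / (1 - t / \<rho>))))"
    have "norm (W n z) \<le> B" if z: "z \<in> K" for n z
    proof -
      define f where "f u = W n (a + of_real \<rho> * u)" for u
      have sub: "a + of_real \<rho> * u \<in> ball a r" if "u \<in> cball 0 1" for u
      proof -
        have "norm (of_real \<rho> * u) \<le> \<rho> * 1" using that \<rho> by (auto simp: norm_mult)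
        then show ?thesis using \<rho> by (simp add: dist_norm)
      qed
      have "f holomorphic_on cball 0 1"
        unfolding f_def by (rule holomorphic_on_compose_gen[OF _ hol, unfolded o_def])
          (use sub in \<open>auto intro!: holomorphic_intros\<close>)
      moreover have "norm (f 0) \<le> R" using R by (simp add: f_def)
      moreover have "\<not> (f u = 0 \<or> f u = 1)" if "u \<in> cball 0 1" for u
        using om[OF sub[OF that]] by (simp add: f_def)
      moreover have "norm ((z - a) / of_real \<rho>) \<le> t / \<rho>"
        using z t \<rho> by (auto simp: norm_divide dist_norm norm_minus_commute intro!: divide_right_mono)
      ultimately have "norm (f ((z - a) / of_real \<rho>)) \<le> B"
        unfolding B_def using t \<rho> by (intro Schottky) auto
      then show ?thesis using \<rho> by (simp add: f_def)
    qed
    then show ?thesis by blast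
  qed
  have "h holomorphic_on ball a r" if "h \<in> range W" for h using hol that by blast
  note Montel = Montel[OF open_ball this bounded subset_refl]
  obtain g s where g: "g holomorphic_on ball a r" "strict_mono s"
      "\<And>x. x \<in> ball a r \<Longrightarrow> (\<lambda>n. W (s n) x) \<longlonglongrightarrow> g x"
      "\<And>K. compact K \<Longrightarrow> K \<subseteq> ball a r \<Longrightarrow> uniform_limit K (W \<circ> s) g sequentially"
    by (rule Montel) (assumption | rule that)+
  have a: "a \<in> ball a r" using r by simp
  have "(\<lambda>n. W (s n) a) \<longlonglongrightarrow> 0" using LIMSEQ_subseq_LIMSEQ[OF lim g(2)] by (simp add: o_def)
  then have ga: "g a = 0" using g(3)[OF a] LIMSEQ_unique by blast
  have "g constant_on ball a r"
  proof (rule ccontr)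
    assume "\<not> g constant_on ball a r"
    then have "g a \<noteq> 0"
      by (intro Hurwitz_no_zeros[of "ball a r" "W \<circ> s" g]) (use hol g om a in auto)
    with ga show False by simp
  qed
  then have g0: "g w = 0" if "w \<in> ball a r" for w using that ga a by (auto simp: constant_on_def)
  have "uniform_limit (cball a r') (W \<circ> s) g sequentially" using r by (intro g(4)) auto
  then have "\<forall>\<^sub>F n in sequentially. \<forall>w\<in>cball a r'. dist ((W \<circ> s) n w) (g w) < e"
    using e by (rule uniform_limitD)
  then obtain n0 where n0: "\<And>n w. n \<ge> n0 \<Longrightarrow> w \<in> cball a r' \<Longrightarrow> dist ((W \<circ> s) n w) (g w) < e"
    unfolding eventually_sequentially by blast
  \<comment> \<open>Convergence is known along the subsequence \<open>s\<close> only, so the claim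
    provides some index beyond \<open>N\<close>; the one taken is \<open>s n\<close>, which is at
    least \<open>n\<close>.\<close>
  define n where "n = max n0 N"
  have "s n \<ge> N" using seq_suble[OF g(2), of n] by (simp add: n_def)
  moreover have "norm (W (s n) w) < e" if "w \<in> ball a r'" for w
    using n0[of n w] g0[of w] that r by (auto simp: n_def)
  ultimately show ?thesis by blast
qed

text \<open>The quotient of \<open>u\<close> and \<open>v\<close> is continuous with values 1 and
  -1, hence constant. In the lifting argument this settles the sign of a square root.\<close>

lemma square_eq_imp_eq_connected:
  fixes u v :: "complex \<Rightarrow> complex"
  assumes "connected S" "continuous_on S u" "continuous_on S v" "\<And>w. w \<in> S \<Longrightarrow> (u w)\<^sup>2 = (v w)\<^sup>2"
    "\<And>w. w \<in> S \<Longrightarrow> v w \<noteq> 0" "a \<in> S" "u a = v a" "w \<in> S"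
  shows "u w = v w"
proof -
  have "u w / v w \<in> {1, -1}" if "w \<in> S" for w
    using assms(4,5)[OF that] by (auto simp: power2_eq_iff)
  then have "(\<lambda>w. u w / v w) ` S \<subseteq> {1, -1}" by blast
  then have "finite ((\<lambda>w. u w / v w) ` S)" by (rule finite_subset) simp
  then have "(\<lambda>w. u w / v w) constant_on S"
    using assms by (intro continuous_finite_range_constant continuous_intros) auto
  then have "u w / v w = u a / v a" using assms(6,8) by (auto simp: constant_on_def)
  then show ?thesis using assms(5)[OF assms(8)] assms(5)[OF assms(6)] assms(7) by simp
qed

lemma lam_local_inverse_0:
  obtains d e h where "0 < d" "d \<le> 1" "0 < e" "h holomorphic_on ball 0 e"
    "\<And>w. w \<in> ball 0 e \<Longrightarrow> h w \<in> ball 0 d \<and> lam (h w) = w"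
    "\<And>q. q \<in> ball 0 d \<Longrightarrow> lam q \<in> ball 0 e \<Longrightarrow> h (lam q) = q"
proof -
  obtain d where d: "d > 0" "ball 0 d \<subseteq> ball (0::complex) 1" "inj_on lam (ball 0 d)"
    using has_complex_derivative_locally_injective[OF lam_holomorphic, of 0] by (auto simp: deriv_lam_0)
  have hol: "lam holomorphic_on ball 0 d" using lam_holomorphic d(2) by (rule holomorphic_on_subset)
  obtain h where h: "h holomorphic_on lam ` ball 0 d" "\<And>z. z \<in> ball 0 d \<Longrightarrow> h (lam z) = z"
    by (metis holomorphic_has_inverse[OF hol open_ball d(3)])
  have "open (lam ` ball 0 d)" by (rule open_mapping_thm3[OF hol _ d(3)]) simp
  moreover have "0 \<in> lam ` ball 0 d" using d(1) by (intro image_eqI[of _ _ 0]) auto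
  ultimately obtain e where e: "e > 0" "ball 0 e \<subseteq> lam ` ball 0 d" by (auto simp: open_contains_ball)
  show ?thesis
  proof (rule that[OF d(1) _ e(1)])
    show "d \<le> 1" using d(1,2) by (simp add: ball_subset_ball_iff)
    show "h holomorphic_on ball 0 e" by (rule holomorphic_on_subset[OF h(1) e(2)])
    show "h w \<in> ball 0 d \<and> lam (h w) = w" if "w \<in> ball 0 e" for w
      using that e(2) h(2) by (metis (no_types, lifting) imageE subsetD)
  qed (use h in auto)
qed

text \<open>\<open>lam\<close> has the lifting property of a covering of the plane without \<open>0\<close> and \<open>1\<close>: the iterated
  Landen transforms of \<open>F\<close> tend to \<open>0\<close>, where \<open>lam\<close> is invertible, and the lift of the \<open>n\<close>-th
  transform is the power \<open>2 ^ n\<close> of a lift of \<open>F\<close>.\<close>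

lemma lam_lift:
  assumes F: "F holomorphic_on ball a r" "\<And>w. w \<in> ball a r \<Longrightarrow> F w \<noteq> 0 \<and> F w \<noteq> 1"
    and p: "norm p < 1" "lam p = F a" and r: "0 < r'" "r' < r"
  obtains g where "g holomorphic_on ball a r'" "g a = p"
    "\<And>w. w \<in> ball a r' \<Longrightarrow> norm (g w) < 1 \<and> lam (g w) = F w"
proof -
  let ?B = "ball a r"
  have a: "a \<in> ?B" "a \<in> ball a r'" using r by auto
  have pn: "norm (p ^ 2 ^ n) < 1" for n using p(1) by (simp add: norm_power power_less_one_iff)
  \<comment> \<open>\<open>P n\<close> says that the \<open>n\<close>-th transform omits 0 and 1 and
    lies over \<open>p ^ 2 ^ n\<close> at \<open>a\<close>; \<open>Q n\<close> links two consecutive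
    transforms by Landen's formula. They are built by dependent choice, as each root is taken of the
    previous function.\<close>
  define P where "P n G \<longleftrightarrow> G holomorphic_on ?B \<and> (\<forall>w\<in>?B. G w \<noteq> 0 \<and> G w \<noteq> 1) \<and>
      G a = lam (p ^ 2 ^ n) \<and> (n = 0 \<longrightarrow> G = F)" for n :: nat and G
  define Q where "Q n G G' \<longleftrightarrow> (\<exists>\<kappa>. \<kappa> holomorphic_on ?B \<and> \<kappa> a = modk (p ^ 2 ^ n) \<and>
      (\<forall>w\<in>?B. G w = 4 * \<kappa> w / (1 + \<kappa> w)\<^sup>2 \<and> \<kappa> w \<noteq> 0 \<and> G' w = (\<kappa> w)\<^sup>2))" for n :: nat and G G'
  have "\<exists>W. \<forall>n. P n (W n) \<and> Q n (W n) (W (Suc n))"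
  proof (rule dependent_nat_choice)
    show "\<exists>G. P 0 G" using F p by (intro exI[of _ F]) (auto simp: P_def)
    fix G n assume "P n G"
    then have G: "G holomorphic_on ?B" "\<And>w. w \<in> ?B \<Longrightarrow> G w \<noteq> 0 \<and> G w \<noteq> 1" "lam (p ^ 2 ^ n) = G a"
      by (auto simp: P_def)
    obtain \<kappa> where \<kappa>: "\<kappa> holomorphic_on ?B" "\<kappa> a = modk (p ^ 2 ^ n)"
      "\<And>w. w \<in> ?B \<Longrightarrow> G w = 4 * \<kappa> w / (1 + \<kappa> w)\<^sup>2 \<and> \<kappa> w \<noteq> 0 \<and> (\<kappa> w)\<^sup>2 \<noteq> 1"
      using landen_step[OF G(1,2) _ pn G(3)] r by auto
    have "P (Suc n) (\<lambda>w. (\<kappa> w)\<^sup>2)"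
      using \<kappa> by (auto simp: P_def modk_square mult.commute simp flip: power_mult intro!: holomorphic_intros)
    moreover have "Q n G (\<lambda>w. (\<kappa> w)\<^sup>2)"
      unfolding Q_def using \<kappa> by (intro exI[of _ \<kappa>]) auto
    ultimately show "\<exists>y. P (Suc n) y \<and> Q n G y" by blast
  qed
  then obtain W where WP: "\<And>n. P n (W n)" and WQ: "\<And>n. Q n (W n) (W (Suc n))" by blast
  have W: "W n holomorphic_on ?B" "w \<in> ?B \<Longrightarrow> W n w \<noteq> 0 \<and> W n w \<noteq> 1" "W n a = lam (p ^ 2 ^ n)" "W 0 = F" for n w
    using WP[of n] WP[of 0] by (auto simp: P_def)
  obtain d e h where h: "0 < d" "d \<le> 1" "0 < e" "h holomorphic_on ball 0 e"
    "\<And>w. w \<in> ball 0 e \<Longrightarrow> h w \<in> ball 0 d \<and> lam (h w) = w"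
    "\<And>q. q \<in> ball 0 d \<Longrightarrow> lam q \<in> ball 0 e \<Longrightarrow> h (lam q) = q"
    using lam_local_inverse_0 by metis
  have p0: "(\<lambda>n. p ^ 2 ^ n) \<longlonglongrightarrow> 0" by (rule power_power2_tendsto_0[OF p(1)])
  have "isCont lam 0"
    using lam_holomorphic holomorphic_on_imp_continuous_on continuous_on_interior by fastforce
  from isCont_tendsto_compose[OF this p0] have lim: "(\<lambda>n. W n a) \<longlonglongrightarrow> 0" by (simp add: W)
  have "\<forall>\<^sub>F n in sequentially. dist (p ^ 2 ^ n) 0 < d" using tendstoD[OF p0 h(1)] .
  \<comment> \<open>\<open>h\<close> inverts \<open>lam\<close> only inside \<open>ball 0 d\<close>.
    With \<open>p ^ 2 ^ n\<close> in this ball, the lift takes that value at \<open>a\<close> and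
    not another one over \<open>lam (p ^ 2 ^ n)\<close>.\<close>
  then obtain N where N: "\<And>n. n \<ge> N \<Longrightarrow> norm (p ^ 2 ^ n) < d" by (auto simp: eventually_sequentially)
  obtain n where n: "n \<ge> N" "\<And>w. w \<in> ball a r' \<Longrightarrow> norm (W n w) < e"
    using omitting_small[OF W(1,2) lim r h(3), of N] by blast
  define G where "G w = h (W n w)" for w
  have sub: "ball a r' \<subseteq> ?B" using r by auto
  have G: "G holomorphic_on ball a r'" "G a = p ^ 2 ^ n"
    "\<And>w. w \<in> ball a r' \<Longrightarrow> norm (G w) < 1 \<and> lam (G w) = W n w \<and> G w \<noteq> 0"
  proof -
    show "G holomorphic_on ball a r'"
      unfolding G_def by (rule holomorphic_on_compose_gen[OF holomorphic_on_subset[OF W(1) sub] h(4), unfolded o_def])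
        (use n(2) in auto)
    show "G a = p ^ 2 ^ n"
      unfolding G_def W(3) by (rule h(6)) (use N[OF n(1)] n(2)[OF a(2)] W(3)[of n] in auto)
    show "norm (G w) < 1 \<and> lam (G w) = W n w \<and> G w \<noteq> 0" if "w \<in> ball a r'" for w
      using h(5)[of "W n w"] n(2)[OF that] h(2) W(2)[of w n] that sub by (auto simp: G_def)
  qed
  obtain L where L: "L holomorphic_on ball a r'" "\<And>w. w \<in> ball a r' \<Longrightarrow> G w = exp (L w)"
    using contractible_imp_holomorphic_log[OF G(1)] G(3) by (metis convex_ball convex_imp_contractible)
  \<comment> \<open>\<open>exp (L w / 2 ^ n)\<close> is some root of order \<open>2 ^ n\<close> of
    \<open>G w\<close>; the constant \<open>c\<close>, a root of unity, adjusts its value at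
    \<open>a\<close> to \<open>p\<close>.\<close>
  define c where "c = p / exp (L a / 2 ^ n)"
  define g where "g w = c * exp (L w / 2 ^ n)" for w
  have root: "exp (L w / 2 ^ n) ^ 2 ^ n = G w" if "w \<in> ball a r'" for w
    using L(2)[OF that] by (simp flip: exp_of_nat_mult)
  have "c ^ 2 ^ n = 1"
    using root[OF a(2)] G(2) G(3)[OF a(2)] by (simp add: c_def power_divide)
  then have gp: "g w ^ 2 ^ n = G w" if "w \<in> ball a r'" for w
    using root[OF that] by (simp add: g_def power_mult_distrib)
  have ga: "g a = p" by (simp add: g_def c_def)
  have ghol: "g holomorphic_on ball a r'" unfolding g_def by (intro holomorphic_intros L) auto
  have g1: "norm (g w) < 1" if "w \<in> ball a r'" for w
  proof -
    have "norm (g w) ^ 2 ^ n < 1" using gp[OF that] G(3)[OF that] by (simp flip: norm_power)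
    then show ?thesis by (simp add: power_less_one_iff)
  qed
  have gi1: "norm (g w ^ 2 ^ i) < 1" if "w \<in> ball a r'" for w i
    using g1[OF that] by (simp add: norm_power power_less_one_iff)
  \<comment> \<open>Downwards from \<open>n\<close> to 0: by the level above,
    \<open>modk (g w ^ 2 ^ i)\<close> and the chosen \<open>\<kappa>\<close> have the same square,
    their common value at \<open>a\<close> settles the sign, and Landen's formula gives the level
    \<open>i\<close>.\<close>
  have "\<forall>w\<in>ball a r'. lam (g w ^ 2 ^ i) = W i w" if "i \<le> n" for i
    using that
  proof (induction i rule: inc_induct)
    case base
    then show ?case using gp G(3) by auto
  next
    case (step i)
    obtain \<kappa> where \<kappa>: "\<kappa> holomorphic_on ?B" "\<kappa> a = modk (p ^ 2 ^ i)"
      "\<And>w. w \<in> ?B \<Longrightarrow> W i w = 4 * \<kappa> w / (1 + \<kappa> w)\<^sup>2 \<and> \<kappa> w \<noteq> 0 \<and> W (Suc i) w = (\<kappa> w)\<^sup>2"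
      using WQ[of i] by (auto simp: Q_def)
    have mh: "(\<lambda>w. modk (g w ^ 2 ^ i)) holomorphic_on ball a r'"
      by (rule holomorphic_on_compose_gen[OF _ modk_holomorphic, unfolded o_def])
         (use gi1 in \<open>auto intro!: holomorphic_intros ghol\<close>)
    have "modk (g w ^ 2 ^ i) = \<kappa> w" if w: "w \<in> ball a r'" for w
    proof (rule square_eq_imp_eq_connected[where S = "ball a r'" and a = a and v = \<kappa>
          and u = "\<lambda>w. modk (g w ^ 2 ^ i)"])
      show "(modk (g w ^ 2 ^ i))\<^sup>2 = (\<kappa> w)\<^sup>2" if "w \<in> ball a r'" for w
        using step.IH \<kappa>(3)[of w] that sub by (auto simp: modk_square mult.commute simp flip: power_mult)
    qed (use w a sub \<kappa> ga mh in \<open>auto intro: holomorphic_on_imp_continuous_on holomorphic_on_subset\<close>)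
    then show ?case
      using \<kappa>(3) sub lam_landen[OF gi1] by (metis subsetD)
  qed
  from this[of 0] have "lam (g w) = F w" if "w \<in> ball a r'" for w using that by (simp add: W)
  with ghol ga g1 that show ?thesis by blast
qed

text \<open>Off 0, lifting the identity map near \<open>lam q\<close> yields a holomorphic right
  inverse of \<open>lam\<close> through \<open>q\<close>, and the chain rule makes the two
  derivatives reciprocal.\<close>

lemma deriv_lam_nonzero:
  assumes q: "norm q < 1"
  shows "deriv lam q \<noteq> 0"
proof (cases "q = 0")
  case False
  have "open (- {0, 1 :: complex})" by (intro open_Compl finite_imp_closed) auto
  moreover have "lam q \<in> - {0, 1}" using False lam_eq_0_iff[OF q] lam_neq_1[OF q] by auto
  ultimately obtain r where r: "r > 0" "ball (lam q) r \<subseteq> - {0, 1}" unfolding open_contains_ball by blast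
  then have om: "w \<noteq> 0 \<and> w \<noteq> 1" if "w \<in> ball (lam q) r" for w using that by blast
  obtain g where g: "g holomorphic_on ball (lam q) (r/2)" "g (lam q) = q"
      "\<And>w. w \<in> ball (lam q) (r/2) \<Longrightarrow> norm (g w) < 1 \<and> lam (g w) = w"
    using lam_lift[of "\<lambda>w. w" "lam q" r q "r/2"] om q r(1) by (auto intro: holomorphic_on_ident)
  have "(g has_field_derivative deriv g (lam q)) (at (lam q))"
    using r(1) by (intro holomorphic_derivI[OF g(1)]) auto
  moreover have "(lam has_field_derivative deriv lam q) (at (g (lam q)))"
    unfolding g(2) using q by (intro holomorphic_derivI[OF lam_holomorphic]) auto
  ultimately have "((\<lambda>w. lam (g w)) has_field_derivative deriv lam q * deriv g (lam q)) (at (lam q))"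
    using DERIV_chain2 by blast
  moreover have "((\<lambda>w. lam (g w)) has_field_derivative 1) (at (lam q))"
    by (rule has_field_derivative_transform_within_open[OF DERIV_ident, of "ball (lam q) (r/2)"])
       (use r(1) g(3) in auto)
  ultimately have "deriv lam q * deriv g (lam q) = 1" by (rule DERIV_unique)
  then show ?thesis by auto
qed (simp add: deriv_lam_0)

section \<open>The covering \<open>phi\<close>\<close>

lemma log_continuation_works: "is_log_continuation log_one_minus_nome_inv"
proof -
  have "(\<lambda>z. 1 - lam z) holomorphic_on ball 0 1" by (intro holomorphic_intros lam_holomorphic)
  moreover have "contractible (ball (0::complex) 1)" by (simp add: convex_imp_contractible)
  moreover have "1 - lam z \<noteq> 0" if "z \<in> ball 0 1" for z using lam_neq_1[of z] that by auto
  ultimately obtain M where M: "M holomorphic_on ball 0 1" "\<And>z. z \<in> ball 0 1 \<Longrightarrow> 1 - lam z = exp (M z)"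
    using contractible_imp_holomorphic_log[of "\<lambda>z. 1 - lam z" "ball 0 1"] by metis
  \<comment> \<open>\<open>exp (M 0) = 1 - lam 0 = 1\<close>, so the subtraction leaves the
    exponential unchanged.\<close>
  define L where "L z = M z - M 0" for z
  have L: "L holomorphic_on ball 0 1" "L 0 = 0" unfolding L_def by (auto intro!: holomorphic_intros M)
  have eL: "exp (L z) = 1 - lam z" if "z \<in> ball 0 1" for z
    using M(2)[OF that] M(2)[of 0] by (simp add: L_def exp_diff)
  have "isCont L 0"
    using L(1) holomorphic_on_imp_continuous_on continuous_on_interior by fastforce
  then have "(L \<longlongrightarrow> 0) (nhds 0)" using L(2) by (simp add: isCont_def tendsto_nhds_iff)
  then have "\<forall>\<^sub>F z in nhds 0. dist (L z) 0 < pi" by (rule tendstoD) simp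
  moreover have "\<forall>\<^sub>F z in nhds 0. z \<in> ball (0::complex) 1" by (intro eventually_nhds_in_open) auto
  ultimately have "\<forall>\<^sub>F z in nhds 0. L z = Ln (1 - nome_inv z)"
  proof eventually_elim
    case (elim z)
    have "\<bar>Im (L z)\<bar> < pi" using elim(1) abs_Im_le_cmod[of "L z"] by simp
    then have "Ln (exp (L z)) = L z" by (intro Ln_exp) auto
    then show ?case using eL[OF elim(2)] nome_inv_eq_lam[OF elim(2)] by simp
  qed
  with L have "is_log_continuation L" by (simp add: is_log_continuation_def)
  then show ?thesis unfolding log_one_minus_nome_inv_def by (rule someI[of is_log_continuation])
qed

lemma phi_holomorphic: "phi holomorphic_on ball 0 1"
  and phi_0 [simp]: "phi 0 = 0"
  using log_continuation_works
  by (auto simp: phi_def[abs_def] is_log_continuation_def intro!: holomorphic_intros)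

lemma exp_phi:
  assumes "norm z < 1"
  shows "exp (2 * of_real pi * \<i> * phi z) = 1 - lam z"
proof -
  let ?L = log_one_minus_nome_inv
  have L: "?L holomorphic_on ball 0 1" "\<forall>\<^sub>F z in nhds 0. ?L z = Ln (1 - nome_inv z)"
    using log_continuation_works by (auto simp: is_log_continuation_def)
  then have "\<forall>\<^sub>F z in nhds 0. ?L z = Ln (1 - nome_inv z) \<and> z \<in> ball (0::complex) 1"
    by (intro eventually_conj eventually_nhds_in_open) auto
  then obtain S where S: "open S" "0 \<in> S" "\<And>z. z \<in> S \<Longrightarrow> ?L z = Ln (1 - nome_inv z) \<and> z \<in> ball 0 1"
    unfolding eventually_nhds by blast
  have "exp (?L z) = 1 - lam z"
  proof (rule analytic_continuation_open[of S "ball 0 1" "\<lambda>z. exp (?L z)" "\<lambda>z. 1 - lam z"])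
    show "exp (?L u) = 1 - lam u" if "u \<in> S" for u
      using S(3)[OF that] lam_neq_1[of u] by (simp add: nome_inv_eq_lam)
  qed (use S assms L(1) lam_holomorphic in \<open>auto intro!: holomorphic_intros\<close>)
  then show ?thesis by (simp add: phi_def)
qed

lemma exp_2pi_i_eq_1_iff: "exp (2 * of_real pi * \<i> * w) = 1 \<longleftrightarrow> w \<in> \<int>"
proof
  assume "exp (2 * of_real pi * \<i> * w) = 1"
  then obtain n :: int where n: "Re (2 * of_real pi * \<i> * w) = 0" "Im (2 * of_real pi * \<i> * w) = of_int (2 * n) * pi"
    unfolding exp_eq_1 by blast
  then have "w = of_int n" by (simp add: complex_eq_iff)
  then show "w \<in> \<int>" by simp
next
  assume "w \<in> \<int>"
  then obtain n where "w = of_int n" by (elim Ints_cases)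
  then show "exp (2 * of_real pi * \<i> * w) = 1"
    unfolding exp_eq_1 by (intro conjI exI[of _ n]) auto
qed

text \<open>The origin is the only point of the disc over an integer. So removing it leaves exactly
  the part over the non-integers, and lifts of admissible curves never return to it unless they are
  constant.\<close>

lemma phi_in_Ints_iff: "norm z < 1 \<Longrightarrow> phi z \<in> \<int> \<longleftrightarrow> z = 0"
  using exp_phi[of z] exp_2pi_i_eq_1_iff[of "phi z"] lam_eq_0_iff[of z] by auto

lemma deriv_phi_nonzero:
  assumes "norm z < 1"
  shows "deriv phi z \<noteq> 0"
proof
  assume "deriv phi z = 0"
  then have "(phi has_field_derivative 0) (at z)"
    using holomorphic_derivI[OF phi_holomorphic, of z] assms by simp
  from DERIV_chain2[OF DERIV_exp DERIV_cmult[OF this, of "2 * of_real pi * \<i>"]]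
  have "((\<lambda>z. exp (2 * of_real pi * \<i> * phi z)) has_field_derivative 0) (at z)" by simp
  then have "((\<lambda>z. 1 - lam z) has_field_derivative 0) (at z)"
    by (rule has_field_derivative_transform_within_open[of _ _ _ "ball 0 1"]) (use assms exp_phi in auto)
  moreover have "((\<lambda>z. 1 - lam z) has_field_derivative 0 - deriv lam z) (at z)"
    using assms by (intro derivative_intros holomorphic_derivI[OF lam_holomorphic]) auto
  ultimately have "deriv lam z = 0" using DERIV_unique by fastforce
  with deriv_lam_nonzero[OF assms] show False by simp
qed

lemma phi_locally_injective:
  assumes "norm z < 1"
  obtains s where "0 < s" "ball z s \<subseteq> ball 0 1" "inj_on phi (ball z s)"
  by (rule has_complex_derivative_locally_injective[OF phi_holomorphic _ open_ball deriv_phi_nonzero[OF assms]])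
     (use assms that in auto)

definition punctured_disc :: "complex set" where
  "punctured_disc = ball 0 1 - {0}"

text \<open>\<open>1 - exp (2 \<pi> \<i> w)\<close> lifts through \<open>lam\<close>; the lift is a section of \<open>phi\<close> because it is one up
  to a continuous integer.\<close>

lemma phi_section:
  assumes p: "p \<in> punctured_disc" and B: "ball (phi p) r \<inter> \<int> = {}" and r: "0 < r'" "r' < r"
  obtains g where "g holomorphic_on ball (phi p) r'" "g (phi p) = p"
    "\<And>w. w \<in> ball (phi p) r' \<Longrightarrow> g w \<in> punctured_disc \<and> phi (g w) = w"
proof -
  let ?E = "\<lambda>w. 1 - exp (2 * of_real pi * \<i> * w)"
  have p1: "norm p < 1" using p by (simp add: punctured_disc_def)
  obtain g where g: "g holomorphic_on ball (phi p) r'" "g (phi p) = p"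
      "\<And>w. w \<in> ball (phi p) r' \<Longrightarrow> norm (g w) < 1 \<and> lam (g w) = ?E w"
  proof (rule lam_lift[of ?E "phi p" r p r'])
    show "?E holomorphic_on ball (phi p) r" by (intro holomorphic_intros)
    show "?E w \<noteq> 0 \<and> ?E w \<noteq> 1" if "w \<in> ball (phi p) r" for w
    proof -
      have "w \<notin> \<int>" using that B by blast
      with exp_2pi_i_eq_1_iff[of w] have "exp (2 * of_real pi * \<i> * w) \<noteq> 1" by simp
      then show ?thesis by (simp del: exp_eq_1)
    qed
  qed (use p1 r exp_phi[OF p1] in auto)
  have int: "phi (g w) - w \<in> \<int>" if "w \<in> ball (phi p) r'" for w
  proof -
    have "exp (2 * of_real pi * \<i> * phi (g w)) = exp (2 * of_real pi * \<i> * w)"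
      using exp_phi[of "g w"] g(3)[OF that] by simp
    then show ?thesis
      by (simp add: exp_2pi_i_eq_1_iff[symmetric] right_diff_distrib exp_diff)
  qed
  have cont: "continuous_on (ball (phi p) r') (\<lambda>w. phi (g w) - w)"
    by (intro continuous_intros continuous_on_compose2[OF holomorphic_on_imp_continuous_on[OF phi_holomorphic]]
          holomorphic_on_imp_continuous_on[OF g(1)]) (use g(3) in auto)
  have "(\<lambda>w. phi (g w) - w) constant_on ball (phi p) r'"
  proof (rule continuous_discrete_range_constant[OF _ cont])
    fix x assume x: "x \<in> ball (phi p) r'"
    show "\<exists>e>0. \<forall>y. y \<in> ball (phi p) r' \<and> phi (g y) - y \<noteq> phi (g x) - x \<longrightarrow> e \<le> norm (phi (g y) - y - (phi (g x) - x))"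
    proof (intro exI[of _ 1] conjI allI impI)
      fix y assume y: "y \<in> ball (phi p) r' \<and> phi (g y) - y \<noteq> phi (g x) - x"
      then have "phi (g y) - y - (phi (g x) - x) \<in> \<int>" using Ints_diff[OF int[of y] int[OF x]] by blast
      then obtain n where n: "phi (g y) - y - (phi (g x) - x) = of_int n" by (elim Ints_cases)
      with y have "n \<noteq> 0" by auto
      then show "1 \<le> norm (phi (g y) - y - (phi (g x) - x))" unfolding n norm_of_int by linarith
    qed simp
  qed simp
  then obtain c where c: "\<And>w. w \<in> ball (phi p) r' \<Longrightarrow> phi (g w) - w = c"
    unfolding constant_on_def by blast
  have sec: "phi (g w) = w" if "w \<in> ball (phi p) r'" for w
    using c[OF that] c[of "phi p"] r g(2) by simp
  have "g w \<in> punctured_disc" if "w \<in> ball (phi p) r'" for w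
  proof -
    have "w \<in> ball (phi p) r" using that r by simp
    then have "w \<notin> \<int>" using B by blast
    then have "g w \<noteq> 0" using sec[OF that] by auto
    then show ?thesis using g(3)[OF that] by (simp add: punctured_disc_def)
  qed
  with g(1,2) sec that show ?thesis by blast
qed

definition phi_section_on :: "(complex \<Rightarrow> complex) \<Rightarrow> complex set \<Rightarrow> bool" where
  "phi_section_on g T \<longleftrightarrow> g holomorphic_on T \<and> (\<forall>w\<in>T. g w \<in> punctured_disc \<and> phi (g w) = w)"

text \<open>One ball must serve all \<open>p\<close> over it. In an integer-free ball of radius
  \<open>R\<close> around \<open>x\<close>, a point \<open>phi p\<close> within \<open>R/4\<close>
  of \<open>x\<close> has room \<open>3*R/4\<close>, and the section on its ball of radius
  \<open>R/2\<close> covers \<open>ball x (R/4)\<close>.\<close>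

lemma phi_evenly_covered:
  assumes x: "x \<notin> \<int>"
  obtains \<rho> where "0 < \<rho>" "ball x \<rho> \<inter> \<int> = {}"
    "\<forall>p\<in>punctured_disc. phi p \<in> ball x \<rho> \<longrightarrow> (\<exists>g. phi_section_on g (ball x \<rho>) \<and> g (phi p) = p)"
proof -
  have "open (- \<int> :: complex set)" by (simp add: open_Compl)
  with x obtain R where R: "R > 0" "ball x R \<subseteq> - \<int>" unfolding open_contains_ball by blast
  show ?thesis
  proof (rule that[of "R/4"])
    have "ball x (R/4) \<subseteq> ball x R" using R(1) by (intro subset_ball) simp
    then show "ball x (R/4) \<inter> \<int> = {}" using R(2) by blast
  next
    show "\<forall>p\<in>punctured_disc. phi p \<in> ball x (R/4) \<longrightarrow> (\<exists>g. phi_section_on g (ball x (R/4)) \<and> g (phi p) = p)"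
    proof (intro ballI impI)
      fix p assume p: "p \<in> punctured_disc" "phi p \<in> ball x (R/4)"
      have "ball (phi p) (3*R/4) \<subseteq> ball x R" using p(2) R(1) by (simp add: ball_subset_ball_iff dist_commute)
      then have "ball (phi p) (3*R/4) \<inter> \<int> = {}" using R(2) by blast
      then obtain g where g: "g holomorphic_on ball (phi p) (R/2)" "g (phi p) = p"
        "\<And>w. w \<in> ball (phi p) (R/2) \<Longrightarrow> g w \<in> punctured_disc \<and> phi (g w) = w"
        using phi_section[OF p(1), of "3*R/4" "R/2"] R(1) by auto
      have "ball x (R/4) \<subseteq> ball (phi p) (R/2)" using p(2) R(1) by (simp add: ball_subset_ball_iff dist_commute)
      with g show "\<exists>g. phi_section_on g (ball x (R/4)) \<and> g (phi p) = p"
        by (intro exI[of _ g]) (auto simp: phi_section_on_def intro: holomorphic_on_subset)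
    qed
  qed (use R in simp)
qed

text \<open>Local injectivity of \<open>phi\<close> makes the sections agree near \<open>a\<close>;
  the identity theorem extends this to the ball.\<close>

lemma phi_section_unique:
  assumes g: "g1 holomorphic_on ball x \<rho>" "g2 holomorphic_on ball x \<rho>"
    and s1: "\<And>w. w \<in> ball x \<rho> \<Longrightarrow> norm (g1 w) < 1 \<and> phi (g1 w) = w"
    and s2: "\<And>w. w \<in> ball x \<rho> \<Longrightarrow> norm (g2 w) < 1 \<and> phi (g2 w) = w"
    and a: "a \<in> ball x \<rho>" "g1 a = g2 a" and w: "w \<in> ball x \<rho>"
  shows "g1 w = g2 w"
proof -
  obtain s where s: "0 < s" "inj_on phi (ball (g1 a) s)"
    using phi_locally_injective[of "g1 a"] s1[OF a(1)] by metis
  define S where "S = ball x \<rho> \<inter> g1 -` ball (g1 a) s \<inter> (ball x \<rho> \<inter> g2 -` ball (g1 a) s)"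
  have "open S"
    unfolding S_def using g
    by (intro open_Int continuous_open_preimage holomorphic_on_imp_continuous_on) auto
  moreover have "a \<in> S" using a s by (auto simp: S_def)
  moreover have "g1 u = g2 u" if "u \<in> S" for u
  proof (rule inj_onD[OF s(2)])
    have "u \<in> ball x \<rho>" using that by (simp add: S_def)
    then show "phi (g1 u) = phi (g2 u)" using s1 s2 by simp
  qed (use that in \<open>simp_all add: S_def\<close>)
  moreover have "S \<subseteq> ball x \<rho>" by (auto simp: S_def)
  ultimately show ?thesis
    using analytic_continuation_open[of S "ball x \<rho>" g1 g2 w] g w by blast
qed

text \<open>Local sections show that the image and its complement among the non-integers are both
  open, and the plane without a countable set is connected.\<close>

lemma phi_image: "phi ` punctured_disc = - \<int>"
proof -
  have sub: "phi ` punctured_disc \<subseteq> - \<int>"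
    using phi_in_Ints_iff by (auto simp: punctured_disc_def)
  have mem: "ball x \<rho> \<subseteq> phi ` punctured_disc"
    if "phi_section_on g (ball x \<rho>)" for x \<rho> g
  proof
    fix w assume "w \<in> ball x \<rho>"
    with that have "g w \<in> punctured_disc" "w = phi (g w)" by (auto simp: phi_section_on_def)
    then show "w \<in> phi ` punctured_disc" by (rule image_eqI[rotated])
  qed
  have opn: "open (phi ` punctured_disc)"
    unfolding open_contains_ball
  proof
    fix y assume "y \<in> phi ` punctured_disc"
    then obtain p where p: "p \<in> punctured_disc" "y = phi p" by blast
    then have "y \<notin> \<int>" using sub by blast
    obtain \<rho> where \<rho>: "0 < \<rho>" "ball y \<rho> \<inter> \<int> = {}"
      "\<forall>p\<in>punctured_disc. phi p \<in> ball y \<rho> \<longrightarrow> (\<exists>g. phi_section_on g (ball y \<rho>) \<and> g (phi p) = p)"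
      by (rule phi_evenly_covered[OF \<open>y \<notin> \<int>\<close>])
    have "phi p \<in> ball y \<rho>" using p(2) \<rho>(1) by simp
    then obtain g where "phi_section_on g (ball y \<rho>)" using \<rho>(3) p(1) by blast
    then have "ball y \<rho> \<subseteq> phi ` punctured_disc" by (rule mem)
    then show "\<exists>e>0. ball y e \<subseteq> phi ` punctured_disc" using \<rho>(1) by blast
  qed
  moreover have "open (- \<int> - phi ` punctured_disc)"
    unfolding open_contains_ball
  proof
    fix y assume y: "y \<in> - \<int> - phi ` punctured_disc"
    then have "y \<notin> \<int>" by simp
    obtain \<rho> where \<rho>: "0 < \<rho>" "ball y \<rho> \<inter> \<int> = {}"
      "\<forall>p\<in>punctured_disc. phi p \<in> ball y \<rho> \<longrightarrow> (\<exists>g. phi_section_on g (ball y \<rho>) \<and> g (phi p) = p)"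
      by (rule phi_evenly_covered[OF \<open>y \<notin> \<int>\<close>])
    have "phi p \<notin> ball y \<rho>" if p: "p \<in> punctured_disc" for p
    proof
      assume "phi p \<in> ball y \<rho>"
      then obtain g where "phi_section_on g (ball y \<rho>)" using \<rho>(3) p by blast
      then have "ball y \<rho> \<subseteq> phi ` punctured_disc" by (rule mem)
      moreover have "y \<in> ball y \<rho>" using \<rho>(1) by simp
      ultimately show False using y by blast
    qed
    then have "ball y \<rho> \<subseteq> - \<int> - phi ` punctured_disc" using \<rho>(2) by blast
    then show "\<exists>e>0. ball y e \<subseteq> - \<int> - phi ` punctured_disc" using \<rho>(1) by blast
  qed
  moreover have "countable (\<int> :: complex set)" by (simp add: Ints_def)
  then have "connected (- \<int> :: complex set)"
    by (intro path_connected_imp_connected path_connected_complement_countable) auto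
  moreover have "1/2 \<in> punctured_disc" by (simp add: punctured_disc_def)
  then have "phi ` punctured_disc \<noteq> {}" by blast
  ultimately have "- \<int> - phi ` punctured_disc = {}"
    using sub connectedD[of "- \<int>" "phi ` punctured_disc" "- \<int> - phi ` punctured_disc"] by blast
  with sub show ?thesis by blast
qed

text \<open>The sheets over \<open>T\<close> are the images of the sections on \<open>T\<close>.
  Sheets with a common point come from sections that agree at its projection, and these coincide by
  \<open>phi_section_unique\<close>.\<close>

lemma phi_covering: "covering_space punctured_disc phi (- \<int>)"
  unfolding covering_space_def
proof (intro conjI ballI phi_image)
  have sub: "punctured_disc \<subseteq> ball 0 1" by (auto simp: punctured_disc_def)
  show cont: "continuous_on punctured_disc phi"
    using holomorphic_on_imp_continuous_on[OF phi_holomorphic] sub by (rule continuous_on_subset)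
  fix x :: complex assume "x \<in> - \<int>"
  then have "x \<notin> \<int>" by simp
  obtain \<rho> where \<rho>: "0 < \<rho>" "ball x \<rho> \<inter> \<int> = {}"
      "\<forall>p\<in>punctured_disc. phi p \<in> ball x \<rho> \<longrightarrow> (\<exists>g. phi_section_on g (ball x \<rho>) \<and> g (phi p) = p)"
    by (rule phi_evenly_covered[OF \<open>x \<notin> \<int>\<close>])
  define T where "T = ball x \<rho>"
  define sections where "sections = {g. phi_section_on g T}"
  define v where "v = (\<lambda>g. g ` T) ` sections"
  have c1: "\<Union>v = punctured_disc \<inter> phi -` T"
  proof (intro equalityI subsetI)
    fix p assume "p \<in> punctured_disc \<inter> phi -` T"
    with \<rho>(3) obtain g where g: "g \<in> sections" "g (phi p) = p" "phi p \<in> T"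
      unfolding sections_def T_def by auto
    then have "p \<in> g ` T" by (metis image_eqI)
    with g(1) show "p \<in> \<Union>v" unfolding v_def by blast
  qed (auto simp: v_def sections_def phi_section_on_def)
  have c2: "openin (top_of_set punctured_disc) u" if "u \<in> v" for u
  proof -
    obtain g where g: "g \<in> sections" "u = g ` T" using \<open>u \<in> v\<close> by (auto simp: v_def)
    have "inj_on g T" using g(1) by (intro inj_on_inverseI[of _ phi]) (auto simp: sections_def phi_section_on_def)
    then have "open u" unfolding g(2)
      using g(1) by (intro open_mapping_thm3) (auto simp: sections_def phi_section_on_def T_def)
    moreover have "u \<subseteq> punctured_disc" using g by (auto simp: sections_def phi_section_on_def)
    ultimately show ?thesis by (simp add: open_subset)
  qed
  have c3: "pairwise disjnt v"
  proof (rule pairwiseI)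
    fix u1 u2 assume u: "u1 \<in> v" "u2 \<in> v" "u1 \<noteq> u2"
    then obtain g1 g2 where g: "g1 \<in> sections" "g2 \<in> sections" "u1 = g1 ` T" "u2 = g2 ` T"
      by (auto simp: v_def)
    show "disjnt u1 u2"
    proof (rule ccontr)
      assume "\<not> disjnt u1 u2"
      then obtain a b where ab: "a \<in> T" "b \<in> T" "g1 a = g2 b" by (auto simp: disjnt_def g)
      have "phi (g1 a) = a" "phi (g2 b) = b"
        using g(1,2) ab(1,2) by (simp_all add: sections_def phi_section_on_def)
      then have "a = b" using ab(3) by simp
      have s: "norm (h w) < 1 \<and> phi (h w) = w" if "h \<in> sections" "w \<in> ball x \<rho>" for h w
      proof -
        have "h w \<in> punctured_disc" "phi (h w) = w"
          using that by (simp_all add: sections_def phi_section_on_def T_def)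
        then show ?thesis by (simp add: punctured_disc_def)
      qed
      have h: "g1 holomorphic_on ball x \<rho>" "g2 holomorphic_on ball x \<rho>"
        using g(1,2) by (simp_all add: sections_def phi_section_on_def T_def)
      have "g1 w = g2 w" if "w \<in> T" for w
        using phi_section_unique[OF h s[OF g(1)] s[OF g(2)], of a w] ab \<open>a = b\<close> that
        by (simp add: T_def)
      then have "u1 = u2" unfolding g by (intro image_cong) auto
      with u(3) show False by simp
    qed
  qed
  have c4: "\<exists>q. homeomorphism u T phi q" if "u \<in> v" for u
  proof -
    obtain g where g: "g \<in> sections" "u = g ` T" using \<open>u \<in> v\<close> by (auto simp: v_def)
    have "u \<subseteq> punctured_disc" "continuous_on T g" and gT: "\<And>w. w \<in> T \<Longrightarrow> phi (g w) = w"
      using g by (auto simp: sections_def phi_section_on_def intro: holomorphic_on_imp_continuous_on)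
    then have "homeomorphism u T phi g"
      using continuous_on_subset[OF cont] g(2) by (intro homeomorphismI) (auto simp: gT)
    then show ?thesis by blast
  qed
  have c5: "x \<in> T" using \<rho>(1) by (simp add: T_def)
  have c6: "openin (top_of_set (- \<int>)) T" using \<rho>(2) by (auto simp: T_def intro!: open_subset)
  show "\<exists>T. x \<in> T \<and> openin (top_of_set (- \<int>)) T \<and> (\<exists>v. \<Union>v = punctured_disc \<inter> phi -` T \<and>
      (\<forall>u\<in>v. openin (top_of_set punctured_disc) u) \<and> pairwise disjnt v \<and> (\<forall>u\<in>v. \<exists>q. homeomorphism u T phi q))"
    by (intro exI[of _ T] exI[of _ v] conjI ballI c1 c2 c3 c4 c5 c6)
qed

section \<open>Lifting curves and homotopies\<close>

lemma Omega_curves_cong: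
  assumes "\<And>t. t \<in> {0..1} \<Longrightarrow> f t = g t"
  shows "f \<in> Omega_curves \<longleftrightarrow> g \<in> Omega_curves"
proof -
  have "path f \<longleftrightarrow> path g" unfolding path_def by (rule continuous_on_cong) (use assms in auto)
  moreover have "pathstart f = pathstart g" using assms[of 0] by (simp add: pathstart_def)
  ultimately show ?thesis using assms by (auto simp: Omega_curves_def)
qed

lemma Omega_homotopic_iff:
  "(\<gamma>, \<delta>) \<in> Omega_homotopic \<longleftrightarrow> \<gamma> \<in> Omega_curves \<and> \<delta> \<in> Omega_curves \<and>
    (\<exists>H :: real \<times> real \<Rightarrow> complex. continuous_on ({0..1} \<times> {0..1}) H \<and> (\<forall>t\<in>{0..1}. H (0, t) = \<gamma> t) \<and> (\<forall>t\<in>{0..1}. H (1, t) = \<delta> t) \<and>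
      (\<forall>s\<in>{0..1}. (\<lambda>t. H (s, t)) \<in> Omega_curves \<and> H (s, 1) = \<gamma> 1))"
proof -
  let ?P = "\<lambda>r. r \<in> Omega_curves \<and> pathfinish r = pathfinish \<gamma>"
  \<comment> \<open>The unfolding of \<open>homotopic_with\<close> requires a property that ignores
    the values of a curve outside the unit interval.\<close>
  have key: "?P h = ?P k" if "\<And>x. x \<in> topspace (top_of_set {0..1}) \<Longrightarrow> h x = k x" for h k :: "real \<Rightarrow> complex"
    using Omega_curves_cong[of h k] that by (auto simp: pathfinish_def)
  have hw: "homotopic_with_canon ?P {0..1} UNIV \<gamma> \<delta> \<longleftrightarrow>
    (\<exists>h :: real \<times> real \<Rightarrow> complex. continuous_map (prod_topology (top_of_set {0..1}) (top_of_set {0..1})) (top_of_set UNIV) h \<and>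
       (\<forall>x\<in>topspace (top_of_set {0..1}). h (0, x) = \<gamma> x) \<and>
       (\<forall>x\<in>topspace (top_of_set {0..1}). h (1, x) = \<delta> x) \<and> (\<forall>t\<in>{0..1}. ?P (\<lambda>x. h (t, x))))"
    by (rule homotopic_with, rule key, blast)
  show ?thesis
    unfolding Omega_homotopic_def mem_Collect_eq split_conv hw by (simp add: pathfinish_def)
qed

lemma Omega_homotopic_endpoint: "(\<gamma>, \<delta>) \<in> Omega_homotopic \<Longrightarrow> \<delta> 1 = \<gamma> 1"
proof -
  assume "(\<gamma>, \<delta>) \<in> Omega_homotopic"
  then obtain H :: "real \<times> real \<Rightarrow> complex" where H: "\<forall>t\<in>{0..1}. H (1, t) = \<delta> t" "\<forall>s\<in>{0..1}. (\<lambda>t. H (s, t)) \<in> Omega_curves \<and> H (s, 1) = \<gamma> 1"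
    unfolding Omega_homotopic_iff by blast
  have "1 \<in> {0..1::real}" by simp
  from bspec[OF H(1) this] bspec[OF H(2) this] show ?thesis by simp
qed

lemma Omega_homotopic_equal:
  assumes "\<gamma> \<in> Omega_curves" "\<And>t. t \<in> {0..1} \<Longrightarrow> \<gamma> t = \<delta> t"
  shows "(\<gamma>, \<delta>) \<in> Omega_homotopic"
proof -
  have "\<delta> \<in> Omega_curves" using assms(1) Omega_curves_cong[of \<gamma> \<delta>, OF assms(2)] by simp
  moreover have "continuous_on {0..1} \<gamma>" using assms(1) by (simp add: Omega_curves_def path_def)
  then have "continuous_on ({0..1} \<times> {0..1}) (\<lambda>x. \<gamma> (snd x))"
    by (rule continuous_on_compose2[OF _ continuous_on_snd[OF continuous_on_id]]) auto
  moreover have "(\<lambda>t. \<gamma> t) \<in> Omega_curves" using assms(1) by simp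
  ultimately show ?thesis
    unfolding Omega_homotopic_iff using assms
    by (intro conjI exI[of _ "\<lambda>x. \<gamma> (snd x)"] ballI) simp_all
qed

lemma Omega_homotopic_equiv: "equiv Omega_curves Omega_homotopic"
proof (rule equivI)
  show "Omega_homotopic \<subseteq> Omega_curves \<times> Omega_curves" by (auto simp: Omega_homotopic_def)
  show "refl_on Omega_curves Omega_homotopic"
    by (rule refl_onI) (rule Omega_homotopic_equal, simp_all)
  show "sym Omega_homotopic"
  proof (rule symI)
    fix \<gamma> \<delta> assume r: "(\<gamma>, \<delta>) \<in> Omega_homotopic"
    then have "pathfinish \<gamma> = pathfinish \<delta>" using Omega_homotopic_endpoint[of \<gamma> \<delta>] by (simp add: pathfinish_def)
    with r show "(\<delta>, \<gamma>) \<in> Omega_homotopic"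
      by (simp add: Omega_homotopic_def homotopic_with_sym[of _ _ _ \<gamma> \<delta>])
  qed
  show "trans Omega_homotopic"
  proof (rule transI)
    fix \<gamma> \<delta> \<eta> assume r: "(\<gamma>, \<delta>) \<in> Omega_homotopic" "(\<delta>, \<eta>) \<in> Omega_homotopic"
    then have "pathfinish \<gamma> = pathfinish \<delta>" using Omega_homotopic_endpoint[of \<gamma> \<delta>] by (simp add: pathfinish_def)
    with r show "(\<gamma>, \<eta>) \<in> Omega_homotopic"
      unfolding Omega_homotopic_def using homotopic_with_trans by auto
  qed
qed

definition disc_lift :: "(real \<Rightarrow> complex) \<Rightarrow> (real \<Rightarrow> complex) \<Rightarrow> bool" where
  "disc_lift \<alpha> \<gamma> \<longleftrightarrow> path \<alpha> \<and> path_image \<alpha> \<subseteq> ball 0 1 \<and> \<alpha> 0 = 0 \<and> (\<forall>t\<in>{0..1}. phi (\<alpha> t) = \<gamma> t)"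

lemma disc_lift_norm: "disc_lift \<alpha> \<gamma> \<Longrightarrow> t \<in> {0..1} \<Longrightarrow> norm (\<alpha> t) < 1"
  by (force simp: disc_lift_def path_image_def)

lemma phi_continuous: "continuous_on (ball 0 1) phi"
  by (rule holomorphic_on_imp_continuous_on[OF phi_holomorphic])

lemma Omega_curve_cases:
  assumes "\<gamma> \<in> Omega_curves"
  obtains (nonint) "\<And>t. 0 < t \<Longrightarrow> t \<le> 1 \<Longrightarrow> \<gamma> t \<notin> \<int>" "\<gamma> 1 \<notin> \<int>" | (zero) "\<And>t. t \<in> {0..1} \<Longrightarrow> \<gamma> t = 0" "\<gamma> 1 = 0"
  using assms by (force simp: Omega_curves_def)

lemma Omega_curve_nonint:
  assumes "\<gamma> \<in> Omega_curves" "\<gamma> 1 \<notin> \<int>" "0 < t" "t \<le> 1"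
  shows "\<gamma> t \<notin> \<int>"
  using assms(1) by (cases rule: Omega_curve_cases) (use assms in auto)

lemma disc_lift_image:
  assumes "path \<alpha>" "path_image \<alpha> \<subseteq> ball 0 1" "\<alpha> 0 = 0"
    and "(\<forall>t\<in>{0<..1}. \<alpha> t \<noteq> 0) \<or> (\<forall>t\<in>{0..1}. \<alpha> t = 0)"
  shows "phi \<circ> \<alpha> \<in> Omega_curves" "disc_lift \<alpha> (phi \<circ> \<alpha>)"
proof -
  have "path (phi \<circ> \<alpha>)"
    using assms(1,2) by (intro path_continuous_image) (auto intro: continuous_on_subset[OF phi_continuous])
  moreover have "norm (\<alpha> t) < 1" if "t \<in> {0..1}" for t
    using assms(2) that by (force simp: path_image_def)
  ultimately show "phi \<circ> \<alpha> \<in> Omega_curves"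
    using assms(3,4) phi_in_Ints_iff by (auto simp: Omega_curves_def pathstart_def)
  show "disc_lift \<alpha> (phi \<circ> \<alpha>)" using assms by (simp add: disc_lift_def)
qed

lemma disc_lift_linepath:
  assumes "norm z < 1"
  shows "phi \<circ> linepath 0 z \<in> Omega_curves" "disc_lift (linepath 0 z) (phi \<circ> linepath 0 z)"
proof -
  have "path_image (linepath 0 z) \<subseteq> ball 0 1"
    using assms by (simp add: closed_segment_subset)
  moreover have "(\<forall>t\<in>{0<..1}. linepath 0 z t \<noteq> 0) \<or> (\<forall>t\<in>{0..1}. linepath 0 z t = 0)"
    by (auto simp: linepath_def)
  ultimately show "phi \<circ> linepath 0 z \<in> Omega_curves" "disc_lift (linepath 0 z) (phi \<circ> linepath 0 z)"
    using disc_lift_image[OF path_linepath, of 0 z] by (simp_all add: linepath_0')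
qed

text \<open>The section exists at the origin as well, over which the covering says nothing. For
  \<open>z \<noteq> 0\<close> the disc is shrunk to radius at most \<open>norm z\<close>, so that
  curves pushed through the section avoid the origin.\<close>

lemma phi_local_section:
  assumes z: "norm z < 1"
  obtains \<epsilon> h where "0 < \<epsilon>" "h holomorphic_on ball (phi z) \<epsilon>" "h (phi z) = z"
    "\<forall>w\<in>ball (phi z) \<epsilon>. norm (h w) < 1 \<and> phi (h w) = w"
    "z \<noteq> 0 \<longrightarrow> (\<forall>w\<in>ball (phi z) \<epsilon>. h w \<noteq> 0)"
proof -
  obtain s0 where s0: "0 < s0" "ball z s0 \<subseteq> ball 0 1" "inj_on phi (ball z s0)"
    by (rule phi_locally_injective[OF z])
  define s where "s = (if z = 0 then s0 else min s0 (norm z))"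
  have s: "0 < s" "ball z s \<subseteq> ball z s0" "z \<noteq> 0 \<Longrightarrow> 0 \<notin> ball z s"
    using s0(1) by (auto simp: s_def dist_norm)
  then have inj: "inj_on phi (ball z s)" and hol: "phi holomorphic_on ball z s"
    using s0 by (auto intro: inj_on_subset holomorphic_on_subset[OF phi_holomorphic])
  obtain h where h: "h holomorphic_on phi ` ball z s" "\<And>u. u \<in> ball z s \<Longrightarrow> h (phi u) = u"
    by (rule holomorphic_has_inverse[OF hol open_ball inj]) (rule that, assumption+)
  have "open (phi ` ball z s)" by (rule open_mapping_thm3[OF hol open_ball inj])
  moreover have "phi z \<in> phi ` ball z s" using s(1) by simp
  ultimately obtain \<epsilon> where \<epsilon>: "0 < \<epsilon>" "ball (phi z) \<epsilon> \<subseteq> phi ` ball z s"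
    unfolding open_contains_ball by blast
  have im: "h w \<in> ball z s \<and> phi (h w) = w" if "w \<in> ball (phi z) \<epsilon>" for w
  proof -
    from that \<epsilon>(2) obtain u where "u \<in> ball z s" "w = phi u" by blast
    then show ?thesis using h(2) by simp
  qed
  show ?thesis
  proof (rule that[OF \<epsilon>(1)])
    show "h holomorphic_on ball (phi z) \<epsilon>" by (rule holomorphic_on_subset[OF h(1) \<epsilon>(2)])
    show "h (phi z) = z" using h(2) s(1) by simp
    show "\<forall>w\<in>ball (phi z) \<epsilon>. norm (h w) < 1 \<and> phi (h w) = w" using im s(2) s0(2) by force
    show "z \<noteq> 0 \<longrightarrow> (\<forall>w\<in>ball (phi z) \<epsilon>. h w \<noteq> 0)" using im s(3) by metis
  qed
qed

lemma phi_section_open: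
  assumes "h holomorphic_on T" "open T" "\<forall>w\<in>T. norm (h w) < 1 \<and> phi (h w) = w"
  shows "open (h ` T)"
proof (rule open_mapping_thm3[OF assms(1,2)])
  show "inj_on h T" using assms(3) by (intro inj_on_inverseI[of _ phi]) auto
qed

text \<open>The times at which the lift follows the section form a closed set, given by an equation,
  and an open one, the preimage of the open image of the section. This takes the place of uniqueness
  of lifts near the origin.\<close>

lemma lift_stays_in_section:
  fixes \<beta> :: "real \<Rightarrow> complex"
  assumes h: "h holomorphic_on ball c r" "\<forall>w\<in>ball c r. norm (h w) < 1 \<and> phi (h w) = w"
    and \<beta>: "connected I" "continuous_on I \<beta>" "\<And>t. t \<in> I \<Longrightarrow> norm (\<beta> t) < 1 \<and> phi (\<beta> t) \<in> ball c r"
    and t0: "t0 \<in> I" "\<beta> t0 = h (phi (\<beta> t0))" and t: "t \<in> I"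
  shows "\<beta> t = h (phi (\<beta> t))"
proof -
  let ?A = "{t \<in> I. \<beta> t = h (phi (\<beta> t))}"
  have hc: "continuous_on (ball c r) h" using h(1) by (rule holomorphic_on_imp_continuous_on)
  have c1: "continuous_on I (\<lambda>t. phi (\<beta> t))"
    by (rule continuous_on_compose2[OF phi_continuous \<beta>(2)]) (use \<beta>(3) in auto)
  have c2: "continuous_on I (\<lambda>t. h (phi (\<beta> t)))"
    by (rule continuous_on_compose2[OF hc c1]) (use \<beta>(3) in auto)
  have "closedin (top_of_set I) ?A"
  proof -
    have "continuous_on I (\<lambda>t. \<beta> t - h (phi (\<beta> t)))" by (intro continuous_intros \<beta>(2) c2)
    from continuous_closedin_preimage_constant[OF this, of 0] show ?thesis by simp
  qed
  moreover have "?A = I \<inter> \<beta> -` (h ` ball c r)"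
    using \<beta>(3) h(2) by auto
  then have "openin (top_of_set I) ?A"
    using continuous_openin_preimage_gen[OF \<beta>(2) phi_section_open[OF h(1) open_ball h(2)]] by simp
  ultimately have "?A = {} \<or> ?A = I" using \<beta>(1) unfolding connected_clopen by blast
  then show ?thesis using t0 t by blast
qed

text \<open>A nonconstant curve starts at the integer 0, which the covering misses. A short initial
  piece is lifted by the section of \<open>phi\<close> at 0, the rest by path lifting from the point
  reached.\<close>

lemma disc_lift_exists:
  assumes "\<gamma> \<in> Omega_curves"
  shows "\<exists>\<alpha>. disc_lift \<alpha> \<gamma>"
  using assms
proof (cases rule: Omega_curve_cases)
  case zero
  then have "disc_lift (\<lambda>_. 0) \<gamma>"
    by (auto simp: disc_lift_def path_def path_image_def)
  then show ?thesis by blast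
next
  case nonint
  have \<gamma>: "continuous_on {0..1} \<gamma>" "\<gamma> 0 = 0"
    using assms by (auto simp: Omega_curves_def path_def pathstart_def)
  obtain \<epsilon> h where h: "0 < \<epsilon>" "h holomorphic_on ball 0 \<epsilon>" "h 0 = 0"
    "\<forall>w\<in>ball 0 \<epsilon>. norm (h w) < 1 \<and> phi (h w) = w"
    using phi_local_section[of 0] by auto
  obtain d where d: "d > 0" "\<forall>t\<in>{0..1}. dist t 0 < d \<longrightarrow> dist (\<gamma> t) (\<gamma> 0) < \<epsilon>"
    using \<gamma>(1) h(1) unfolding continuous_on_iff by (metis atLeastAtMost_iff order_refl zero_le_one)
  define \<delta> where "\<delta> = min (d/2) (1/2)"
  have \<delta>: "0 < \<delta>" "\<delta> < 1" "\<delta> < d" using d(1) by (auto simp: \<delta>_def)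
  have small: "\<gamma> t \<in> ball 0 \<epsilon>" if "0 \<le> t" "t \<le> \<delta>" for t
    using d(2) \<delta> \<gamma>(2) that by (auto simp: dist_real_def)
  have "h (\<gamma> \<delta>) \<in> punctured_disc"
  proof -
    have "norm (h (\<gamma> \<delta>)) < 1" "phi (h (\<gamma> \<delta>)) = \<gamma> \<delta>" using h(4) small[of \<delta>] \<delta> by auto
    moreover have "\<gamma> \<delta> \<notin> \<int>" using nonint(1) \<delta> by simp
    ultimately show ?thesis by (auto simp: punctured_disc_def)
  qed
  moreover have "path (subpath \<delta> 1 \<gamma>)"
    using assms \<delta> by (intro path_subpath) (auto simp: Omega_curves_def)
  moreover have "path_image (subpath \<delta> 1 \<gamma>) \<subseteq> - \<int>"
    using nonint(1) \<delta> by (auto simp: path_image_subpath)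
  moreover have "pathstart (subpath \<delta> 1 \<gamma>) = phi (h (\<gamma> \<delta>))"
    using h(4) small[of \<delta>] \<delta> by (auto simp: pathstart_subpath)
  ultimately obtain k where k: "path k" "path_image k \<subseteq> punctured_disc" "pathstart k = h (\<gamma> \<delta>)"
    "\<And>t. t \<in> {0..1} \<Longrightarrow> phi (k t) = subpath \<delta> 1 \<gamma> t"
    by (rule covering_space_lift_path_strong[OF phi_covering]) (rule that, simp_all)
  define \<alpha> where "\<alpha> t = (if t \<le> \<delta> then h (\<gamma> t) else k ((t - \<delta>) / (1 - \<delta>)))" for t
  have u: "(t - \<delta>) / (1 - \<delta>) \<in> {0..1}" if "t \<in> {0..1}" "\<delta> \<le> t" for t
    using that \<delta> by (auto simp: divide_simps)
  have "continuous_on {0..1} \<alpha>"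
    unfolding \<alpha>_def
  proof (rule continuous_on_cases_1)
    have "continuous_on {t \<in> {0..1}. t \<le> \<delta>} \<gamma>" by (rule continuous_on_subset[OF \<gamma>(1)]) auto
    then show "continuous_on {t \<in> {0..1}. t \<le> \<delta>} (\<lambda>t. h (\<gamma> t))"
      by (rule continuous_on_compose2[OF holomorphic_on_imp_continuous_on[OF h(2)]]) (use small in auto)
    have "continuous_on {0..1} k" using k(1) by (simp add: path_def)
    moreover have "continuous_on {t \<in> {0..1}. \<delta> \<le> t} (\<lambda>t. (t - \<delta>) / (1 - \<delta>))"
      using \<delta> by (intro continuous_intros) auto
    ultimately show "continuous_on {t \<in> {0..1}. \<delta> \<le> t} (\<lambda>t. k ((t - \<delta>) / (1 - \<delta>)))"
      by (rule continuous_on_compose2) (use u in blast)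
    show "h (\<gamma> \<delta>) = k ((\<delta> - \<delta>) / (1 - \<delta>))" using k(3) by (simp add: pathstart_def)
  qed
  moreover have val: "norm (\<alpha> t) < 1 \<and> phi (\<alpha> t) = \<gamma> t" if "t \<in> {0..1}" for t
  proof (cases "t \<le> \<delta>")
    case True
    then show ?thesis using h(4) small[of t] that by (simp add: \<alpha>_def)
  next
    case False
    then have v: "(t - \<delta>) / (1 - \<delta>) \<in> {0..1}" using u that by simp
    then have "k ((t - \<delta>) / (1 - \<delta>)) \<in> punctured_disc" using k(2) by (auto simp: path_image_def)
    moreover have "(1 - \<delta>) * ((t - \<delta>) / (1 - \<delta>)) + \<delta> = t" using \<delta> by simp
    then have "subpath \<delta> 1 \<gamma> ((t - \<delta>) / (1 - \<delta>)) = \<gamma> t" by (simp add: subpath_def)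
    ultimately show ?thesis using False k(4)[OF v] by (simp add: \<alpha>_def punctured_disc_def)
  qed
  moreover have "\<alpha> 0 = 0" using \<delta> \<gamma>(2) h(3) by (simp add: \<alpha>_def)
  ultimately have "disc_lift \<alpha> \<gamma>" by (auto simp: disc_lift_def path_def path_image_def)
  then show ?thesis by blast
qed

text \<open>A homotopy lifts through the local section at \<open>0\<close> for small times and through the covering
  afterwards.\<close>

lemma Omega_homotopic_lift_endpoint:
  assumes rel: "(\<gamma>, \<delta>) \<in> Omega_homotopic" and \<alpha>: "disc_lift \<alpha> \<gamma>" and \<beta>: "disc_lift \<beta> \<delta>"
  shows "\<alpha> 1 = \<beta> 1"
proof -
  obtain H :: "real \<times> real \<Rightarrow> complex" where H: "continuous_on ({0..1} \<times> {0..1}) H"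
    "\<forall>t\<in>{0..1}. H (0, t) = \<gamma> t" "\<forall>t\<in>{0..1}. H (1, t) = \<delta> t"
    "\<forall>s\<in>{0..1}. (\<lambda>t. H (s, t)) \<in> Omega_curves \<and> H (s, 1) = \<gamma> 1"
    using rel unfolding Omega_homotopic_iff by blast
  have ends: "phi (\<alpha> 1) = \<gamma> 1" "phi (\<beta> 1) = \<gamma> 1"
    using \<alpha> \<beta> Omega_homotopic_endpoint[OF rel] by (auto simp: disc_lift_def)
  note norms = disc_lift_norm[OF \<alpha>] disc_lift_norm[OF \<beta>]
  show ?thesis
  proof (cases "\<gamma> 1 \<in> \<int>")
    case True
    then have "phi (\<alpha> 1) \<in> \<int>" "phi (\<beta> 1) \<in> \<int>" using ends by simp_all
    then show ?thesis using norms[of 1] phi_in_Ints_iff[of "\<alpha> 1"] phi_in_Ints_iff[of "\<beta> 1"] by simp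
  next
    case False
    have nonint: "H (s, t) \<notin> \<int>" if "s \<in> {0..1}" "0 < t" "t \<le> 1" for s t
      using Omega_curve_nonint[of "\<lambda>t. H (s, t)" t] H(4) that False by auto
    have H0: "H (s, 0) = 0" if "s \<in> {0..1}" for s
      using H(4) that by (auto simp: Omega_curves_def pathstart_def)
    obtain \<epsilon> h where h: "0 < \<epsilon>" "h holomorphic_on ball 0 \<epsilon>" "h 0 = 0"
      "\<forall>w\<in>ball 0 \<epsilon>. norm (h w) < 1 \<and> phi (h w) = w"
      using phi_local_section[of 0] by auto
    have "uniformly_continuous_on ({0..1} \<times> {0..1}) H"
      by (rule compact_uniformly_continuous[OF H(1)]) (intro compact_Times compact_Icc)
    then obtain d where d: "d > 0" "\<forall>x\<in>{0..1} \<times> {0..1}. \<forall>x'\<in>{0..1} \<times> {0..1}. dist x' x < d \<longrightarrow> dist (H x') (H x) < \<epsilon>"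
      using h(1) unfolding uniformly_continuous_on_def by blast
    \<comment> \<open>Uniform continuity yields one time \<open>c\<close> that suits all stages
      \<open>s\<close> of the homotopy.\<close>
    define c where "c = min (d/2) (1/2)"
    have c: "0 < c" "c < 1" "c < d" using d(1) by (auto simp: c_def)
    have small: "H (s, t) \<in> ball 0 \<epsilon>" if "s \<in> {0..1}" "0 \<le> t" "t \<le> c" for s t
    proof -
      have "dist (s, t) (s, 0) < d" using that c by (simp add: dist_Pair_Pair dist_real_def)
      then have "dist (H (s, t)) (H (s, 0)) < \<epsilon>" using d(2) that c by auto
      then show ?thesis using H0 that by (simp add: dist_commute)
    qed
    \<comment> \<open>The lifting theorem takes the deformation parameter first, so time comes first
      here, rescaled from \<open>{c..1}\<close> to the unit interval; \<open>f\<close> is the lift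
      at time \<open>c\<close>.\<close>
    define K where "K = (\<lambda>x :: real \<times> real. H (snd x, c + (1 - c) * fst x))"
    define f where "f s = h (H (s, c))" for s
    have time: "0 < c + (1 - c) * u \<and> c + (1 - c) * u \<le> 1" if "u \<in> {0..1}" for u
    proof -
      have "0 \<le> (1 - c) * u" "(1 - c) * u \<le> 1 - c"
        using that c by (auto intro!: mult_left_le mult_nonneg_nonneg)
      then show ?thesis using c(1) by auto
    qed
    have "continuous_on ({0..1} \<times> {0..1}) K"
      unfolding K_def
      by (rule continuous_on_compose2[OF H(1)]) (use time in \<open>force intro!: continuous_intros\<close>)+
    moreover have "K \<in> {0..1} \<times> {0..1} \<rightarrow> - \<int>"
      unfolding K_def using nonint time by auto
    moreover have "K (0, s) = phi (f s)" if "s \<in> {0..1}" for s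
      using h(4) small[OF that, of c] c by (auto simp: K_def f_def)
    moreover have "continuous_on {0..1} f"
      unfolding f_def
    proof (rule continuous_on_compose2[OF holomorphic_on_imp_continuous_on[OF h(2)]])
      show "continuous_on {0..1} (\<lambda>s. H (s, c))"
        by (rule continuous_on_compose2[OF H(1)]) (use c in \<open>auto intro!: continuous_intros\<close>)
    qed (use small c in auto)
    moreover have "f \<in> {0..1} \<rightarrow> punctured_disc"
    proof
      fix s :: real assume s: "s \<in> {0..1}"
      have "norm (f s) < 1" "phi (f s) = H (s, c)" using h(4) small[OF s, of c] c by (auto simp: f_def)
      moreover have "H (s, c) \<notin> \<int>" using nonint[OF s] c by simp
      ultimately show "f s \<in> punctured_disc" by (auto simp: punctured_disc_def)
    qed
    ultimately obtain k where k: "continuous_on ({0..1} \<times> {0..1}) k" "k \<in> {0..1} \<times> {0..1} \<rightarrow> punctured_disc"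
      "\<And>s. s \<in> {0..1} \<Longrightarrow> k (0, s) = f s" "\<And>z. z \<in> {0..1} \<times> {0..1} \<Longrightarrow> K z = phi (k z)"
      by (rule covering_space_lift_homotopy[OF phi_covering]) (assumption | rule that)+
    \<comment> \<open>The ends of the lifted stages cover the constant \<open>\<gamma> 1\<close>, so
      by uniqueness of lifts they do not move.\<close>
    have const: "k (1, 1) = k (1, 0)"
    proof (rule covering_space_lift_unique[OF phi_covering, where T = "{0..1}" and a = 0 and f = "\<lambda>_. \<gamma> 1"
            and ?g1.0 = "\<lambda>s. k (1, s)" and ?g2.0 = "\<lambda>s. k (1, 0)"])
      show "continuous_on {0..1} (\<lambda>s. k (1, s))"
        by (rule continuous_on_compose2[OF k(1)]) (auto intro!: continuous_intros)
      show "\<gamma> 1 = phi (k (1, s))" if "s \<in> {0..1}" for s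
        using k(4)[of "(1, s)"] H(4) that by (simp add: K_def)
      then show "\<gamma> 1 = phi (k (1, 0))" by simp
    qed (use k(2) False in auto)
    \<comment> \<open>Any lift of stage \<open>s\<close> follows the section up to time
      \<open>c\<close>; from there it has the same start as \<open>k\<close>, hence the same
      end.\<close>
    have endpoint: "\<eta> 1 = k (1, s)" if s: "s \<in> {0..1}" and \<eta>: "disc_lift \<eta> (\<lambda>t. H (s, t))" for \<eta> s
    proof -
      have cont: "continuous_on {0..1} \<eta>" and \<eta>0: "\<eta> 0 = 0" and ph: "\<And>t. t \<in> {0..1} \<Longrightarrow> phi (\<eta> t) = H (s, t)"
        using \<eta> by (auto simp: disc_lift_def path_def)
      have "\<eta> c = h (phi (\<eta> c))"
      proof (rule lift_stays_in_section[OF h(2,4), where I = "{0..c}" and ?t0.0 = 0 and \<beta> = \<eta> and t = c])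
        show "continuous_on {0..c} \<eta>" using cont by (rule continuous_on_subset) (use c in auto)
        show "norm (\<eta> t) < 1 \<and> phi (\<eta> t) \<in> ball 0 \<epsilon>" if "t \<in> {0..c}" for t
          using disc_lift_norm[OF \<eta>, of t] ph[of t] small[OF s, of t] that c by simp
      qed (use c \<eta>0 h(3) in auto)
      then have start: "\<eta> c = k (0, s)" using ph[of c] k(3)[OF s] c by (simp add: f_def)
      have "\<eta> (c + (1 - c) * 1) = k (1, s)"
      proof (rule covering_space_lift_unique[OF phi_covering, where T = "{0..1}" and a = 0 and x = 1
            and f = "\<lambda>u. K (u, s)" and ?g1.0 = "\<lambda>u. \<eta> (c + (1 - c) * u)" and ?g2.0 = "\<lambda>u. k (u, s)"])
        show "continuous_on {0..1} (\<lambda>u. K (u, s))"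
          by (rule continuous_on_compose2[OF \<open>continuous_on ({0..1} \<times> {0..1}) K\<close>])
             (use s in \<open>auto intro!: continuous_intros\<close>)
        show "(\<lambda>u. K (u, s)) \<in> {0..1} \<rightarrow> - \<int>"
          unfolding K_def using nonint[OF s] time by auto
        show "continuous_on {0..1} (\<lambda>u. \<eta> (c + (1 - c) * u))"
          by (rule continuous_on_compose2[OF cont]) (use time in \<open>force intro!: continuous_intros\<close>)+
        show lift: "K (u, s) = phi (\<eta> (c + (1 - c) * u))" if "u \<in> {0..1}" for u
          using ph[of "c + (1 - c) * u"] time[OF that] by (simp add: K_def)
        show "(\<lambda>u. \<eta> (c + (1 - c) * u)) \<in> {0..1} \<rightarrow> punctured_disc"
        proof
          fix u :: real assume u: "u \<in> {0..1}"
          have "phi (\<eta> (c + (1 - c) * u)) \<notin> \<int>"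
            using ph[of "c + (1 - c) * u"] nonint[OF s, of "c + (1 - c) * u"] time[OF u] by simp
          moreover have "norm (\<eta> (c + (1 - c) * u)) < 1"
            using disc_lift_norm[OF \<eta>] time[OF u] by simp
          ultimately show "\<eta> (c + (1 - c) * u) \<in> punctured_disc" by (auto simp: punctured_disc_def)
        qed
        show "continuous_on {0..1} (\<lambda>u. k (u, s))"
          by (rule continuous_on_compose2[OF k(1)]) (use s in \<open>auto intro!: continuous_intros\<close>)
      qed (use k(2,4) s start in auto)
      then show ?thesis by simp
    qed
    have "disc_lift \<alpha> (\<lambda>t. H (0, t))" "disc_lift \<beta> (\<lambda>t. H (1, t))"
      using \<alpha> \<beta> H(2,3) by (auto simp: disc_lift_def)
    then have "\<alpha> 1 = k (1, 0)" "\<beta> 1 = k (1, 1)" using endpoint by auto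
    with const show ?thesis by simp
  qed
qed

text \<open>Geometric interpolation between \<open>\<alpha> t\<close> and \<open>t * \<alpha> 1\<close> unwinds a curve at its start.\<close>

lemma disc_lift_homotopic_linepath:
  assumes \<gamma>: "\<gamma> \<in> Omega_curves" and \<alpha>: "disc_lift \<alpha> \<gamma>"
  shows "(\<gamma>, phi \<circ> linepath 0 (\<alpha> 1)) \<in> Omega_homotopic"
  using \<gamma>
proof (cases rule: Omega_curve_cases)
  case zero
  then have "\<alpha> 1 = 0"
    using \<alpha> phi_in_Ints_iff[of "\<alpha> 1"] disc_lift_norm[OF \<alpha>, of 1] by (auto simp: disc_lift_def)
  with zero show ?thesis by (intro Omega_homotopic_equal[OF \<gamma>]) (simp add: linepath_def)
next
  case nonint
  define z where "z = \<alpha> 1"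
  have cont: "continuous_on {0..1} \<alpha>" and \<alpha>0: "\<alpha> 0 = 0" and ph: "\<And>t. t \<in> {0..1} \<Longrightarrow> phi (\<alpha> t) = \<gamma> t"
    using \<alpha> by (auto simp: disc_lift_def path_def)
  note n1 = disc_lift_norm[OF \<alpha>]
  have nz: "\<alpha> t \<noteq> 0" if "t \<in> {0<..1}" for t
    using nonint(1)[of t] ph[of t] that by auto
  have z: "norm z < 1" "z \<noteq> 0" using n1[of 1] nz[of 1] by (auto simp: z_def)
  have c1: "continuous_on {0<..1} \<alpha>" by (rule continuous_on_subset[OF cont]) auto
  have "contractible {0<..1::real}" by (rule convex_imp_contractible) simp
  then obtain l where l: "continuous_on {0<..1} l" "\<And>t. t \<in> {0<..1} \<Longrightarrow> \<alpha> t = exp (l t)"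
    using continuous_logarithm_on_contractible[OF c1] nz by metis
  \<comment> \<open>A logarithm of \<open>t * z\<close>, normalised to agree with \<open>l\<close>
    at \<open>t = 1\<close>, so that all stages end at \<open>z\<close>.\<close>
  define m where "m t = l 1 + of_real (ln t)" for t
  have m: "exp (m t) = of_real t * z" if "0 < t" for t
    using l(2)[of 1] that by (simp add: m_def z_def exp_add exp_of_real mult.commute)
  have cm: "continuous_on {0<..1} m" unfolding m_def by (intro continuous_intros) auto
  define H where "H = (\<lambda>(s::real, t::real). if t \<le> 0 then 0 else exp (of_real (1 - s) * l t + of_real s * m t))"
  \<comment> \<open>Real parts of logarithms are interpolated linearly, so moduli stay below the
    larger of the two. This keeps the homotopy in the disc and makes it continuous at time 0, where
    the logarithms diverge.\<close>
  have bound: "norm (H (s, t)) \<le> max (norm (\<alpha> t)) (t * norm z)" if "s \<in> {0..1}" "t \<in> {0..1}" for s t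
  proof (cases "t = 0")
    case True
    then show ?thesis by (simp add: H_def)
  next
    case False
    then have t: "0 < t" "t \<in> {0<..1}" using that by auto
    have "Re (of_real (1 - s) * l t + of_real s * m t) = (1 - s) * Re (l t) + s * Re (m t)" by simp
    also have "\<dots> \<le> max (Re (l t)) (Re (m t))"
      using that by (intro convex_bound_le) auto
    finally have "norm (H (s, t)) \<le> exp (max (Re (l t)) (Re (m t)))"
      using t by (simp add: H_def)
    also have "\<dots> = max (exp (Re (l t))) (exp (Re (m t)))" by (simp add: max_def)
    also have "exp (Re (l t)) = norm (\<alpha> t)" using l(2)[OF t(2)] by simp
    also have "exp (Re (m t)) = t * norm z" using arg_cong[OF m[OF t(1)], of norm] t by (simp add: norm_mult)
    finally show ?thesis .
  qed
  have H1: "norm (H x) < 1" if "x \<in> {0..1} \<times> {0..1}" for x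
  proof -
    have "t * norm z < 1" if "t \<in> {0..1}" for t :: real
      using mult_right_mono[of t 1 "norm z"] that z(1) by auto
    then show ?thesis using bound[of "fst x" "snd x"] n1[of "snd x"] that by (fastforce simp: less_max_iff_disj)
  qed
  have contH: "continuous_on ({0..1} \<times> {0..1}) H"
    unfolding continuous_on_eq_continuous_within
  proof
    fix x :: "real \<times> real" assume x: "x \<in> {0..1} \<times> {0..1}"
    show "continuous (at x within {0..1} \<times> {0..1}) H"
    proof (cases "snd x = 0")
      case True
      have "((\<lambda>y. max (norm (\<alpha> (snd y))) (snd y * norm z)) \<longlongrightarrow> max (norm (\<alpha> (snd x))) (snd x * norm z))
          (at x within {0..1} \<times> {0..1})"
      proof (intro tendsto_intros)
        have "continuous_on ({0..1} \<times> {0..1}) (\<lambda>y :: real \<times> real. \<alpha> (snd y))"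
          by (rule continuous_on_compose2[OF cont continuous_on_snd[OF continuous_on_id]]) auto
        then show "((\<lambda>y. \<alpha> (snd y)) \<longlongrightarrow> \<alpha> (snd x)) (at x within {0..1} \<times> {0..1})"
          using x unfolding continuous_on_def by blast
      qed
      then have lim: "((\<lambda>y. max (norm (\<alpha> (snd y))) (snd y * norm z)) \<longlongrightarrow> 0) (at x within {0..1} \<times> {0..1})"
        using True \<alpha>0 by simp
      have "(H \<longlongrightarrow> 0) (at x within {0..1} \<times> {0..1})"
      proof (rule Lim_null_comparison[OF _ lim])
        show "\<forall>\<^sub>F y in at x within {0..1} \<times> {0..1}. norm (H y) \<le> max (norm (\<alpha> (snd y))) (snd y * norm z)"
          unfolding eventually_at_filter using bound by (intro always_eventually) auto
      qed
      moreover have "H x = 0" using True by (cases x) (simp add: H_def)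
      ultimately show ?thesis by (simp add: continuous_within)
    next
      case False
      let ?T = "{0..1} \<times> {0<..1} :: (real \<times> real) set"
      have xT: "x \<in> ?T" using x False by auto
      have "continuous_on ?T (\<lambda>y. l (snd y))" "continuous_on ?T (\<lambda>y. m (snd y))"
        by (rule continuous_on_compose2[OF l(1) continuous_on_snd[OF continuous_on_id]]
                 continuous_on_compose2[OF cm continuous_on_snd[OF continuous_on_id]]; auto)+
      then have "continuous_on ?T (\<lambda>y. exp (of_real (1 - fst y) * l (snd y) + of_real (fst y) * m (snd y)))"
        by (intro continuous_intros)
      then have "continuous_on ?T H"
        by (rule continuous_on_eq) (auto simp: H_def)
      then have "continuous (at x within ?T) H" using xT unfolding continuous_on_eq_continuous_within by blast
      moreover have "at x within ({0..1} \<times> {0..1}) = at x within ?T"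
      proof (rule at_within_nhd[of x "UNIV \<times> {0<..}"])
        show "open (UNIV \<times> {0<..} :: (real \<times> real) set)" by (intro open_Times) auto
      qed (use xT in auto)
      ultimately show ?thesis by simp
    qed
  qed
  have Hz: "H (s, t) = 0 \<longleftrightarrow> t \<le> 0" for s t by (simp add: H_def)
  have Hend: "H (s, 1) = z" for s
  proof -
    have "of_real (1 - s) * l 1 + of_real s * m 1 = l 1" by (simp add: m_def algebra_simps)
    then show ?thesis using l(2)[of 1] by (simp add: H_def z_def)
  qed
  have H0: "H (0, t) = \<alpha> t" if "t \<in> {0..1}" for t
    using that \<alpha>0 l(2)[of t] by (cases "t = 0") (auto simp: H_def)
  have Hl: "H (1, t) = linepath 0 z t" if "t \<in> {0..1}" for t
    using that m[of t] by (cases "t = 0") (auto simp: H_def linepath_def scaleR_conv_of_real)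
  have curve: "(\<lambda>t. phi (H (s, t))) \<in> Omega_curves" if s: "s \<in> {0..1}" for s
  proof -
    have "path (\<lambda>t. H (s, t))"
      unfolding path_def by (rule continuous_on_compose2[OF contH]) (use s in \<open>auto intro!: continuous_intros\<close>)
    moreover have "path_image (\<lambda>t. H (s, t)) \<subseteq> ball 0 1" using H1 s by (auto simp: path_image_def)
    ultimately have "phi \<circ> (\<lambda>t. H (s, t)) \<in> Omega_curves"
      by (rule disc_lift_image) (auto simp: Hz)
    then show ?thesis by (simp add: o_def)
  qed
  have "continuous_on ({0..1} \<times> {0..1}) (\<lambda>x. phi (H x))"
    by (rule continuous_on_compose2[OF phi_continuous contH]) (use H1 in auto)
  moreover have "phi \<circ> linepath 0 z \<in> Omega_curves" by (rule disc_lift_linepath(1)[OF z(1)])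
  moreover have "phi z = \<gamma> 1" using ph[of 1] by (simp add: z_def)
  ultimately show ?thesis
    unfolding Omega_homotopic_iff z_def[symmetric] using \<gamma> curve Hend H0 Hl ph
    by (intro conjI exI[of _ "\<lambda>x. phi (H x)"] ballI) simp_all
qed

section \<open>The topology and the charts of \<open>\<Omega>\<^sub>\<int>\<close>\<close>

lemma phi_lift_class: "norm z < 1 \<Longrightarrow> phi_lift z \<in> Omega"
  unfolding phi_lift_def Omega_def by (rule quotientI[OF disc_lift_linepath(1)])

lemma phi_lift_eqI:
  assumes "\<gamma> \<in> Omega_curves" "disc_lift \<alpha> \<gamma>"
  shows "phi_lift (\<alpha> 1) = Omega_homotopic `` {\<gamma>}"
  unfolding phi_lift_def
  by (rule equiv_class_eq[OF Omega_homotopic_equiv disc_lift_homotopic_linepath[OF assms], symmetric])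

lemma mem_phi_lift_iff: "\<gamma> \<in> phi_lift z \<longleftrightarrow> (phi \<circ> linepath 0 z, \<gamma>) \<in> Omega_homotopic"
  by (simp add: phi_lift_def)

lemma mem_phi_lift_curve: "\<gamma> \<in> phi_lift z \<Longrightarrow> \<gamma> \<in> Omega_curves"
  by (simp add: mem_phi_lift_iff Omega_homotopic_def)

lemma mem_phi_lift_endpoint:
  assumes "norm z < 1" "\<gamma> \<in> phi_lift z" "disc_lift \<alpha> \<gamma>"
  shows "\<alpha> 1 = z"
  using Omega_homotopic_lift_endpoint[OF assms(2)[unfolded mem_phi_lift_iff] disc_lift_linepath(2)[OF assms(1)] assms(3)]
  by (simp add: linepath_1')

lemma mem_phi_liftI:
  assumes "\<gamma> \<in> Omega_curves" "disc_lift \<alpha> \<gamma>" "\<alpha> 1 = z"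
  shows "\<gamma> \<in> phi_lift z"
  using phi_lift_eqI[OF assms(1,2)] equiv_class_self[OF Omega_homotopic_equiv assms(1)] assms(3) by simp

text \<open>A representative has a lift, and the end of the lift determines the class.\<close>

lemma Omega_cases:
  assumes "P \<in> Omega"
  obtains z where "norm z < 1" "P = phi_lift z"
proof -
  obtain \<gamma> where \<gamma>: "\<gamma> \<in> Omega_curves" "P = Omega_homotopic `` {\<gamma>}"
    using assms unfolding Omega_def by (rule quotientE)
  obtain \<alpha> where \<alpha>: "disc_lift \<alpha> \<gamma>" using disc_lift_exists[OF \<gamma>(1)] by blast
  show ?thesis
    by (rule that[of "\<alpha> 1"]) (use disc_lift_norm[OF \<alpha>, of 1] phi_lift_eqI[OF \<gamma>(1) \<alpha>] \<gamma>(2) in auto)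
qed

lemma phi_lift_inj:
  assumes "norm z < 1" "norm w < 1" "phi_lift z = phi_lift w"
  shows "z = w"
proof -
  have "phi \<circ> linepath 0 z \<in> phi_lift z"
    by (rule mem_phi_liftI[OF disc_lift_linepath[OF assms(1)]]) (simp add: linepath_1')
  then show ?thesis
    using mem_phi_lift_endpoint[OF assms(2) _ disc_lift_linepath(2)[OF assms(1)]] assms(3)
    by (simp add: linepath_1')
qed

lemma phi_lift_bij: "bij_betw phi_lift (ball 0 1) Omega"
proof (rule bij_betwI')
  show "phi_lift x = phi_lift y \<longleftrightarrow> x = y" if "x \<in> ball 0 1" "y \<in> ball 0 1" for x y
    using phi_lift_inj that by auto
  show "phi_lift x \<in> Omega" if "x \<in> ball 0 1" for x using phi_lift_class that by simp
  show "\<exists>x\<in>ball 0 1. P = phi_lift x" if "P \<in> Omega" for P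
    using that by (rule Omega_cases) auto
qed

lemma Omega_proj_phi_lift:
  assumes z: "norm z < 1"
  shows "Omega_proj (phi_lift z) = phi z"
proof -
  have "pathfinish \<gamma> = phi z" if "\<gamma> \<in> phi_lift z" for \<gamma>
    using Omega_homotopic_endpoint[of "phi \<circ> linepath 0 z" \<gamma>] that
    by (simp add: mem_phi_lift_iff pathfinish_def linepath_1')
  moreover have "phi \<circ> linepath 0 z \<in> phi_lift z"
    by (rule mem_phi_liftI[OF disc_lift_linepath[OF z]]) (simp add: linepath_1')
  ultimately have "pathfinish ` phi_lift z = {phi z}" by auto
  then show ?thesis by (simp add: Omega_proj_def)
qed

lemma Omega_origin_eq: "Omega_origin = phi_lift 0"
proof -
  have "phi \<circ> linepath 0 0 = (\<lambda>_. 0)" by (auto simp: fun_eq_iff linepath_def)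
  then show ?thesis by (simp add: Omega_origin_def phi_lift_def)
qed

section \<open>The topology of the surface is that of the disc\<close>

lemma disc_lift_subpath:
  assumes "disc_lift \<beta> \<delta>" "s \<in> {0..1}"
  shows "disc_lift (subpath 0 s \<beta>) (subpath 0 s \<delta>)"
proof -
  have "s * t \<in> {0..1}" if "t \<in> {0..1}" for t using assms(2) that by (auto intro: mult_le_one)
  then show ?thesis
    using assms path_subpath[of \<beta> 0 s] path_image_subpath_subset[of 0 s \<beta>]
    by (auto simp: disc_lift_def subpath_def)
qed

text \<open>The lift of a continued curve is at \<open>z\<close> at time \<open>s\<close> and is
  held in the section afterwards by \<open>lift_stays_in_section\<close>.\<close>

lemma Omega_nbhd_phi_lift_subset:
  assumes z: "norm z < 1" and h: "h holomorphic_on ball (phi z) r" "h (phi z) = z"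
    "\<forall>w\<in>ball (phi z) r. norm (h w) < 1 \<and> phi (h w) = w"
  shows "Omega_nbhd (phi_lift z) r \<subseteq> phi_lift ` h ` ball (phi z) r"
proof
  fix Q assume "Q \<in> Omega_nbhd (phi_lift z) r"
  then obtain \<delta> s where Q: "Q \<in> Omega" "\<delta> \<in> Q" "s \<in> {0..1}" "subpath 0 s \<delta> \<in> phi_lift z"
    "path_image (subpath s 1 \<delta>) \<subseteq> ball (phi z) r"
    unfolding Omega_nbhd_def Omega_proj_phi_lift[OF z] by blast
  obtain q where q: "norm q < 1" "Q = phi_lift q" using Q(1) by (rule Omega_cases)
  have \<delta>: "\<delta> \<in> Omega_curves" using mem_phi_lift_curve Q(2) q(2) by blast
  obtain \<beta> where \<beta>: "disc_lift \<beta> \<delta>" using disc_lift_exists[OF \<delta>] by blast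
  have b1: "\<beta> 1 = q" using mem_phi_lift_endpoint[OF q(1) _ \<beta>] Q(2) q(2) by simp
  have bs: "\<beta> s = z"
    using mem_phi_lift_endpoint[OF z Q(4) disc_lift_subpath[OF \<beta> Q(3)]] by (simp add: subpath_def)
  have ph: "phi (\<beta> t) = \<delta> t" if "t \<in> {0..1}" for t using \<beta> that by (simp add: disc_lift_def)
  have in_ball: "phi (\<beta> t) \<in> ball (phi z) r" if "t \<in> {s..1}" for t
  proof -
    have "\<delta> t \<in> path_image (subpath s 1 \<delta>)" using Q(3) that by (auto simp: path_image_subpath)
    then show ?thesis using Q(3,5) ph[of t] that by auto
  qed
  have "\<beta> 1 = h (phi (\<beta> 1))"
  proof (rule lift_stays_in_section[OF h(1,3), where I = "{s..1}" and ?t0.0 = s and \<beta> = \<beta> and t = 1])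
    have "continuous_on {0..1} \<beta>" using \<beta> by (simp add: disc_lift_def path_def)
    then show "continuous_on {s..1} \<beta>" by (rule continuous_on_subset) (use Q(3) in auto)
    show "norm (\<beta> t) < 1 \<and> phi (\<beta> t) \<in> ball (phi z) r" if "t \<in> {s..1}" for t
      using disc_lift_norm[OF \<beta>, of t] in_ball[OF that] that Q(3) by simp
  qed (use Q(3) bs h(2) in auto)
  then have "q \<in> h ` ball (phi z) r" using b1 in_ball[of 1] Q(3) by auto
  then show "Q \<in> phi_lift ` h ` ball (phi z) r" using q(2) by blast
qed

text \<open>A point of the section is reached from \<open>z\<close> along the image under
  \<open>h\<close> of a straight segment; for \<open>z \<noteq> 0\<close> the absence of zeros of
  \<open>h\<close> keeps this continuation away from the origin.\<close>

lemma phi_lift_subset_Omega_nbhd: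
  assumes z: "norm z < 1" and h: "h holomorphic_on ball (phi z) r" "h (phi z) = z"
    "\<forall>w\<in>ball (phi z) r. norm (h w) < 1 \<and> phi (h w) = w"
    "z \<noteq> 0 \<longrightarrow> (\<forall>w\<in>ball (phi z) r. h w \<noteq> 0)" and r: "0 < r"
  shows "phi_lift ` h ` ball (phi z) r \<subseteq> Omega_nbhd (phi_lift z) r"
proof
  fix Q assume "Q \<in> phi_lift ` h ` ball (phi z) r"
  then obtain w where w: "w \<in> ball (phi z) r" "Q = phi_lift (h w)" by blast
  have nh: "norm (h w) < 1" using h(3) w(1) by blast
  define g where "g = h \<circ> linepath (phi z) w"
  have seg: "linepath (phi z) w t \<in> ball (phi z) r" if "t \<in> {0..1}" for t
  proof -
    have "closed_segment (phi z) w \<subseteq> ball (phi z) r" using w(1) r by (intro closed_segment_subset) auto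
    then show ?thesis using that linepath_in_path[of t "phi z" w] by blast
  qed
  have path_g: "path g"
    unfolding g_def using seg
    by (intro path_continuous_image[OF path_linepath] continuous_on_subset[OF holomorphic_on_imp_continuous_on[OF h(1)]])
       (auto simp: path_image_def)
  have g: "norm (g t) < 1 \<and> phi (g t) \<in> ball (phi z) r \<and> phi (g t) = linepath (phi z) w t" if "t \<in> {0..1}" for t
    using h(3) seg[OF that] by (simp add: g_def)
  have g01: "g 0 = z" "g 1 = h w" using h(2) by (simp_all add: g_def linepath_0' linepath_1')
  have "\<exists>\<delta>\<in>Q. \<exists>s\<in>{0..1}. subpath 0 s \<delta> \<in> phi_lift z \<and> path_image (subpath s 1 \<delta>) \<subseteq> ball (phi z) r"
  proof (cases "z = 0")
    case True
    \<comment> \<open>At the origin the curve to be continued is constant. Joining it to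
      \<open>g\<close> would rest at 0 for a while, which is not admissible for a curve that then
      leaves 0; so \<open>g\<close> alone is used, with \<open>s = 0\<close>.\<close>
    have "(\<forall>t\<in>{0<..1}. g t \<noteq> 0) \<or> (\<forall>t\<in>{0..1}. g t = 0)"
    proof (cases "w = 0")
      case True
      then show ?thesis using h(2) \<open>z = 0\<close> by (simp add: g_def linepath_def)
    next
      case False
      have "g t \<noteq> 0" if "t \<in> {0<..1}" for t
        using g[of t] that False \<open>z = 0\<close> by (auto simp: linepath_def)
      then show ?thesis by blast
    qed
    then have c: "phi \<circ> g \<in> Omega_curves" "disc_lift g (phi \<circ> g)"
      using path_g g g01 True by (auto intro!: disc_lift_image simp: path_image_def)
    have "phi \<circ> g \<in> Q" using mem_phi_liftI[OF c] g01 w(2) by simp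
    moreover have "subpath 0 0 (phi \<circ> g) \<in> phi_lift z"
    proof (rule mem_phi_liftI)
      show "subpath 0 0 (phi \<circ> g) \<in> Omega_curves"
        using g01 True by (simp add: subpath_def Omega_curves_def path_def pathstart_def)
      show "disc_lift (subpath 0 0 g) (subpath 0 0 (phi \<circ> g))" by (rule disc_lift_subpath[OF c(2)]) simp
    qed (simp add: subpath_def g01)
    moreover have "phi (g t) \<in> ball (phi z) r" if "t \<in> {0..1}" for t using g[OF that] by blast
    then have "path_image (subpath 0 1 (phi \<circ> g)) \<subseteq> ball (phi z) r"
      by (auto simp: path_image_def)
    ultimately show ?thesis by (intro bexI[of _ "phi \<circ> g"] bexI[of _ 0]) auto
  next
    case False
    \<comment> \<open>The join reaches \<open>z\<close> at time \<open>1/2\<close>, which becomes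
      the witness for \<open>s\<close>.\<close>
    define \<alpha> where "\<alpha> = linepath 0 z +++ g"
    have path_\<alpha>: "path \<alpha>"
      unfolding \<alpha>_def using path_g g01 by (intro path_join_imp) (auto simp: pathstart_def pathfinish_def linepath_1')
    have ends: "\<alpha> 0 = 0" "\<alpha> 1 = h w" by (simp_all add: \<alpha>_def joinpaths_def linepath_0' g01)
    have norm_\<alpha>: "norm (\<alpha> t) < 1" if "t \<in> {0..1}" for t
    proof (cases "t \<le> 1/2")
      case True
      then show ?thesis
        using disc_lift_norm[OF disc_lift_linepath(2)[OF z], of "2 * t"] that by (simp add: \<alpha>_def joinpaths_def)
    next
      case False
      then show ?thesis using g[of "2 * t - 1"] that by (simp add: \<alpha>_def joinpaths_def)
    qed
    have nz: "\<alpha> t \<noteq> 0" if "t \<in> {0<..1}" for t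
    proof (cases "t \<le> 1/2")
      case True
      then show ?thesis using that \<open>z \<noteq> 0\<close> by (simp add: \<alpha>_def joinpaths_def linepath_def)
    next
      case False
      then show ?thesis using h(4) \<open>z \<noteq> 0\<close> seg[of "2 * t - 1"] that by (simp add: \<alpha>_def joinpaths_def g_def)
    qed
    have "path_image \<alpha> \<subseteq> ball 0 1" using norm_\<alpha> by (auto simp: path_image_def)
    moreover have "(\<forall>t\<in>{0<..1}. \<alpha> t \<noteq> 0) \<or> (\<forall>t\<in>{0..1}. \<alpha> t = 0)" using nz by blast
    ultimately have c: "phi \<circ> \<alpha> \<in> Omega_curves" "disc_lift \<alpha> (phi \<circ> \<alpha>)"
      by (simp_all add: disc_lift_image[OF path_\<alpha> _ ends(1)])
    have "phi \<circ> \<alpha> \<in> Q" using mem_phi_liftI[OF c] ends w(2) by simp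
    moreover have "subpath 0 (1/2) (phi \<circ> \<alpha>) \<in> phi_lift z"
    proof -
      have "(phi \<circ> linepath 0 z, subpath 0 (1/2) (phi \<circ> \<alpha>)) \<in> Omega_homotopic"
        by (rule Omega_homotopic_equal[OF disc_lift_linepath(1)[OF z]])
           (simp add: subpath_def \<alpha>_def joinpaths_def)
      then show ?thesis by (simp add: mem_phi_lift_iff)
    qed
    moreover have "path_image (subpath (1/2) 1 (phi \<circ> \<alpha>)) \<subseteq> ball (phi z) r"
    proof -
      have "phi (\<alpha> t) \<in> ball (phi z) r" if "t \<in> {1/2..1}" for t
      proof (cases "t = 1/2")
        case True
        have "\<alpha> t = z" unfolding True by (simp add: \<alpha>_def joinpaths_def linepath_def)
        then show ?thesis using r by simp
      next
        case False
        then have "\<alpha> t = g (2 * t - 1)" using that by (simp add: \<alpha>_def joinpaths_def)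
        moreover have "2 * t - 1 \<in> {0..1}" using that by simp
        ultimately show ?thesis using g by metis
      qed
      then show ?thesis by (auto simp: path_image_subpath)
    qed
    ultimately show ?thesis by (intro bexI[of _ "phi \<circ> \<alpha>"] bexI[of _ "1/2"]) auto
  qed
  moreover have "Q \<in> Omega" using phi_lift_class[OF nh] w(2) by simp
  ultimately show "Q \<in> Omega_nbhd (phi_lift z) r"
    unfolding Omega_nbhd_def Omega_proj_phi_lift[OF z] by blast
qed

lemma Omega_nbhd_mono: "r \<le> r' \<Longrightarrow> Omega_nbhd P r \<subseteq> Omega_nbhd P r'"
  using subset_ball[of r r' "Omega_proj P"] unfolding Omega_nbhd_def by blast

lemma topspace_Omega [simp]: "topspace Omega_topology = Omega"
proof
  show "topspace Omega_topology \<subseteq> Omega"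
    using openin_topspace[of Omega_topology] unfolding openin_Omega_topology by blast
  have "openin Omega_topology Omega"
    unfolding openin_Omega_topology by (auto simp: Omega_nbhd_def intro: exI[of _ 1])
  then show "Omega \<subseteq> topspace Omega_topology" by (rule openin_subset)
qed

text \<open>By the two inclusions above, the sets \<open>Omega_nbhd\<close> around
  \<open>phi_lift z\<close> are, for small radii, the images of balls under a local section; so
  openness means the same on both sides.\<close>

lemma phi_lift_homeomorphic: "homeomorphic_map disc_topology Omega_topology phi_lift"
  unfolding homeomorphic_map_def quotient_map_def
proof (intro conjI allI impI)
  have td: "topspace disc_topology = ball 0 1" by (simp add: disc_topology_def)
  show "inj_on phi_lift (topspace disc_topology)" "phi_lift ` topspace disc_topology = topspace Omega_topology"
    using phi_lift_bij by (simp_all add: td bij_betw_def)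
  fix U assume "U \<subseteq> topspace Omega_topology"
  then have U: "U \<subseteq> Omega" by simp
  let ?V = "{x \<in> topspace disc_topology. phi_lift x \<in> U}"
  have V: "openin disc_topology ?V \<longleftrightarrow> open ?V"
    by (auto simp: td disc_topology_def openin_open_eq)
  show "openin disc_topology ?V \<longleftrightarrow> openin Omega_topology U"
  proof
    assume "openin disc_topology ?V"
    then have oV: "open ?V" using V by simp
    show "openin Omega_topology U"
      unfolding openin_Omega_topology
    proof (intro conjI ballI U)
      fix P assume P: "P \<in> U"
      then have "P \<in> Omega" using U by blast
      then obtain z where z: "norm z < 1" "P = phi_lift z" by (rule Omega_cases)
      obtain \<epsilon> h where h: "0 < \<epsilon>" "h holomorphic_on ball (phi z) \<epsilon>" "h (phi z) = z"
        "\<forall>w\<in>ball (phi z) \<epsilon>. norm (h w) < 1 \<and> phi (h w) = w"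
        "z \<noteq> 0 \<longrightarrow> (\<forall>w\<in>ball (phi z) \<epsilon>. h w \<noteq> 0)"
        by (rule phi_local_section[OF z(1)])
      have "open (ball (phi z) \<epsilon> \<inter> h -` ?V)"
        by (rule continuous_open_preimage[OF holomorphic_on_imp_continuous_on[OF h(2)] open_ball oV])
      moreover have "phi z \<in> ball (phi z) \<epsilon> \<inter> h -` ?V" using h(1,3) z P by (simp add: td)
      ultimately obtain r where r: "0 < r" "ball (phi z) r \<subseteq> ball (phi z) \<epsilon> \<inter> h -` ?V"
        unfolding open_contains_ball by blast
      have hr: "h holomorphic_on ball (phi z) r" by (rule holomorphic_on_subset[OF h(2)]) (use r(2) in blast)
      have h4: "\<forall>w\<in>ball (phi z) r. norm (h w) < 1 \<and> phi (h w) = w" using h(4) r(2) by blast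
      have "Omega_nbhd (phi_lift z) r \<subseteq> phi_lift ` h ` ball (phi z) r"
        by (rule Omega_nbhd_phi_lift_subset[OF z(1) hr h(3) h4])
      also have "\<dots> \<subseteq> U" using r(2) by blast
      finally show "\<exists>r>0. Omega_nbhd P r \<subseteq> U" using r(1) z(2) by blast
    qed
  next
    assume "openin Omega_topology U"
    then have oU: "\<And>P. P \<in> U \<Longrightarrow> \<exists>r>0. Omega_nbhd P r \<subseteq> U" unfolding openin_Omega_topology by blast
    have "open ?V"
    proof (subst open_subopen, intro ballI)
      fix z assume "z \<in> ?V"
      then have z: "norm z < 1" "phi_lift z \<in> U" by (auto simp: td)
      obtain \<epsilon> h where h: "0 < \<epsilon>" "h holomorphic_on ball (phi z) \<epsilon>" "h (phi z) = z"
        "\<forall>w\<in>ball (phi z) \<epsilon>. norm (h w) < 1 \<and> phi (h w) = w"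
        "z \<noteq> 0 \<longrightarrow> (\<forall>w\<in>ball (phi z) \<epsilon>. h w \<noteq> 0)"
        by (rule phi_local_section[OF z(1)])
      obtain r0 where r0: "0 < r0" "Omega_nbhd (phi_lift z) r0 \<subseteq> U" using oU[OF z(2)] by blast
      define r where "r = min r0 \<epsilon>"
      have r: "0 < r" "r \<le> r0" "ball (phi z) r \<subseteq> ball (phi z) \<epsilon>" using h(1) r0(1) by (auto simp: r_def)
      have hr: "h holomorphic_on ball (phi z) r" by (rule holomorphic_on_subset[OF h(2) r(3)])
      have h4: "\<forall>w\<in>ball (phi z) r. norm (h w) < 1 \<and> phi (h w) = w" using h(4) r(3) by blast
      have "phi_lift ` h ` ball (phi z) r \<subseteq> Omega_nbhd (phi_lift z) r"
        by (rule phi_lift_subset_Omega_nbhd[OF z(1) hr h(3) h4 _ r(1)]) (use h(5) r(3) in blast)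
      also have "\<dots> \<subseteq> U" using Omega_nbhd_mono[OF r(2)] r0(2) by blast
      finally have "h ` ball (phi z) r \<subseteq> ?V" using h4 by (auto simp: td)
      moreover have "open (h ` ball (phi z) r)" by (rule phi_section_open[OF hr open_ball h4])
      moreover have "z \<in> h ` ball (phi z) r" using h(3) r(1) by (intro image_eqI[of _ _ "phi z"]) auto
      ultimately show "\<exists>T. open T \<and> z \<in> T \<and> T \<subseteq> ?V" by blast
    qed
    then show "openin disc_topology ?V" using V by simp
  qed
qed

lemma phi_lift_quotient: "quotient_map disc_topology Omega_topology phi_lift"
  using phi_lift_homeomorphic by (simp add: homeomorphic_map_def)

lemma topspace_disc [simp]: "topspace disc_topology = ball 0 1"
  by (simp add: disc_topology_def)

lemma phi_lift_continuous: "continuous_map disc_topology Omega_topology phi_lift"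
  by (rule quotient_imp_continuous_map[OF phi_lift_quotient])

lemma Omega_proj_continuous: "continuous_map Omega_topology euclidean Omega_proj"
proof (rule continuous_compose_quotient_map[OF phi_lift_quotient])
  have "continuous_map disc_topology euclidean phi"
    using phi_continuous by (simp add: disc_topology_def)
  then show "continuous_map disc_topology euclidean (Omega_proj \<circ> phi_lift)"
    by (rule continuous_map_eq) (simp add: Omega_proj_phi_lift)
qed

lemma psi_phi_lift: "norm z < 1 \<Longrightarrow> psi (phi_lift z) = z"
  unfolding psi_def using phi_lift_bij by (intro inv_into_f_f) (auto simp: bij_betw_def)

lemma phi_psi: "P \<in> Omega \<Longrightarrow> phi (psi P) = Omega_proj P"
  by (elim Omega_cases) (simp add: psi_phi_lift Omega_proj_phi_lift)

lemma psi_bij: "bij_betw psi Omega (ball 0 1)"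
  unfolding psi_def by (rule bij_betw_inv_into[OF phi_lift_bij])

lemma psi_continuous: "continuous_map Omega_topology disc_topology psi"
proof (rule continuous_compose_quotient_map[OF phi_lift_quotient])
  show "continuous_map disc_topology disc_topology (psi \<circ> phi_lift)"
    by (rule continuous_map_eq[OF continuous_map_id]) (simp add: psi_phi_lift)
qed

section \<open>The complex structure and the biholomorphic map\<close>

lemma Omega_chart_at:
  assumes "P \<in> Omega"
  obtains U where "P \<in> U" "(U, Omega_proj) \<in> Omega_atlas"
proof -
  obtain z where z: "norm z < 1" "P = phi_lift z" using assms by (rule Omega_cases)
  obtain \<epsilon> h where h: "0 < \<epsilon>" "h holomorphic_on ball (phi z) \<epsilon>" "h (phi z) = z"
    "\<forall>w\<in>ball (phi z) \<epsilon>. norm (h w) < 1 \<and> phi (h w) = w"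
    "z \<noteq> 0 \<longrightarrow> (\<forall>w\<in>ball (phi z) \<epsilon>. h w \<noteq> 0)"
    by (rule phi_local_section[OF z(1)])
  let ?B = "ball (phi z) \<epsilon>"
  \<comment> \<open>A sheet of the projection, on which \<open>phi_lift \<circ> h\<close> inverts
    \<open>Omega_proj\<close>.\<close>
  define U where "U = phi_lift ` h ` ?B"
  have hd: "h ` ?B \<subseteq> ball 0 1" using h(4) by auto
  have UO: "U \<subseteq> Omega" unfolding U_def using hd phi_lift_class by auto
  have proj: "Omega_proj (phi_lift (h w)) = w" if "w \<in> ?B" for w
    using h(4) that by (simp add: Omega_proj_phi_lift)
  have "(\<lambda>w. Omega_proj (phi_lift (h w))) ` ?B = (\<lambda>w. w) ` ?B" by (intro image_cong refl proj)
  then have im: "Omega_proj ` U = ?B" by (simp add: U_def image_image)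
  have "openin disc_topology (h ` ?B)"
    using phi_section_open[OF h(2) open_ball h(4)] hd by (simp add: disc_topology_def open_subset)
  then have oU: "openin Omega_topology U"
    unfolding U_def using phi_lift_homeomorphic homeomorphic_map_openness hd topspace_disc by metis
  have "homeomorphic_maps (subtopology Omega_topology U) (top_of_set ?B) Omega_proj (phi_lift \<circ> h)"
    unfolding homeomorphic_maps_def
  proof (intro conjI ballI)
    show "continuous_map (subtopology Omega_topology U) (top_of_set ?B) Omega_proj"
      using im continuous_map_from_subtopology[OF Omega_proj_continuous]
      by (auto simp: continuous_map_in_subtopology)
    have "continuous_map (top_of_set ?B) disc_topology h"
      using holomorphic_on_imp_continuous_on[OF h(2)] hd
      by (auto simp: disc_topology_def continuous_map_in_subtopology)
    from continuous_map_compose[OF this phi_lift_continuous]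
    show "continuous_map (top_of_set ?B) (subtopology Omega_topology U) (phi_lift \<circ> h)"
      by (auto simp: continuous_map_in_subtopology U_def)
  qed (use proj in \<open>auto simp: U_def\<close>)
  then have "homeomorphic_map (subtopology Omega_topology U) (top_of_set (Omega_proj ` U)) Omega_proj"
    unfolding im homeomorphic_map_maps by blast
  then have "(U, Omega_proj) \<in> Omega_atlas"
    using oU im by (auto simp: Omega_atlas_def)
  moreover have "P \<in> U" unfolding U_def z(2) using h(1,3) by (intro imageI image_eqI[of _ _ "phi z"]) auto
  ultimately show ?thesis by (rule that[rotated])
qed

text \<open>Connectedness and the Hausdorff property are carried over from the disc; all charts
  restrict the same map \<open>Omega_proj\<close>, so the transition maps are identities.\<close>

lemma Omega_riemann_surface: "riemann_surface Omega_topology Omega_atlas"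
proof -
  have hs: "disc_topology homeomorphic_space Omega_topology"
    by (rule homeomorphic_map_imp_homeomorphic_space[OF phi_lift_homeomorphic])
  have "connected (ball (0::complex) 1)" by simp
  then have "connected_space disc_topology" by (simp add: disc_topology_def connected_space_subtopology)
  then have "connected_space Omega_topology" using homeomorphic_connected_space[OF hs] by simp
  moreover have "Hausdorff_space disc_topology"
    unfolding disc_topology_def by (intro Hausdorff_space_subtopology Hausdorff_space_euclidean)
  then have "Hausdorff_space Omega_topology" using homeomorphic_Hausdorff_space[OF hs] by simp
  moreover have "topspace Omega_topology \<noteq> {}" using phi_lift_class[of 0] by auto
  moreover have "complex_atlas Omega_topology Omega_atlas"
    unfolding complex_atlas_def
  proof (intro conjI)
    show "\<forall>(U, f)\<in>Omega_atlas. openin Omega_topology U \<and> open (f ` U) \<and>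
        homeomorphic_map (subtopology Omega_topology U) (top_of_set (f ` U)) f"
      by (auto simp: Omega_atlas_def)
    show "(\<Union>(U, f)\<in>Omega_atlas. U) = topspace Omega_topology"
    proof (intro equalityI subsetI)
      fix P assume "P \<in> (\<Union>(U, f)\<in>Omega_atlas. U)"
      then obtain U where "P \<in> U" "openin Omega_topology U" by (auto simp: Omega_atlas_def)
      then show "P \<in> topspace Omega_topology" using openin_subset by blast
    next
      fix P assume "P \<in> topspace Omega_topology"
      then have "P \<in> Omega" by simp
      then obtain U where "P \<in> U" "(U, Omega_proj) \<in> Omega_atlas" by (rule Omega_chart_at)
      then show "P \<in> (\<Union>(U, f)\<in>Omega_atlas. U)" by blast
    qed
    show "\<forall>(U, f)\<in>Omega_atlas. \<forall>(V, g)\<in>Omega_atlas. (g \<circ> inv_into U f) holomorphic_on f ` (U \<inter> V)"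
    proof clarify
      fix U f V g assume "(U, f) \<in> Omega_atlas" "(V, g) \<in> Omega_atlas"
      then have fg: "f = Omega_proj" "g = Omega_proj" by (auto simp: Omega_atlas_def)
      have "(\<lambda>w. w) holomorphic_on Omega_proj ` (U \<inter> V)" by (rule holomorphic_on_ident)
      then show "(g \<circ> inv_into U f) holomorphic_on f ` (U \<inter> V)"
        unfolding fg by (rule holomorphic_transform) (auto simp: f_inv_into_f)
    qed
  qed
  ultimately show ?thesis by (simp add: riemann_surface_def)
qed

text \<open>Read in a chart, \<open>psi\<close> is a continuous right inverse of \<open>phi\<close>,
  whose derivative never vanishes, so the rule for the derivative of an inverse applies.\<close>

lemma psi_holomorphic: "holomorphic_between Omega_topology Omega_atlas disc_topology disc_atlas psi"
  unfolding holomorphic_between_def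
proof (intro conjI psi_continuous, clarify)
  fix U f V g assume "(U, f) \<in> Omega_atlas" "(V, g) \<in> disc_atlas"
  then have fg: "f = Omega_proj" "V = ball 0 1" "g = (\<lambda>z. z)"
    and U: "openin Omega_topology U" "open (Omega_proj ` U)"
      "homeomorphic_map (subtopology Omega_topology U) (top_of_set (Omega_proj ` U)) Omega_proj"
    by (auto simp: Omega_atlas_def disc_atlas_def)
  have UO: "U \<subseteq> Omega" using openin_subset[OF U(1)] by simp
  have tU: "topspace (subtopology Omega_topology U) = U" using UO by auto
  let ?W = "Omega_proj ` U"
  define F where "F = psi \<circ> inv_into U Omega_proj"
  obtain k where k: "homeomorphic_maps (subtopology Omega_topology U) (top_of_set ?W) Omega_proj k"
    using U(3) unfolding homeomorphic_map_maps by blast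
  have inj: "inj_on Omega_proj U" using U(3) UO by (simp add: homeomorphic_map_def Int_absorb1)
  have kU: "k (Omega_proj P) = P" if "P \<in> U" for P
    using k that UO by (auto simp: homeomorphic_maps_def)
  have "continuous_map (top_of_set ?W) disc_topology (psi \<circ> k)"
    using k psi_continuous continuous_map_compose continuous_map_into_fulltopology
    unfolding homeomorphic_maps_def by metis
  then have "continuous_on ?W (psi \<circ> k)"
    by (auto simp: disc_topology_def continuous_map_in_subtopology)
  then have cF: "continuous_on ?W F"
    by (rule continuous_on_eq) (auto simp: F_def kU inv_into_f_f[OF inj])
  have F: "norm (F w) < 1 \<and> phi (F w) = w" if "w \<in> ?W" for w
  proof -
    obtain P where P: "P \<in> U" "w = Omega_proj P" using \<open>w \<in> ?W\<close> by blast
    then have "F w = psi P" by (simp add: F_def inv_into_f_f[OF inj])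
    moreover have "P \<in> Omega" using P(1) UO by blast
    moreover have "psi P \<in> ball 0 1" using psi_bij \<open>P \<in> Omega\<close> by (auto simp: bij_betw_def)
    ultimately show ?thesis using phi_psi P(2) by simp
  qed
  have "F holomorphic_on ?W"
    unfolding holomorphic_on_open[OF U(2)]
  proof (intro ballI exI)
    fix w assume w: "w \<in> ?W"
    show "(F has_field_derivative inverse (deriv phi (F w))) (at w)"
    proof (rule has_field_derivative_inverse_basic[OF _ _ _ U(2) w])
      show "(phi has_field_derivative deriv phi (F w)) (at (F w))"
        using F[OF w] by (intro holomorphic_derivI[OF phi_holomorphic]) auto
      show "deriv phi (F w) \<noteq> 0" using F[OF w] by (intro deriv_phi_nonzero) simp
      show "continuous (at w) F" using continuous_on_eq_continuous_at[OF U(2)] cF w by blast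
    qed (use F in auto)
  qed
  then have "F holomorphic_on Omega_proj ` (U \<inter> psi -` ball 0 1)"
    by (rule holomorphic_on_subset) blast
  then show "(g \<circ> psi \<circ> inv_into U f) holomorphic_on f ` (U \<inter> psi -` V)"
    by (simp add: fg F_def o_def)
qed

text \<open>Stated for any function agreeing with \<open>phi_lift\<close> on the disc, because the
  inverse in \<open>biholomorphic_between\<close> is \<open>inv_into Omega psi\<close>, whose
  agreement is established there only.\<close>

lemma phi_lift_holomorphic:
  assumes q: "\<And>z. norm z < 1 \<Longrightarrow> q z = phi_lift z"
  shows "holomorphic_between disc_topology disc_atlas Omega_topology Omega_atlas q"
  unfolding holomorphic_between_def
proof (intro conjI, goal_cases)
  case 1
  show ?case by (rule continuous_map_eq[OF phi_lift_continuous]) (simp add: q)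
next
  case 2
  show ?case
  proof clarify
    fix V g U f assume "(V, g) \<in> disc_atlas" "(U, f) \<in> Omega_atlas"
    then have fg: "f = Omega_proj" "V = ball 0 1" "g = (\<lambda>z. z)"
      by (auto simp: Omega_atlas_def disc_atlas_def)
    have i: "inv_into (ball 0 1) (\<lambda>z. z) z = z" if "norm z < 1" for z :: complex
      using inv_into_f_f[of "\<lambda>z. z" "ball 0 1" z] that by simp
    have "phi holomorphic_on (\<lambda>z. z) ` (ball 0 1 \<inter> q -` U)"
      by (rule holomorphic_on_subset[OF phi_holomorphic]) auto
    then show "(f \<circ> q \<circ> inv_into V g) holomorphic_on g ` (V \<inter> q -` U)"
      unfolding fg by (rule holomorphic_transform) (auto simp: i q Omega_proj_phi_lift)
  qed
qed

theorem theorem21: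
  shows "is_nome_inverse nome_inv \<and>
    is_log_continuation log_one_minus_nome_inv \<and>
    riemann_surface Omega_topology Omega_atlas \<and>
    bij_betw phi_lift (ball 0 1) Omega \<and>
    biholomorphic_between Omega_topology Omega_atlas disc_topology disc_atlas psi \<and>
    psi Omega_origin = 0 \<and>
    (\<forall>P\<in>Omega. phi (psi P) = Omega_proj P)"
proof -
  have "inv_into Omega psi z = phi_lift z" if "norm z < 1" for z
    unfolding psi_def using that by (intro inv_into_inv_into_eq[OF phi_lift_bij]) simp
  then have "biholomorphic_between Omega_topology Omega_atlas disc_topology disc_atlas psi"
    unfolding biholomorphic_between_def
    using psi_bij psi_holomorphic phi_lift_holomorphic[of "inv_into Omega psi"] by simp
  moreover have "psi Omega_origin = 0" by (simp add: Omega_origin_eq psi_phi_lift)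
  ultimately show ?thesis
    using nome_inv_works log_continuation_works Omega_riemann_surface phi_lift_bij phi_psi by blast
qed

end
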